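(* Let $q$ be a nonzero complex parameter. Let $\{a_n, c_n, Q_a, Q_c \mid n\in\mathbf{Z}\}$ be two sets of bosonic oscillators satisfying $$[a_n,a_m]=\delta_{n+m,0}(-1)^n\frac{[n]_q^2}{n},\quad [a_0,Q_a]=1,\qquad [c_n,c_m]=\delta_{n+m,0}\frac{[n]_q^2}{n},\quad [c_0,Q_c]=1$$ (the $[a_n,a_m]$ and $[c_n,c_m]$ formulas being for $n\neq0$), all remaining commutators being zero, where $[n]_q=(q^n-q^{-n})/(q-q^{-1})$. Introduce the $q$-deformed free boson fields $$a(z;\kappa)=Q_a+a_0\ln z-\sum_{n\neq0}\frac{a_n}{[n]_q}q^{\kappa|n|}z^{-n},\qquad c(z)=Q_c+c_0\ln z-\sum_{n\neq0}\frac{c_n}{[n]_q}z^{-n},$$ and set $$a_\pm(z)=\pm(q-q^{-1})\sum_{n>0}a_{\pm n}z^{\mp n}\pm a_0\ln q .$$ Then the Drinfeld generators of $U_q[osp(2|2)^{(2)}]$ at level one (central element $c$ equal to $1$) have the following nonclassical realization by the free boson fields: $$\psi^\pm(z)=e^{a_\pm(z)},\qquad X^\pm(z)={:}e^{\pm a(z;\mp\frac12)}\,Y^\pm(z){:}\,F^\pm,$$ where $F^+=q^{1/2}+q^{-1/2}$, $F^-=\dfrac{1}{q-q^{-1}}$, and $$Y^+(z)=e^{c(q^{1/2}z)}+e^{-c(-q^{-1/2}z)},\qquad Y^-(z)=e^{c(-q^{1/2}z)}+e^{-c(q^{-1/2}z)}.$$ That is, these bosonized currents satisfy the defining relations of $U_q[osp(2|2)^{(2)}]$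 (listed in the context) with $c=1$. The realization is nonclassical in the sense that $X^-(z)$ so defined does not have a classical, i.e. $q\to1$, limit.
   Context: Drinfeld definition. $U_q[osp(2|2)^{(2)}]$ is the associative $\mathbf{Z}_2$-graded algebra with unit generated by the currents $X^\pm(z)=\sum_{n\in\mathbf{Z}}X^\pm_n z^{-n-1}$ (odd), $\psi^\pm(z)=K^{\pm1}\exp\big(\pm(q-q^{-1})\sum_{n>0}H_{\pm n}z^{\mp n}\big)$ (even, invertible), and a central element $c$ (even). With $z_\pm=zq^{\pm c/2}$, $w_\pm=wq^{\pm c/2}$, $\{A,B\}=AB+BA$ and the formal delta function $\delta(z)=\sum_{l\in\mathbf{Z}}z^l$, the relations are $$\psi^\pm(z)\psi^\pm(w)=\psi^\pm(w)\psi^\pm(z),$$ $$\psi^+(z)\psi^-(w)=\frac{(z_+q+w_-)(z_-+w_+q)}{(z_++w_-q)(z_-q+w_+)}\,\psi^-(w)\psi^+(z),$$ $$\psi^\pm(z)^{-1}X^+(w)\psi^\pm(z)=\frac{z_\pm+wq}{z_\pm q+w}X^+(w),\qquad \psi^\pm(z)X^-(w)\psi^\pm(z)^{-1}=\frac{z_\mp+wq}{z_\mp q+w}X^-(w),$$ $$(z+wq^{\pm1})X^\pm(z)X^\pm(w)+(zq^{\pm1}+w)X^\pm(w)X^\pm(z)=0,$$ $$\{X^+(z),X^-(w)\}=\frac{1}{(q-q^{-1})zw}\Big[\delta\big(\tfrac wz q^{c}\big)\psi^+(w_+)-\delta\big(\tfrac wz q^{-c}\big)\psi^-(z_+)\Big].$$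 "Level one" means $c=1$. The colons ${:}\ {:}$ denote the usual bosonic normal ordering: $Q_a,Q_c$ and $a_n,c_n$ with $n<0$ are placed to the left of $a_0,c_0$ and of $a_n,c_n$ with $n>0$.
   Formalization: The sign of F^- is corrected to -1/(q-q^{-1}): as printed, the {X^+,X^-} relation fails by a sign on the Fock vacuum. Also q is not a root of unity, a_0 and c_0 are diagonalizable with integer eigenvalues, exp(Q) replaces Q, and each vector is killed by annihilators of large total degree. *)

theory Defs
  imports
    Complex_Main
    "HOL-Library.Multiset"
    "HOL-Library.Poly_Mapping"
    "HOL-Computational_Algebra.Formal_Power_Series"
begin

section \<open>Formal series with operator coefficients\<close>

text \<open>
  A current \<open>A(z) = \<Sum>k. A\<^sub>k z\<^sup>k\<close> on a complex vector space \<open>'v\<close> (with scalar multiplication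
  \<open>scale\<close>) is the family of its coefficients, indexed by the power of \<open>z\<close>; in two variables the
  indices are the powers of \<open>z\<close> and of \<open>w\<close>. Thus the mode \<open>X\<^sub>n\<close> of \<open>X(z) = \<Sum>n. X\<^sub>n z\<^sup>-\<^sup>n\<^sup>-\<^sup>1\<close> is
  the coefficient with index \<open>-n-1\<close>. The sums \<^const>\<open>Sum_any\<close> below run over all integers; in
  every use they have only finitely many nonzero terms when applied to a vector.
\<close>

type_synonym 'v ser = "int \<Rightarrow> 'v \<Rightarrow> 'v"
type_synonym 'v ser2 = "int \<Rightarrow> int \<Rightarrow> 'v \<Rightarrow> 'v"

definition ser_one :: "'v::zero ser" where
  "ser_one k v = (if k = 0 then v else 0)"

definition ser_mult :: "'v::ab_group_add ser \<Rightarrow> 'v ser \<Rightarrow> 'v ser" where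
  "ser_mult A B k v = Sum_any (\<lambda>i. A i (B (k - i) v))"

text \<open>\<open>\<Sum>n\<ge>0. A\<^sub>n z\<^sup>n\<close> and \<open>\<Sum>n\<ge>0. A\<^sub>n z\<^sup>-\<^sup>n\<close> as two-sided series.\<close>

definition ser_up :: "(nat \<Rightarrow> 'v \<Rightarrow> 'v) \<Rightarrow> 'v::zero ser" where
  "ser_up A k v = (if k \<ge> 0 then A (nat k) v else 0)"

definition ser_down :: "(nat \<Rightarrow> 'v \<Rightarrow> 'v) \<Rightarrow> 'v::zero ser" where
  "ser_down A k v = (if k \<le> 0 then A (nat (- k)) v else 0)"

text \<open>
  \<open>op_pow A k m\<close> is the coefficient of \<open>x\<^sup>m\<close> in \<open>(\<Sum>n>0. A\<^sub>n x\<^sup>n)\<^sup>k\<close>, and \<open>op_exp A m\<close> the one in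
  \<open>exp (\<Sum>n>0. A\<^sub>n x\<^sup>n)\<close>; the value \<open>A 0\<close> is never used.
\<close>

primrec op_pow :: "(nat \<Rightarrow> 'v::ab_group_add \<Rightarrow> 'v) \<Rightarrow> nat \<Rightarrow> nat \<Rightarrow> 'v \<Rightarrow> 'v" where
  "op_pow A 0 = (\<lambda>m v. if m = 0 then v else 0)"
| "op_pow A (Suc k) = (\<lambda>m v. \<Sum>i=1..m. A i (op_pow A k (m - i) v))"

definition op_exp :: "(complex \<Rightarrow> 'v \<Rightarrow> 'v) \<Rightarrow> (nat \<Rightarrow> 'v::ab_group_add \<Rightarrow> 'v) \<Rightarrow> nat \<Rightarrow> 'v \<Rightarrow> 'v" where
  "op_exp scale A m v = (\<Sum>k\<le>m. scale (1 / fact k) (op_pow A k m v))"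

text \<open>\<open>A(tz)\<close>, and \<open>A(z)\<close>, \<open>A(w)\<close> as series in two variables.\<close>

definition dilate :: "(complex \<Rightarrow> 'v \<Rightarrow> 'v) \<Rightarrow> complex \<Rightarrow> 'v ser \<Rightarrow> 'v ser" where
  "dilate scale t A k v = scale (t powi k) (A k v)"

definition in_z :: "'v::zero ser \<Rightarrow> 'v ser2" where
  "in_z A i j v = (if j = 0 then A i v else 0)"

definition in_w :: "'v::zero ser \<Rightarrow> 'v ser2" where
  "in_w A i j v = (if i = 0 then A j v else 0)"

text \<open>\<open>A(z) B(w)\<close>, then \<open>A(w) B(z)\<close>, then \<open>A(z) B(w) C(z)\<close>.\<close>

definition prod_zw :: "'v ser \<Rightarrow> 'v ser \<Rightarrow> 'v ser2" where
  "prod_zw A B i j v = A i (B j v)"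

definition prod_wz :: "'v ser \<Rightarrow> 'v ser \<Rightarrow> 'v ser2" where
  "prod_wz A B i j v = A j (B i v)"

definition prod_zwz :: "'v::ab_group_add ser \<Rightarrow> 'v ser \<Rightarrow> 'v ser \<Rightarrow> 'v ser2" where
  "prod_zwz A B C i j v = Sum_any (\<lambda>k. A k (B j (C (i - k) v)))"

text \<open>Product of a scalar series \<open>S(z,w)\<close> with an operator-valued series \<open>D(z,w)\<close>.\<close>

definition smult2 ::
    "(complex \<Rightarrow> 'v \<Rightarrow> 'v) \<Rightarrow> (int \<Rightarrow> int \<Rightarrow> complex) \<Rightarrow> 'v::ab_group_add ser2 \<Rightarrow> 'v ser2" where
  "smult2 scale S D i j v = Sum_any (\<lambda>(k, l). scale (S k l) (D (i - k) (j - l) v))"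

text \<open>The scalar series \<open>\<alpha>z + \<beta>w\<close> and \<open>\<delta>(b w/z)\<close>.\<close>

definition lin_zw :: "complex \<Rightarrow> complex \<Rightarrow> int \<Rightarrow> int \<Rightarrow> complex" where
  "lin_zw \<alpha> \<beta> i j = (if i = 1 \<and> j = 0 then \<alpha> else if i = 0 \<and> j = 1 then \<beta> else 0)"

definition delta_wz :: "complex \<Rightarrow> int \<Rightarrow> int \<Rightarrow> complex" where
  "delta_wz b i j = (if i + j = 0 then b powi j else 0)"

text \<open>
  A rational function of degree \<open>0\<close> in \<open>(z,w)\<close> is expanded in \<open>u = w/z\<close> (\<open>expand_wz\<close>) or in
  \<open>u = z/w\<close> (\<open>expand_zw\<close>), where it is a quotient of products of linear forms \<open>lin_u \<alpha> \<beta> = \<alpha> + \<beta>u\<close>.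
\<close>

definition lin_u :: "complex \<Rightarrow> complex \<Rightarrow> complex fps" where
  "lin_u \<alpha> \<beta> = fps_const \<alpha> + fps_const \<beta> * fps_X"

definition expand_wz :: "complex fps \<Rightarrow> int \<Rightarrow> int \<Rightarrow> complex" where
  "expand_wz f i j = (if i + j = 0 \<and> j \<ge> 0 then fps_nth f (nat j) else 0)"

definition expand_zw :: "complex fps \<Rightarrow> int \<Rightarrow> int \<Rightarrow> complex" where
  "expand_zw f i j = (if i + j = 0 \<and> i \<ge> 0 then fps_nth f (nat i) else 0)"


section \<open>The Drinfeld relations of \<open>U\<^sub>q[osp(2|2)\<^sup>(\<^sup>2\<^sup>)]\<close>\<close>

text \<open>
  The central element \<open>c\<close> acts as a scalar and \<open>t\<close> is the value of \<open>q\<^sup>c\<^sup>/\<^sup>2\<close>, so that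
  \<open>z\<^sub>\<plusminus> = z t\<^sup>\<plusminus>\<^sup>1\<close>; at level one \<open>t\<close> is a square root of \<open>q\<close>. The operator \<open>P\<close> is the parity of
  the graded representation space. Since \<open>\<psi>\<^sup>+(z)\<close> and \<open>\<psi>\<^sup>-(z)\<close> are series in \<open>1/z\<close> and in \<open>z\<close>,
  the structure functions have to be expanded in \<open>w/z\<close> in the relations that contain \<open>\<psi>\<^sup>+(z)\<close>,
  and in \<open>z/w\<close> in those between \<open>\<psi>\<^sup>-(z)\<close> and \<open>X\<^sup>\<plusminus>(w)\<close>. The inverses \<open>\<psi>\<^sup>\<plusminus>(z)\<^sup>-\<^sup>1\<close> are inverses
  among series in \<open>1/z\<close> and in \<open>z\<close>, respectively.
\<close>

definition psi_form ::
    "(complex \<Rightarrow> 'v \<Rightarrow> 'v) \<Rightarrow> complex \<Rightarrow> 'v::ab_group_add ser \<Rightarrow> 'v ser \<Rightarrow> bool" where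
  "psi_form scale q psip psim \<longleftrightarrow>
     (\<exists>K H. bij K \<and> Vector_Spaces.linear scale scale K \<and>
        (\<forall>n::int. n \<noteq> 0 \<longrightarrow> Vector_Spaces.linear scale scale (H n)) \<and>
        (\<forall>k v. psip k v =
           K (ser_down (op_exp scale (\<lambda>n v. scale (q - inverse q) (H (int n) v))) k v)) \<and>
        (\<forall>k v. psim k v =
           inv K (ser_up (op_exp scale (\<lambda>n v. scale (- (q - inverse q)) (H (- int n) v))) k v)))"

definition ser_inverse :: "'v::ab_group_add ser \<Rightarrow> 'v ser \<Rightarrow> bool" where
  "ser_inverse A B \<longleftrightarrow> ser_mult A B = ser_one \<and> ser_mult B A = ser_one"

definition drinfeld_osp22 ::
    "(complex \<Rightarrow> 'v \<Rightarrow> 'v) \<Rightarrow> complex \<Rightarrow> complex \<Rightarrow> ('v \<Rightarrow> 'v) \<Rightarrow>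
     'v::ab_group_add ser \<Rightarrow> 'v ser \<Rightarrow> 'v ser \<Rightarrow> 'v ser \<Rightarrow> bool" where
  "drinfeld_osp22 scale q t P psip psim Xp Xm \<longleftrightarrow>
     vector_space scale \<and>
     Vector_Spaces.linear scale scale P \<and> P \<circ> P = id \<and>
     (\<forall>k. Vector_Spaces.linear scale scale (Xp k) \<and> Vector_Spaces.linear scale scale (Xm k)) \<and>
     (\<forall>k v. psip k (P v) = P (psip k v) \<and> psim k (P v) = P (psim k v)) \<and>
     (\<forall>k v. Xp k (P v) = - P (Xp k v) \<and> Xm k (P v) = - P (Xm k v)) \<and>
     psi_form scale q psip psim \<and>
     prod_zw psip psip = prod_wz psip psip \<and>
     prod_zw psim psim = prod_wz psim psim \<and>
     prod_zw psip psim =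
       smult2 scale
         (expand_wz ((lin_u (t * q) (inverse t) * lin_u (inverse t) (t * q)) /
                     (lin_u t (inverse t * q) * lin_u (inverse t * q) t)))
         (prod_wz psim psip) \<and>
     (\<exists>ipsip ipsim.
        (\<forall>k v. k > 0 \<longrightarrow> ipsip k v = 0) \<and> ser_inverse psip ipsip \<and>
        (\<forall>k v. k < 0 \<longrightarrow> ipsim k v = 0) \<and> ser_inverse psim ipsim \<and>
        prod_zwz ipsip Xp psip =
          smult2 scale (expand_wz (lin_u t q / lin_u (t * q) 1)) (in_w Xp) \<and>
        prod_zwz ipsim Xp psim =
          smult2 scale (expand_zw (lin_u q (inverse t) / lin_u 1 (inverse t * q))) (in_w Xp) \<and>
        prod_zwz psip Xm ipsip =
          smult2 scale (expand_wz (lin_u (inverse t) q / lin_u (inverse t * q) 1)) (in_w Xm) \<and>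
        prod_zwz psim Xm ipsim =
          smult2 scale (expand_zw (lin_u q t / lin_u 1 (t * q))) (in_w Xm)) \<and>
     (\<forall>i j v. smult2 scale (lin_zw 1 q) (prod_zw Xp Xp) i j v
            + smult2 scale (lin_zw q 1) (prod_wz Xp Xp) i j v = 0) \<and>
     (\<forall>i j v. smult2 scale (lin_zw 1 (inverse q)) (prod_zw Xm Xm) i j v
            + smult2 scale (lin_zw (inverse q) 1) (prod_wz Xm Xm) i j v = 0) \<and>
     \<comment> \<open>the factor \<open>1/(zw)\<close> shifts both indices on the right-hand side by one\<close>
     (\<forall>i j v. prod_zw Xp Xm i j v + prod_wz Xm Xp i j v =
        scale (1 / (q - inverse q))
          (smult2 scale (delta_wz (t\<^sup>2)) (in_w (dilate scale t psip)) (i + 1) (j + 1) v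
         - smult2 scale (delta_wz (inverse (t\<^sup>2))) (in_z (dilate scale t psim)) (i + 1) (j + 1) v))"


section \<open>Bosonic oscillators\<close>

definition qint :: "complex \<Rightarrow> int \<Rightarrow> complex" where
  "qint q n = (q powi n - q powi (- n)) / (q - inverse q)"

text \<open>
  Only the exponentials \<open>e\<^sup>Q\<close> of the operators \<open>Q\<close> enter the currents, and \<open>Q\<close> itself cannot
  act on a space on which \<open>a\<^sub>0\<close> is diagonalizable; hence \<open>eQa\<close> and \<open>eQc\<close> stand for \<open>exp Q\<^sub>a\<close> and
  \<open>exp Q\<^sub>c\<close>, and \<open>[a\<^sub>0, Q\<^sub>a] = 1\<close> is replaced by \<open>[a\<^sub>0, exp Q\<^sub>a] = exp Q\<^sub>a\<close>. Integrality of the spectra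
  of \<open>a\<^sub>0\<close> and \<open>c\<^sub>0\<close> gives meaning to \<open>z\<close> to the power \<open>a\<^sub>0\<close>, \<open>q\<close> to the power \<open>a\<^sub>0\<close> and \<open>xz\<close> to the
  power \<open>c\<^sub>0\<close>; the last assumption (every vector is killed by products of annihilation operators
  of large total degree) makes normally ordered exponentials well defined. Both hold in the
  Fock space below.
\<close>

locale boson_oscillators = vector_space scale
  for scale :: "complex \<Rightarrow> 'v::ab_group_add \<Rightarrow> 'v" +
  fixes q :: complex
    and a c :: "int \<Rightarrow> 'v \<Rightarrow> 'v"
    and eQa eQc :: "'v \<Rightarrow> 'v"
  assumes linear_a: "Vector_Spaces.linear scale scale (a n)"
    and linear_c: "Vector_Spaces.linear scale scale (c n)"
    and linear_eQa: "Vector_Spaces.linear scale scale eQa"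
    and linear_eQc: "Vector_Spaces.linear scale scale eQc"
    and bij_eQa: "bij eQa"
    and bij_eQc: "bij eQc"
    and comm_aa: "n \<noteq> 0 \<Longrightarrow> m \<noteq> 0 \<Longrightarrow>
      a n (a m v) - a m (a n v) =
        scale (if n + m = 0 then (-1) powi n * (qint q n)\<^sup>2 / of_int n else 0) v"
    and comm_cc: "n \<noteq> 0 \<Longrightarrow> m \<noteq> 0 \<Longrightarrow>
      c n (c m v) - c m (c n v) =
        scale (if n + m = 0 then (qint q n)\<^sup>2 / of_int n else 0) v"
    and comm_a0: "a 0 (a n v) = a n (a 0 v)"
    and comm_c0: "c 0 (c n v) = c n (c 0 v)"
    and comm_ac: "a n (c m v) = c m (a n v)"
    and comm_a0_eQa: "a 0 (eQa v) - eQa (a 0 v) = eQa v"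
    and comm_c0_eQc: "c 0 (eQc v) - eQc (c 0 v) = eQc v"
    and comm_a_eQa: "n \<noteq> 0 \<Longrightarrow> a n (eQa v) = eQa (a n v)"
    and comm_c_eQc: "n \<noteq> 0 \<Longrightarrow> c n (eQc v) = eQc (c n v)"
    and comm_a_eQc: "a n (eQc v) = eQc (a n v)"
    and comm_c_eQa: "c n (eQa v) = eQa (c n v)"
    and comm_eQ: "eQa (eQc v) = eQc (eQa v)"
    and diag_a0: "v \<in> span {u. \<exists>m. a 0 u = scale (of_int m) u}"
    and diag_c0: "v \<in> span {u. \<exists>m. c 0 u = scale (of_int m) u}"
    and smooth: "\<exists>N. \<forall>ns ms. (\<forall>n \<in> set ns \<union> set ms. n > 0) \<longrightarrow> sum_list ns + sum_list ms > N \<longrightarrow>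
      foldr a ns (foldr c ms v) = 0"


section \<open>The bosonized currents\<close>

text \<open>
  \<open>eig_proj scale A m\<close> is the projection onto the eigenspace of \<open>A\<close> for the eigenvalue \<open>m\<close>, that
  is, the coefficient of \<open>z\<^sup>m\<close> in \<open>z\<close> to the power \<open>A\<close>; \<open>op_powi scale x A\<close> is \<open>x\<close> to the power
  \<open>A\<close>, and \<open>ser_zpow scale A \<epsilon> x\<close> is \<open>xz\<close> to the power \<open>\<epsilon>A\<close>, where \<open>\<epsilon> = \<plusminus>1\<close>.
\<close>

definition eig_proj :: "(complex \<Rightarrow> 'v \<Rightarrow> 'v) \<Rightarrow> ('v::ab_group_add \<Rightarrow> 'v) \<Rightarrow> int \<Rightarrow> 'v \<Rightarrow> 'v" where
  "eig_proj scale A m = (THE T. Vector_Spaces.linear scale scale T \<and>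
     (\<forall>k u. A u = scale (of_int k) u \<longrightarrow> T u = (if k = m then u else 0)))"

definition op_powi :: "(complex \<Rightarrow> 'v \<Rightarrow> 'v) \<Rightarrow> complex \<Rightarrow> ('v::ab_group_add \<Rightarrow> 'v) \<Rightarrow> 'v \<Rightarrow> 'v" where
  "op_powi scale x A v = Sum_any (\<lambda>m. scale (x powi m) (eig_proj scale A m v))"

definition ser_zpow ::
    "(complex \<Rightarrow> 'v \<Rightarrow> 'v) \<Rightarrow> ('v::ab_group_add \<Rightarrow> 'v) \<Rightarrow> int \<Rightarrow> complex \<Rightarrow> 'v ser" where
  "ser_zpow scale A \<epsilon> x k v = scale (x powi k) (eig_proj scale A (\<epsilon> * k) v)"

definition exp_charge :: "('v \<Rightarrow> 'v) \<Rightarrow> int \<Rightarrow> 'v \<Rightarrow> 'v" where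
  "exp_charge eQ \<epsilon> = (if \<epsilon> \<ge> 0 then eQ ^^ nat \<epsilon> else inv eQ ^^ nat (- \<epsilon>))"

text \<open>\<open>exp (a\<^sub>+(z))\<close> and \<open>exp (a\<^sub>-(z))\<close>; the two summands of \<open>a\<^sub>\<plusminus>(z)\<close> commute.\<close>

definition psi_plus ::
    "(complex \<Rightarrow> 'v \<Rightarrow> 'v) \<Rightarrow> complex \<Rightarrow> (int \<Rightarrow> 'v \<Rightarrow> 'v) \<Rightarrow> 'v::ab_group_add ser" where
  "psi_plus scale q a k v = op_powi scale q (a 0)
     (ser_down (op_exp scale (\<lambda>n v. scale (q - inverse q) (a (int n) v))) k v)"

definition psi_minus ::
    "(complex \<Rightarrow> 'v \<Rightarrow> 'v) \<Rightarrow> complex \<Rightarrow> (int \<Rightarrow> 'v \<Rightarrow> 'v) \<Rightarrow> 'v::ab_group_add ser" where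
  "psi_minus scale q a k v = op_powi scale (inverse q) (a 0)
     (ser_up (op_exp scale (\<lambda>n v. scale (- (q - inverse q)) (a (- int n) v))) k v)"

text \<open>
  \<open>vertex scale q r a c eQa eQc \<epsilon> h \<eta> x\<close> is the normally ordered exponential
  \<open>:exp (\<epsilon> a(z; h/2) + \<eta> c(xz)):\<close> for signs \<open>\<epsilon>\<close>, \<open>\<eta>\<close>, where \<open>r\<close> is the chosen square root of \<open>q\<close>.
  The arguments of the two exponentials are the parts of \<open>\<epsilon> a(z; h/2) + \<eta> c(xz)\<close> with negative
  and with positive modes, as series in \<open>z\<close> and in \<open>1/z\<close>.
\<close>

definition vertex ::
    "(complex \<Rightarrow> 'v \<Rightarrow> 'v) \<Rightarrow> complex \<Rightarrow> complex \<Rightarrow>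
     (int \<Rightarrow> 'v \<Rightarrow> 'v) \<Rightarrow> (int \<Rightarrow> 'v \<Rightarrow> 'v) \<Rightarrow> ('v \<Rightarrow> 'v) \<Rightarrow> ('v \<Rightarrow> 'v) \<Rightarrow>
     int \<Rightarrow> int \<Rightarrow> int \<Rightarrow> complex \<Rightarrow> 'v::ab_group_add ser" where
  "vertex scale q r a c eQa eQc \<epsilon> h \<eta> x =
     ser_mult
       (ser_up (op_exp scale (\<lambda>n v.
          scale (- (of_int \<epsilon> * r powi (h * int n) / qint q (- int n))) (a (- int n) v)
        + scale (- (of_int \<eta> * x powi int n / qint q (- int n))) (c (- int n) v))))
       (\<lambda>k v. exp_charge eQa \<epsilon> (exp_charge eQc \<eta>
          (ser_mult (ser_zpow scale (a 0) \<epsilon> 1)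
            (ser_mult (ser_zpow scale (c 0) \<eta> x)
              (ser_down (op_exp scale (\<lambda>n v.
                 scale (- (of_int \<epsilon> * r powi (h * int n) / qint q (int n))) (a (int n) v)
               + scale (- (of_int \<eta> * x powi (- int n) / qint q (int n))) (c (int n) v))))) k v)))"

definition F_plus :: "complex \<Rightarrow> complex" where
  "F_plus r = r + inverse r"

text \<open>
  The sign of \<open>F\<^sup>-\<close> is forced by the relation between \<open>X\<^sup>+\<close> and \<open>X\<^sup>-\<close>: with
  \<open>F\<^sup>- = 1/(q - q\<^sup>-\<^sup>1)\<close>, as it is stated in the literature, the right-hand side of that relation
  comes out with the opposite sign. Indeed, on the Fock vacuum \<open>v\<close> one has \<open>X\<^sup>+\<^sub>1 v = 0\<close>, and the
  component along \<open>v\<close> of \<open>X\<^sup>+\<^sub>1 X\<^sup>-\<^sub>-\<^sub>1 v\<close> is \<open>F\<^sup>+ F\<^sup>- (r\<^sup>-\<^sup>1 - r)\<close>, where \<open>r\<^sup>2 = q\<close>; the relation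
  requires it to be \<open>(q - q\<^sup>-\<^sup>1)/(q - q\<^sup>-\<^sup>1) = 1\<close>, so that \<open>F\<^sup>- = -1/(q - q\<^sup>-\<^sup>1)\<close>.
\<close>

definition F_minus :: "complex \<Rightarrow> complex" where
  "F_minus q = - (1 / (q - inverse q))"

definition X_plus ::
    "(complex \<Rightarrow> 'v \<Rightarrow> 'v) \<Rightarrow> complex \<Rightarrow> complex \<Rightarrow>
     (int \<Rightarrow> 'v \<Rightarrow> 'v) \<Rightarrow> (int \<Rightarrow> 'v \<Rightarrow> 'v) \<Rightarrow> ('v \<Rightarrow> 'v) \<Rightarrow> ('v \<Rightarrow> 'v) \<Rightarrow> 'v::ab_group_add ser" where
  "X_plus scale q r a c eQa eQc k v = scale (F_plus r)
     (vertex scale q r a c eQa eQc 1 (-1) 1 r k v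
    + vertex scale q r a c eQa eQc 1 (-1) (-1) (- inverse r) k v)"

definition X_minus ::
    "(complex \<Rightarrow> 'v \<Rightarrow> 'v) \<Rightarrow> complex \<Rightarrow> complex \<Rightarrow>
     (int \<Rightarrow> 'v \<Rightarrow> 'v) \<Rightarrow> (int \<Rightarrow> 'v \<Rightarrow> 'v) \<Rightarrow> ('v \<Rightarrow> 'v) \<Rightarrow> ('v \<Rightarrow> 'v) \<Rightarrow> 'v::ab_group_add ser" where
  "X_minus scale q r a c eQa eQc k v = scale (F_minus q)
     (vertex scale q r a c eQa eQc (-1) 1 1 (- r) k v
    + vertex scale q r a c eQa eQc (-1) 1 (-1) (inverse r) k v)"


section \<open>The Fock space\<close>

text \<open>
  The basis vector \<open>(M, N, m, l)\<close> is the product of the creation operators \<open>a\<^sub>-\<^sub>k\<^sub>-\<^sub>1\<close> (\<open>k\<close> in the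
  multiset \<open>M\<close>) and \<open>c\<^sub>-\<^sub>k\<^sub>-\<^sub>1\<close> (\<open>k\<close> in \<open>N\<close>) applied to \<open>exp (m Q\<^sub>a + l Q\<^sub>c)\<close> times the vacuum. The
  basis does not depend on \<open>q\<close>, so that operators for different \<open>q\<close> can be compared.
\<close>

type_synonym fock_index = "nat multiset \<times> nat multiset \<times> int \<times> int"
type_synonym fock = "fock_index \<Rightarrow>\<^sub>0 complex"

definition fock_scale :: "complex \<Rightarrow> fock \<Rightarrow> fock" where
  "fock_scale x = Poly_Mapping.map ((*) x)"

definition fock_extend :: "(fock_index \<Rightarrow> fock) \<Rightarrow> fock \<Rightarrow> fock" where
  "fock_extend f v = (\<Sum>b \<in> Poly_Mapping.keys v. fock_scale (Poly_Mapping.lookup v b) (f b))"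

definition fock_a :: "complex \<Rightarrow> int \<Rightarrow> fock \<Rightarrow> fock" where
  "fock_a q n = fock_extend (\<lambda>(M, N, m, l).
     if n < 0 then Poly_Mapping.single (add_mset (nat (- n) - 1) M, N, m, l) 1
     else if n = 0 then Poly_Mapping.single (M, N, m, l) (of_int m)
     else Poly_Mapping.single (M - {#nat n - 1#}, N, m, l)
       (of_nat (count M (nat n - 1)) * ((-1) powi n * (qint q n)\<^sup>2 / of_int n)))"

definition fock_c :: "complex \<Rightarrow> int \<Rightarrow> fock \<Rightarrow> fock" where
  "fock_c q n = fock_extend (\<lambda>(M, N, m, l).
     if n < 0 then Poly_Mapping.single (M, add_mset (nat (- n) - 1) N, m, l) 1
     else if n = 0 then Poly_Mapping.single (M, N, m, l) (of_int l)
     else Poly_Mapping.single (M, N - {#nat n - 1#}, m, l)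
       (of_nat (count N (nat n - 1)) * ((qint q n)\<^sup>2 / of_int n)))"

definition fock_eQa :: "fock \<Rightarrow> fock" where
  "fock_eQa = fock_extend (\<lambda>(M, N, m, l). Poly_Mapping.single (M, N, m + 1, l) 1)"

definition fock_eQc :: "fock \<Rightarrow> fock" where
  "fock_eQc = fock_extend (\<lambda>(M, N, m, l). Poly_Mapping.single (M, N, m, l + 1) 1)"

text \<open>
  A \<open>q\<close>-dependent current has a classical limit if all matrix elements of all its modes converge
  as \<open>q\<close> tends to \<open>1\<close> through the values that are not roots of unity.
\<close>

definition has_classical_limit :: "(complex \<Rightarrow> fock ser) \<Rightarrow> bool" where
  "has_classical_limit X \<longleftrightarrow>
     (\<forall>k v b. \<exists>L. ((\<lambda>q. Poly_Mapping.lookup (X q k v) b) \<longlongrightarrow> L)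
        (at 1 within {q. \<forall>n>0. q ^ n \<noteq> 1}))"

section \<open>The Fock space satisfies the oscillator relations\<close>

lemma lookup_fock_scale: "Poly_Mapping.lookup (fock_scale x v) b = x * Poly_Mapping.lookup v b"
  unfolding fock_scale_def by (simp add: Poly_Mapping.map.rep_eq when_def)

interpretation fock: vector_space fock_scale
  by standard (auto intro!: poly_mapping_eqI simp: lookup_fock_scale lookup_add algebra_simps)

lemma fock_linear_iff: "Vector_Spaces.linear fock_scale fock_scale f \<longleftrightarrow>
    (\<forall>v w. f (v + w) = f v + f w) \<and> (\<forall>x v. f (fock_scale x v) = fock_scale x (f v))"
  by (simp add: Vector_Spaces.linear_iff fock.vector_space_axioms)

lemma fock_scale_single: "fock_scale x (Poly_Mapping.single b y) = Poly_Mapping.single b (x * y)"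
  by (rule poly_mapping_eqI) (simp add: lookup_fock_scale lookup_single when_def)

lemma fock_expand:
  "v = (\<Sum>b \<in> Poly_Mapping.keys v. Poly_Mapping.single b (Poly_Mapping.lookup v b))"
  by (rule poly_mapping_eqI) (simp add: lookup_sum lookup_single when_def in_keys_iff)

lemma fock_induct [case_names zero single add]:
  assumes "P 0" and "\<And>b x. P (Poly_Mapping.single b x)" and "\<And>v w. P v \<Longrightarrow> P w \<Longrightarrow> P (v + w)"
  shows "P (v :: fock)"
proof -
  have "P (\<Sum>b \<in> S. Poly_Mapping.single b (Poly_Mapping.lookup v b))" if "finite S" for S
    using that by (induction S) (auto intro: assms)
  from this[OF finite_keys] show ?thesis by (metis fock_expand)
qed

lemma fock_extend_superset:
  assumes "finite S" "Poly_Mapping.keys v \<subseteq> S"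
  shows "fock_extend f v = (\<Sum>b \<in> S. fock_scale (Poly_Mapping.lookup v b) (f b))"
  unfolding fock_extend_def
  by (rule sum.mono_neutral_left) (use assms in \<open>auto simp: in_keys_iff\<close>)

lemma linear_fock_extend: "Vector_Spaces.linear fock_scale fock_scale (fock_extend f)"
  unfolding fock_linear_iff
proof (intro conjI allI)
  fix v w :: fock and x
  let ?S = "Poly_Mapping.keys v \<union> Poly_Mapping.keys w"
  have "Poly_Mapping.keys (v + w) \<subseteq> ?S" by (rule Poly_Mapping.keys_add)
  then show "fock_extend f (v + w) = fock_extend f v + fock_extend f w"
    by (simp add: fock_extend_superset[of ?S] lookup_add fock.scale_left_distrib sum.distrib)
  have "Poly_Mapping.keys (fock_scale x v) \<subseteq> Poly_Mapping.keys v"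
    by (auto simp: in_keys_iff lookup_fock_scale)
  then show "fock_extend f (fock_scale x v) = fock_scale x (fock_extend f v)"
    by (simp add: fock_extend_superset[of "Poly_Mapping.keys v"] lookup_fock_scale
        fock.scale_sum_right)
qed

lemma fock_extend_single [simp]: "fock_extend f (Poly_Mapping.single b x) = fock_scale x (f b)"
  by (subst fock_extend_superset[of "{b}"]) auto

lemma fock_extend_zero [simp]: "fock_extend f 0 = 0"
  by (simp add: fock_extend_def)

lemma linear_fock_a: "Vector_Spaces.linear fock_scale fock_scale (fock_a q n)"
  and linear_fock_c: "Vector_Spaces.linear fock_scale fock_scale (fock_c q n)"
  and linear_fock_eQa: "Vector_Spaces.linear fock_scale fock_scale fock_eQa"
  and linear_fock_eQc: "Vector_Spaces.linear fock_scale fock_scale fock_eQc"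
  unfolding fock_a_def fock_c_def fock_eQa_def fock_eQc_def by (rule linear_fock_extend)+

lemmas fock_add = linear_fock_a[unfolded fock_linear_iff, THEN conjunct1, rule_format]
  linear_fock_c[unfolded fock_linear_iff, THEN conjunct1, rule_format]
  linear_fock_eQa[unfolded fock_linear_iff, THEN conjunct1, rule_format]
  linear_fock_eQc[unfolded fock_linear_iff, THEN conjunct1, rule_format]

lemma fock_zero: "fock_a q n 0 = 0" "fock_c q n 0 = 0" "fock_eQa 0 = 0" "fock_eQc 0 = 0"
  by (simp_all add: fock_a_def fock_c_def fock_eQa_def fock_eQc_def)

lemma qint_minus: "qint q (- n) = - qint q n"
  unfolding qint_def by (metis minus_diff_eq minus_divide_left minus_minus)

lemma fock_comm_aa:
  assumes "n \<noteq> 0" "m \<noteq> 0"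
  shows "fock_a q n (fock_a q m v) - fock_a q m (fock_a q n v) =
    fock_scale (if n + m = 0 then (-1) powi n * (qint q n)\<^sup>2 / of_int n else 0) v"
proof (induction v rule: fock_induct)
  case zero
  then show ?case by (simp add: fock_zero)
next
  case (add v w)
  then show ?case by (simp add: fock_add fock.scale_right_distrib add_diff_add)
next
  case (single b x)
  obtain M N k l where b: "b = (M, N, k, l)" by (cases b)
  have eq: "fock_a q n (fock_a q (- n) (Poly_Mapping.single b x))
      - fock_a q (- n) (fock_a q n (Poly_Mapping.single b x)) =
    fock_scale ((-1) powi n * (qint q n)\<^sup>2 / of_int n) (Poly_Mapping.single b x)" if "n > 0" for n
    using that by (cases "nat n - 1 \<in># M")
      (auto simp: b fock_a_def fock_scale_single single_diff[symmetric] not_in_iff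
        algebra_simps add_divide_distrib)
  have neq: "fock_a q n (fock_a q m (Poly_Mapping.single b x)) =
      fock_a q m (fock_a q n (Poly_Mapping.single b x))" if "n < 0" "m > 0" "n + m \<noteq> 0" for n m
  proof -
    have "nat (- n) - Suc 0 \<noteq> nat m - Suc 0" using that by linarith
    with that show ?thesis
      by (cases "nat m - 1 \<in># M") (auto simp: b fock_a_def fock_scale_single not_in_iff)
  qed
  consider "n < 0" "m < 0" | "n > 0" "m > 0" | "n > 0" "m = - n" | "n < 0" "n = - m"
    | "n < 0" "m > 0" "n + m \<noteq> 0" | "n > 0" "m < 0" "n + m \<noteq> 0"
    using assms by linarith
  then show ?case
  proof cases
    case 1
    then show ?thesis by (simp add: b fock_a_def fock_scale_single add_mset_commute)
  next
    case 2
    then show ?thesis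
      by (cases "n = m") (auto simp: b fock_a_def fock_scale_single diff_right_commute algebra_simps)
  next
    case 3
    then show ?thesis using eq[of n] by simp
  next
    case 4
    then show ?thesis using eq[of m]
      by (simp add: qint_minus power_int_minus_one_minus fock_scale_single single_uminus algebra_simps)
  next
    case 5
    then show ?thesis using neq[of n m] by simp
  next
    case 6
    then show ?thesis using neq[of m n] by simp
  qed
qed

lemma fock_comm_cc:
  assumes "n \<noteq> 0" "m \<noteq> 0"
  shows "fock_c q n (fock_c q m v) - fock_c q m (fock_c q n v) =
    fock_scale (if n + m = 0 then (qint q n)\<^sup>2 / of_int n else 0) v"
proof (induction v rule: fock_induct)
  case zero
  then show ?case by (simp add: fock_zero)
next
  case (add v w)
  then show ?case by (simp add: fock_add fock.scale_right_distrib add_diff_add)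
next
  case (single b x)
  obtain M N k l where b: "b = (M, N, k, l)" by (cases b)
  have eq: "fock_c q n (fock_c q (- n) (Poly_Mapping.single b x))
      - fock_c q (- n) (fock_c q n (Poly_Mapping.single b x)) =
    fock_scale ((qint q n)\<^sup>2 / of_int n) (Poly_Mapping.single b x)" if "n > 0" for n
    using that by (cases "nat n - 1 \<in># N")
      (auto simp: b fock_c_def fock_scale_single single_diff[symmetric] not_in_iff
        algebra_simps add_divide_distrib)
  have neq: "fock_c q n (fock_c q m (Poly_Mapping.single b x)) =
      fock_c q m (fock_c q n (Poly_Mapping.single b x))" if "n < 0" "m > 0" "n + m \<noteq> 0" for n m
  proof -
    have "nat (- n) - Suc 0 \<noteq> nat m - Suc 0" using that by linarith
    with that show ?thesis
      by (cases "nat m - 1 \<in># N") (auto simp: b fock_c_def fock_scale_single not_in_iff)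
  qed
  consider "n < 0" "m < 0" | "n > 0" "m > 0" | "n > 0" "m = - n" | "n < 0" "n = - m"
    | "n < 0" "m > 0" "n + m \<noteq> 0" | "n > 0" "m < 0" "n + m \<noteq> 0"
    using assms by linarith
  then show ?case
  proof cases
    case 1
    then show ?thesis by (simp add: b fock_c_def fock_scale_single add_mset_commute)
  next
    case 2
    then show ?thesis
      by (cases "n = m") (auto simp: b fock_c_def fock_scale_single diff_right_commute algebra_simps)
  next
    case 3
    then show ?thesis using eq[of n] by simp
  next
    case 4
    then show ?thesis using eq[of m]
      by (simp add: qint_minus fock_scale_single single_uminus algebra_simps)
  next
    case 5
    then show ?thesis using neq[of n m] by simp
  next
    case 6
    then show ?thesis using neq[of m n] by simp
  qed
qed

lemma fock_single_simps:
  "fock_a q n (Poly_Mapping.single (M, N, m, l) x) =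
     (if n < 0 then Poly_Mapping.single (add_mset (nat (- n) - 1) M, N, m, l) x
      else if n = 0 then Poly_Mapping.single (M, N, m, l) (x * of_int m)
      else Poly_Mapping.single (M - {#nat n - 1#}, N, m, l)
        (x * (of_nat (count M (nat n - 1)) * ((-1) powi n * (qint q n)\<^sup>2 / of_int n))))"
  "fock_c q n (Poly_Mapping.single (M, N, m, l) x) =
     (if n < 0 then Poly_Mapping.single (M, add_mset (nat (- n) - 1) N, m, l) x
      else if n = 0 then Poly_Mapping.single (M, N, m, l) (x * of_int l)
      else Poly_Mapping.single (M, N - {#nat n - 1#}, m, l)
        (x * (of_nat (count N (nat n - 1)) * ((qint q n)\<^sup>2 / of_int n))))"
  "fock_eQa (Poly_Mapping.single (M, N, m, l) x) = Poly_Mapping.single (M, N, m + 1, l) x"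
  "fock_eQc (Poly_Mapping.single (M, N, m, l) x) = Poly_Mapping.single (M, N, m, l + 1) x"
  "fock_scale y (Poly_Mapping.single b x) = Poly_Mapping.single b (y * x)"
  by (simp_all add: fock_a_def fock_c_def fock_eQa_def fock_eQc_def fock_scale_single)

lemma fock_eqI:
  fixes f g :: "fock \<Rightarrow> fock"
  assumes "\<And>b x. f (Poly_Mapping.single b x) = g (Poly_Mapping.single b x)"
    and "f 0 = g 0" and "\<And>v w. f (v + w) = f v + f w" and "\<And>v w. g (v + w) = g v + g w"
  shows "f v = g v"
  by (induction v rule: fock_induct) (simp_all add: assms)

definition fock_deg :: "fock_index \<Rightarrow> int" where
  "fock_deg = (\<lambda>(M, N, m, l). (\<Sum>k\<in>#M. int k + 1) + (\<Sum>k\<in>#N. int k + 1))"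

lemma fock_deg_nonneg: "fock_deg b \<ge> 0"
proof -
  have "(\<Sum>k\<in>#M. int k + 1) \<ge> 0" for M by (induction M) auto
  then show ?thesis by (cases b) (simp add: fock_deg_def)
qed

lemma fock_deg_a:
  assumes "n > 0"
  shows "\<exists>b' x'. fock_a q n (Poly_Mapping.single b x) = Poly_Mapping.single b' x' \<and>
    (x' = 0 \<or> fock_deg b' + n = fock_deg b)"
proof -
  obtain M N k l where b: "b = (M, N, k, l)" by (cases b)
  show ?thesis
  proof (cases "nat n - 1 \<in># M")
    case True
    then obtain L where "M = add_mset (nat n - 1) L" by (metis multi_member_split)
    with assms show ?thesis
      by (fastforce simp: b fock_a_def fock_scale_single fock_deg_def)
  next
    case False
    with assms have "fock_a q n (Poly_Mapping.single b x) = Poly_Mapping.single b 0"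
      by (simp add: b fock_a_def fock_scale_single not_in_iff)
    then show ?thesis by blast
  qed
qed

lemma fock_deg_c:
  assumes "n > 0"
  shows "\<exists>b' x'. fock_c q n (Poly_Mapping.single b x) = Poly_Mapping.single b' x' \<and>
    (x' = 0 \<or> fock_deg b' + n = fock_deg b)"
proof -
  obtain M N k l where b: "b = (M, N, k, l)" by (cases b)
  show ?thesis
  proof (cases "nat n - 1 \<in># N")
    case True
    then obtain L where "N = add_mset (nat n - 1) L" by (metis multi_member_split)
    with assms show ?thesis
      by (fastforce simp: b fock_c_def fock_scale_single fock_deg_def)
  next
    case False
    with assms have "fock_c q n (Poly_Mapping.single b x) = Poly_Mapping.single b 0"
      by (simp add: b fock_c_def fock_scale_single not_in_iff)
    then show ?thesis by blast
  qed
qed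

lemma fock_deg_foldr:
  assumes f: "\<And>n b x. n > 0 \<Longrightarrow> \<exists>b' x'. f n (Poly_Mapping.single b x) = Poly_Mapping.single b' x' \<and>
      (x' = 0 \<or> fock_deg b' + n = fock_deg b)"
    and f0: "\<And>n. f n 0 = 0"
    and "\<forall>n \<in> set ns. n > (0::int)"
  shows "\<exists>b' x'. foldr f ns (Poly_Mapping.single b x) = Poly_Mapping.single b' x' \<and>
    (x' = 0 \<or> fock_deg b' + sum_list ns = fock_deg b)"
  using assms(3)
proof (induction ns)
  case Nil
  show ?case by (intro exI[of _ b] exI[of _ x]) simp
next
  case (Cons n ns)
  then have "\<forall>n \<in> set ns. n > 0" by simp
  from Cons.IH[OF this] obtain b' x' where
    1: "foldr f ns (Poly_Mapping.single b x) = Poly_Mapping.single b' x'"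
    "x' = 0 \<or> fock_deg b' + sum_list ns = fock_deg b" by blast
  show ?case
  proof (cases "x' = 0")
    case True
    then have "foldr f (n # ns) (Poly_Mapping.single b x) = Poly_Mapping.single b 0"
      by (simp add: 1(1) f0)
    then show ?thesis by blast
  next
    case False
    from Cons.prems have "n > 0" by simp
    from f[OF this, of b' x'] obtain b'' x'' where
      "f n (Poly_Mapping.single b' x') = Poly_Mapping.single b'' x''"
      "x'' = 0 \<or> fock_deg b'' + n = fock_deg b'" by blast
    with False 1 show ?thesis by (intro exI[of _ b''] exI[of _ x'']) auto
  qed
qed

lemma foldr_fock_add:
  "foldr (fock_a q) ns (v + w) = foldr (fock_a q) ns v + foldr (fock_a q) ns w"
  "foldr (fock_c q) ns (v + w) = foldr (fock_c q) ns v + foldr (fock_c q) ns w"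
  by (induction ns) (simp_all add: fock_add)

lemma foldr_fock_zero: "foldr (fock_a q) ns 0 = 0" "foldr (fock_c q) ns 0 = 0"
  by (induction ns) (simp_all add: fock_zero)

lemma fock_smooth: "\<exists>N. \<forall>ns ms. (\<forall>n \<in> set ns \<union> set ms. n > 0) \<longrightarrow> sum_list ns + sum_list ms > N \<longrightarrow>
    foldr (fock_a q) ns (foldr (fock_c q) ms v) = 0"
proof (induction v rule: fock_induct)
  case zero
  show ?case by (simp add: foldr_fock_zero)
next
  case (add v w)
  then obtain N N' where
    "\<forall>ns ms. (\<forall>n \<in> set ns \<union> set ms. n > 0) \<longrightarrow> sum_list ns + sum_list ms > N \<longrightarrow>
      foldr (fock_a q) ns (foldr (fock_c q) ms v) = 0"
    "\<forall>ns ms. (\<forall>n \<in> set ns \<union> set ms. n > 0) \<longrightarrow> sum_list ns + sum_list ms > N' \<longrightarrow>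
      foldr (fock_a q) ns (foldr (fock_c q) ms w) = 0" by blast
  then show ?case by (intro exI[of _ "max N N'"]) (simp add: foldr_fock_add)
next
  case (single b x)
  show ?case
  proof (intro exI[of _ "fock_deg b"] allI impI)
    fix ns ms :: "int list"
    assume pos: "\<forall>n \<in> set ns \<union> set ms. n > 0" and big: "sum_list ns + sum_list ms > fock_deg b"
    from pos obtain b' x' where 1: "foldr (fock_c q) ms (Poly_Mapping.single b x) = Poly_Mapping.single b' x'"
      "x' = 0 \<or> fock_deg b' + sum_list ms = fock_deg b"
      using fock_deg_foldr[of "fock_c q" ms b x, OF fock_deg_c fock_zero(2)] by blast
    from pos obtain b'' x'' where 2: "foldr (fock_a q) ns (Poly_Mapping.single b' x') = Poly_Mapping.single b'' x''"
      "x'' = 0 \<or> fock_deg b'' + sum_list ns = fock_deg b'"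
      using fock_deg_foldr[of "fock_a q" ns b' x', OF fock_deg_a fock_zero(1)] by blast
    show "foldr (fock_a q) ns (foldr (fock_c q) ms (Poly_Mapping.single b x)) = 0"
    proof (cases "x' = 0")
      case True
      then show ?thesis by (simp add: 1(1) foldr_fock_zero)
    next
      case False
      with 1(2) 2(2) big fock_deg_nonneg[of b''] have "x'' = 0" by auto
      then show ?thesis by (simp add: 1(1) 2(1))
    qed
  qed
qed

lemma bij_fock_eQa: "bij fock_eQa"
proof (rule o_bij)
  let ?g = "fock_extend (\<lambda>(M, N, m, l). Poly_Mapping.single (M, N, m - 1, l) 1)"
  have add: "?g (v + w) = ?g v + ?g w" for v w
    using linear_fock_extend by (simp add: fock_linear_iff)
  have zero: "?g 0 = 0" by simp
  have "?g (fock_eQa v) = v" for v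
    by (rule fock_eqI) (auto simp: fock_eQa_def fock_scale_single fock_add[unfolded fock_eQa_def] add)
  then show "?g \<circ> fock_eQa = id" by (simp add: fun_eq_iff)
  have "fock_eQa (?g v) = v" for v
    by (rule fock_eqI[where f = "\<lambda>v. fock_eQa (?g v)"])
      (auto simp: fock_eQa_def fock_scale_single fock_add[unfolded fock_eQa_def] add)
  then show "fock_eQa \<circ> ?g = id" by (simp add: fun_eq_iff)
qed

lemma bij_fock_eQc: "bij fock_eQc"
proof (rule o_bij)
  let ?g = "fock_extend (\<lambda>(M, N, m, l). Poly_Mapping.single (M, N, m, l - 1) 1)"
  have add: "?g (v + w) = ?g v + ?g w" for v w
    using linear_fock_extend by (simp add: fock_linear_iff)
  have "?g (fock_eQc v) = v" for v
    by (rule fock_eqI) (auto simp: fock_eQc_def fock_scale_single fock_add[unfolded fock_eQc_def] add)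
  then show "?g \<circ> fock_eQc = id" by (simp add: fun_eq_iff)
  have "fock_eQc (?g v) = v" for v
    by (rule fock_eqI[where f = "\<lambda>v. fock_eQc (?g v)"])
      (auto simp: fock_eQc_def fock_scale_single fock_add[unfolded fock_eQc_def] add)
  then show "fock_eQc \<circ> ?g = id" by (simp add: fun_eq_iff)
qed

lemma fock_span:
  assumes "\<And>b x. Poly_Mapping.single b x \<in> S"
  shows "v \<in> fock.span S"
  by (induction v rule: fock_induct) (auto intro: fock.span_zero fock.span_base fock.span_add assms)

lemma boson_oscillators_fock:
  "boson_oscillators fock_scale q (fock_a q) (fock_c q) fock_eQa fock_eQc"
proof (intro boson_oscillators.intro boson_oscillators_axioms.intro fock.vector_space_axioms
    linear_fock_a linear_fock_c linear_fock_eQa linear_fock_eQc bij_fock_eQa bij_fock_eQc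
    fock_comm_aa fock_comm_cc fock_smooth)
  fix n m :: int and v :: fock
  show "fock_a q 0 (fock_a q n v) = fock_a q n (fock_a q 0 v)"
    by (induction v rule: fock_induct) (auto simp: fock_add fock_zero fock_single_simps mult_ac)
  show "fock_c q 0 (fock_c q n v) = fock_c q n (fock_c q 0 v)"
    by (induction v rule: fock_induct) (auto simp: fock_add fock_zero fock_single_simps mult_ac)
  show "fock_a q n (fock_c q m v) = fock_c q m (fock_a q n v)"
    by (induction v rule: fock_induct) (auto simp: fock_add fock_zero fock_single_simps mult_ac)
  show "fock_a q 0 (fock_eQa v) - fock_eQa (fock_a q 0 v) = fock_eQa v"
    by (induction v rule: fock_induct) (auto simp: fock_add fock_zero fock_single_simps single_add algebra_simps)
  show "fock_c q 0 (fock_eQc v) - fock_eQc (fock_c q 0 v) = fock_eQc v"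
    by (induction v rule: fock_induct) (auto simp: fock_add fock_zero fock_single_simps single_add algebra_simps)
  show "fock_a q n (fock_eQc v) = fock_eQc (fock_a q n v)"
    by (induction v rule: fock_induct) (auto simp: fock_add fock_zero fock_single_simps mult_ac)
  show "fock_c q n (fock_eQa v) = fock_eQa (fock_c q n v)"
    by (induction v rule: fock_induct) (auto simp: fock_add fock_zero fock_single_simps mult_ac)
  show "fock_eQa (fock_eQc v) = fock_eQc (fock_eQa v)"
    by (induction v rule: fock_induct) (auto simp: fock_add fock_zero fock_single_simps mult_ac)
  show "fock_a q n (fock_eQa v) = fock_eQa (fock_a q n v)" if "n \<noteq> 0"
    by (induction v rule: fock_induct) (use that in \<open>auto simp: fock_add fock_zero fock_single_simps mult_ac\<close>)
  show "fock_c q n (fock_eQc v) = fock_eQc (fock_c q n v)" if "n \<noteq> 0"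
    by (induction v rule: fock_induct) (use that in \<open>auto simp: fock_add fock_zero fock_single_simps mult_ac\<close>)
  show "v \<in> fock.span {u. \<exists>m. fock_a q 0 u = fock_scale (of_int m) u}"
    by (rule fock_span) (force simp: fock_single_simps mult.commute)
  show "v \<in> fock.span {u. \<exists>m. fock_c q 0 u = fock_scale (of_int m) u}"
    by (rule fock_span) (force simp: fock_single_simps mult.commute)
qed

end

theory Submission
  imports Defs
begin

text \<open>
  The currents are sums of normally ordered exponentials of oscillators, so each relation becomes a
  statement about the scalar function that appears when a product of two exponentials is normally
  ordered. Three ideas carry the proof.

  First, the coefficients of \<open>exp (\<Sum>n>0. \<alpha>\<^sub>n x\<^sup>n)\<close> for commuting \<open>\<alpha>\<^sub>n\<close> satisfy
  \<open>n E\<^sub>n = \<Sum>i. i \<alpha>\<^sub>i E\<^sub>n\<^sub>-\<^sub>i\<close> and are determined by this recursion (\<open>op_exp_rec\<close>, \<open>op_exp_unique\<close>).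
  Every identity between such exponentials is therefore checked on the recursion, without convergence
  or infinite sums. The central one is \<open>op_exp_reorder\<close>: an annihilating exponential \<open>A\<close> passes a
  creating exponential \<open>C\<close> at the cost of a scalar power series \<open>f\<close>,
  \<open>A\<^sub>m C\<^sub>n = \<Sum>k. f\<^sub>k C\<^sub>n\<^sub>-\<^sub>k A\<^sub>m\<^sub>-\<^sub>k\<close>. Here \<open>f\<close> is recognized by its logarithmic derivative, and in all
  cases that occur it is a product of factors \<open>(1 - b u)\<close> to powers \<open>\<plusminus>1\<close>.

  Second, the space is spanned by joint eigenvectors of \<open>a\<^sub>0\<close> and \<open>c\<^sub>0\<close> (\<open>charged_induct\<close>). On such a
  vector the zero modes contribute a power of \<open>z\<close>, a scalar and a shift of the charges, and a product
  of two vertex operators is \<open>S(z,w)\<close> times their normally ordered product (\<open>vertex_vertex\<close>).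
  Applied to one vector, the part of fixed total degree of a normally ordered product is a Laurent
  polynomial in \<open>w/z\<close> (\<open>finite_wick\<close>); hence every two-sided sequence \<open>S\<close> of coefficients can act on
  it, in particular delta functions. Since \<open>V(z)V'(w)\<close> and \<open>V'(w)V(z)\<close> have the same normally ordered
  product, the relations between the \<open>X\<^sup>\<plusminus>\<close> are identities between the sequences \<open>S\<close>.

  Third come these identities. For two currents of the same sign the linear prefactors of the relation
  cancel the denominators of \<open>S\<close>, and each of the four pairs of summands satisfies the relation
  separately (\<open>vertex_exchange\<close>). In \<open>{X\<^sup>+(z), X\<^sup>-(w)}\<close> two of the four pairs have constant \<open>S\<close>, with
  opposite signs in the two orders, and drop out. For the other two, \<open>S\<close> is a rational function with
  simple poles at \<open>w = -z\<close> and at \<open>w = q z\<close> or \<open>w = z/q\<close>, expanded in the two opposite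
  domains; the two expansions combine to delta functions at the poles (\<open>vertex_anticommutator\<close>). On the support
  of a delta function the two exponentials fuse into one (\<open>wick_delta\<close>). At \<open>w = -z\<close> the two pairs give
  the same operator with opposite coefficients; at \<open>w = q z\<close> all modes of \<open>c\<close> and the positive modes
  of \<open>a\<close> cancel and \<open>\<psi>\<^sup>-\<close> remains (\<open>fuse_minus\<close>), at \<open>w = z/q\<close> it is \<open>\<psi>\<^sup>+\<close> (\<open>fuse_plus\<close>).
  The relations that contain \<open>\<psi>\<^sup>\<plusminus>\<close> are instances of the reordering lemma.

  The current \<open>X\<^sup>-\<close> has no classical limit because the vacuum matrix element of its mode of degree \<open>0\<close>
  towards the state of charges \<open>(-1, 1)\<close> is the prefactor \<open>-1/(q - q\<^sup>-\<^sup>1)\<close> itself.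
\<close>

section \<open>Formal exponentials of commuting operators\<close>

lemma sum_triangle_swap:
  fixes g :: "nat \<Rightarrow> nat \<Rightarrow> 'b::comm_monoid_add"
  shows "(\<Sum>i=1..n. \<Sum>j=1..n-i. g i j) = (\<Sum>j=1..n. \<Sum>i=1..n-j. g i j)"
  and "(\<Sum>i=1..n. \<Sum>j\<le>n-i. g i j) = (\<Sum>j\<le>n. \<Sum>i=1..n-j. g i j)"
  and "(\<Sum>i=1..n. \<Sum>j\<le>n-i. g i j) = (\<Sum>k\<le>n. \<Sum>i=1..k. g i (k-i))"
  unfolding sum.Sigma[OF finite_atLeastAtMost ballI[OF finite_atLeastAtMost]]
      sum.Sigma[OF finite_atLeastAtMost ballI[OF finite_atMost]]
      sum.Sigma[OF finite_atMost ballI[OF finite_atLeastAtMost]]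
  subgoal by (rule sum.reindex_bij_witness[where i = "\<lambda>(j,i). (i,j)" and j = "\<lambda>(i,j). (j,i)"]) auto
  subgoal by (rule sum.reindex_bij_witness[where i = "\<lambda>(j,i). (i,j)" and j = "\<lambda>(i,j). (j,i)"]) auto
  subgoal by (rule sum.reindex_bij_witness[where i = "\<lambda>(k,i). (i,k-i)" and j = "\<lambda>(i,j). (i+j,i)"]) auto
  done

locale complex_space = vector_space scale
  for scale :: "complex \<Rightarrow> 'v::ab_group_add \<Rightarrow> 'v" (infixr "*s" 75)
begin

abbreviation lin :: "('v \<Rightarrow> 'v) \<Rightarrow> bool" where
  "lin \<equiv> Vector_Spaces.linear scale scale"

lemma lin_iff: "lin f \<longleftrightarrow> (\<forall>x y. f (x + y) = f x + f y) \<and> (\<forall>r x. f (r *s x) = r *s f x)"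
  by (simp add: Vector_Spaces.linear_iff vector_space_axioms)

lemma lin_add: "lin f \<Longrightarrow> f (x + y) = f x + f y"
  and lin_scale: "lin f \<Longrightarrow> f (r *s x) = r *s f x"
  by (simp_all add: lin_iff)

lemma lin_zero: "lin f \<Longrightarrow> f 0 = 0"
  using lin_scale[of f 0 0] by simp

lemma lin_neg: "lin f \<Longrightarrow> f (- x) = - f x"
  using lin_scale[of f "-1" x] by simp

lemma lin_diff: "lin f \<Longrightarrow> f (x - y) = f x - f y"
  using lin_add[of f x "- y"] by (simp add: lin_neg)

lemma lin_sum: "lin f \<Longrightarrow> f (sum g S) = (\<Sum>i\<in>S. f (g i))"
  by (induction S rule: infinite_finite_induct) (simp_all add: lin_add lin_zero)

lemma lin_id: "lin (\<lambda>v. v)"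
  and lin_0: "lin (\<lambda>v. 0)"
  and lin_plus: "lin f \<Longrightarrow> lin g \<Longrightarrow> lin (\<lambda>v. f v + g v)"
  and lin_minus: "lin f \<Longrightarrow> lin g \<Longrightarrow> lin (\<lambda>v. f v - g v)"
  and lin_smult: "lin f \<Longrightarrow> lin (\<lambda>v. r *s f v)"
  and lin_comp: "lin f \<Longrightarrow> lin g \<Longrightarrow> lin (\<lambda>v. f (g v))"
  by (simp_all add: lin_iff scale_right_distrib scale_right_diff_distrib mult.commute)

lemma lin_setsum: "(\<And>i. i \<in> S \<Longrightarrow> lin (f i)) \<Longrightarrow> lin (\<lambda>v. \<Sum>i\<in>S. f i v)"
  by (induction S rule: infinite_finite_induct) (simp_all add: lin_0 lin_plus)

abbreviation commuting :: "(nat \<Rightarrow> 'v \<Rightarrow> 'v) \<Rightarrow> (nat \<Rightarrow> 'v \<Rightarrow> 'v) \<Rightarrow> bool" where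
  "commuting \<alpha> \<beta> \<equiv> \<forall>i>0. \<forall>j>0. \<forall>v. \<alpha> i (\<beta> j v) = \<beta> j (\<alpha> i v)"

lemma lin_op_pow: "(\<And>n. lin (\<alpha> n)) \<Longrightarrow> lin (op_pow \<alpha> k m)"
proof (induction k arbitrary: m)
  case 0
  show ?case by (cases "m = 0") (simp_all add: lin_id lin_0)
next
  case (Suc k)
  then show ?case by (auto intro!: lin_setsum lin_comp[of "\<alpha> _" "op_pow \<alpha> k _"])
qed

lemma lin_op_exp: "(\<And>n. lin (\<alpha> n)) \<Longrightarrow> lin (op_exp scale \<alpha> m)"
  unfolding op_exp_def by (intro lin_setsum lin_smult lin_op_pow)

lemma op_pow_vanish: "(\<And>n. lin (\<alpha> n)) \<Longrightarrow> m < k \<Longrightarrow> op_pow \<alpha> k m v = 0"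
  by (induction k arbitrary: m) (auto intro!: sum.neutral simp: lin_zero)

lemma op_exp_0: "op_exp scale \<alpha> 0 v = v"
  by (simp add: op_exp_def)

text \<open>
  This is \<open>(A\<^sup>k\<^sup>+\<^sup>1)' = (k+1) A' A\<^sup>k\<close> for the Euler derivative \<open>x d/dx\<close>, which needs that the coefficients
  of \<open>A\<close> commute.
\<close>

lemma op_pow_rec:
  assumes lin: "\<And>n. lin (\<alpha> n)"
    and comm: "commuting \<alpha> \<alpha>"
  shows "of_nat m *s op_pow \<alpha> (Suc k) m v =
    of_nat (Suc k) *s (\<Sum>i=1..m. of_nat i *s \<alpha> i (op_pow \<alpha> k (m - i) v))"
proof (induction k arbitrary: m)
  case 0
  have "of_nat m *s \<alpha> i (if m - i = 0 then v else 0) = of_nat i *s \<alpha> i (if m - i = 0 then v else 0)"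
    if "i \<in> {1..m}" for i
    using that by (cases "m = i") (auto simp: lin_zero[OF lin])
  then have "(\<Sum>i=1..m. of_nat m *s \<alpha> i (if m - i = 0 then v else 0)) =
      (\<Sum>i=1..m. of_nat i *s \<alpha> i (if m - i = 0 then v else 0))" by (rule sum.cong[OF refl])
  then show ?case by (simp add: scale_sum_right)
next
  case (Suc k)
  let ?P = "op_pow \<alpha>"
  have "of_nat m *s ?P (Suc (Suc k)) m v = (\<Sum>i=1..m. of_nat m *s \<alpha> i (?P (Suc k) (m - i) v))"
    by (simp add: scale_sum_right)
  also have "\<dots> = (\<Sum>i=1..m. of_nat i *s \<alpha> i (?P (Suc k) (m - i) v))
      + (\<Sum>i=1..m. \<alpha> i (of_nat (m - i) *s ?P (Suc k) (m - i) v))"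
    unfolding sum.distrib[symmetric]
    by (rule sum.cong[OF refl])
      (simp add: lin_scale[OF lin] scale_left_distrib[symmetric] del: op_pow.simps flip: of_nat_add)
  also have "(\<Sum>i=1..m. \<alpha> i (of_nat (m - i) *s ?P (Suc k) (m - i) v)) =
      of_nat (Suc k) *s (\<Sum>i=1..m. \<Sum>j=1..m-i. of_nat j *s \<alpha> j (\<alpha> i (?P k (m - i - j) v)))"
    unfolding Suc.IH scale_sum_right
    by (intro sum.cong refl) (simp add: lin_scale[OF lin] lin_sum[OF lin] scale_sum_right comm)
  also have "(\<Sum>i=1..m. \<Sum>j=1..m-i. of_nat j *s \<alpha> j (\<alpha> i (?P k (m - i - j) v))) =
      (\<Sum>j=1..m. of_nat j *s \<alpha> j (?P (Suc k) (m - j) v))"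
    by (subst sum_triangle_swap(1), intro sum.cong refl)
      (simp add: lin_sum[OF lin] scale_sum_right add.commute)
  finally show ?case 
    unfolding of_nat_Suc[of "Suc k"] scale_left_distrib by (simp del: op_pow.simps)
qed

text \<open>
  The Euler derivative of \<open>E = exp A\<close> is \<open>A' E\<close>.
\<close>

lemma op_exp_rec:
  assumes lin: "\<And>n. lin (\<alpha> n)"
    and comm: "commuting \<alpha> \<alpha>"
  shows "of_nat m *s op_exp scale \<alpha> m v = (\<Sum>i=1..m. of_nat i *s \<alpha> i (op_exp scale \<alpha> (m - i) v))"
proof -
  have ext: "op_exp scale \<alpha> n v = (\<Sum>k\<le>m. (1 / fact k) *s op_pow \<alpha> k n v)" if "n \<le> m" for n m
    unfolding op_exp_def using that
    by (intro sum.mono_neutral_left) (auto simp: op_pow_vanish[OF lin])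
  have "of_nat m *s op_exp scale \<alpha> m v = of_nat m *s (\<Sum>k\<le>Suc m. (1 / fact k) *s op_pow \<alpha> k m v)"
    by (subst ext[of m "Suc m"]) auto
  also have "\<dots> = (\<Sum>k\<le>m. (1 / fact (Suc k)) *s of_nat m *s op_pow \<alpha> (Suc k) m v)"
    by (subst sum.atMost_Suc_shift)
      (auto simp: scale_right_distrib scale_sum_right mult.commute simp del: op_pow.simps(2) fact_Suc)
  also have "\<dots> = (\<Sum>k\<le>m. \<Sum>i=1..m. of_nat i *s \<alpha> i ((1 / fact k) *s op_pow \<alpha> k (m - i) v))"
    unfolding op_pow_rec[OF lin comm]
    by (intro sum.cong refl)
     (simp add: scale_sum_right lin_scale[OF lin] divide_simps mult.commute del: of_nat_Suc)
  also have "\<dots> = (\<Sum>i=1..m. of_nat i *s \<alpha> i (op_exp scale \<alpha> (m - i) v))"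
    by (subst sum.swap, intro sum.cong refl)
      (simp add: ext[of "m - _" m] lin_sum[OF lin] scale_sum_right)
  finally show ?thesis .
qed

text \<open>
  The recursion determines \<open>f\<^sub>n\<close> from the earlier terms because \<open>n\<close> is invertible. All further facts
  about exponentials follow by verifying it for a suitable \<open>f\<close>.
\<close>

lemma op_exp_unique:
  assumes lin: "\<And>n. lin (\<alpha> n)"
    and comm: "commuting \<alpha> \<alpha>"
    and f: "\<And>n. of_nat n *s f n = (\<Sum>i=1..n. of_nat i *s \<alpha> i (f (n - i)))"
  shows "f n = op_exp scale \<alpha> n (f 0)"
proof (induction n rule: less_induct)
  case (less n)
  show ?case
  proof (cases "n = 0")
    case False
    have "of_nat n *s f n = of_nat n *s op_exp scale \<alpha> n (f 0)"
      unfolding f[of n] op_exp_rec[OF lin comm]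
    proof (intro sum.cong refl)
      fix i assume "i \<in> {1..n}"
      then have "f (n - i) = op_exp scale \<alpha> (n - i) (f 0)" by (intro less) auto
      then show "of_nat i *s \<alpha> i (f (n - i)) = of_nat i *s \<alpha> i (op_exp scale \<alpha> (n - i) (f 0))"
        by (rule arg_cong)
    qed
    with False show ?thesis by simp
  qed (simp add: op_exp_0)
qed

lemma op_exp_intertwine:
  assumes lin: "\<And>n. lin (\<alpha> n)" "\<And>n. lin (\<beta> n)" "lin T"
    and comm: "commuting \<alpha> \<alpha>"
      "commuting \<beta> \<beta>"
    and T: "\<And>i v. i > 0 \<Longrightarrow> T (\<alpha> i v) = \<beta> i (T v)"
  shows "T (op_exp scale \<alpha> n v) = op_exp scale \<beta> n (T v)"
proof -
  have "T (op_exp scale \<alpha> n v) = op_exp scale \<beta> n (T (op_exp scale \<alpha> 0 v))"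
  proof (rule op_exp_unique[OF lin(2) comm(2), where f = "\<lambda>n. T (op_exp scale \<alpha> n v)"])
    fix n
    have "of_nat n *s T (op_exp scale \<alpha> n v) = T (of_nat n *s op_exp scale \<alpha> n v)"
      by (simp add: lin_scale[OF lin(3)])
    also have "\<dots> = (\<Sum>i=1..n. of_nat i *s \<beta> i (T (op_exp scale \<alpha> (n - i) v)))"
      unfolding op_exp_rec[OF lin(1) comm(1)] lin_sum[OF lin(3)]
      by (intro sum.cong refl) (simp add: lin_scale[OF lin(3)] T)
    finally show "of_nat n *s T (op_exp scale \<alpha> n v) =
      (\<Sum>i=1..n. of_nat i *s \<beta> i (T (op_exp scale \<alpha> (n - i) v)))" .
  qed
  then show ?thesis by (simp add: op_exp_0)
qed

lemma op_exp_dilate: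
  assumes lin: "\<And>n. lin (\<alpha> n)"
    and comm: "commuting \<alpha> \<alpha>"
  shows "op_exp scale (\<lambda>n v. y ^ n *s \<alpha> n v) n v = y ^ n *s op_exp scale \<alpha> n v"
proof -
  have "y ^ n *s op_exp scale \<alpha> n v = op_exp scale (\<lambda>n v. y ^ n *s \<alpha> n v) n (y ^ 0 *s op_exp scale \<alpha> 0 v)"
  proof (rule op_exp_unique[where f = "\<lambda>n. y ^ n *s op_exp scale \<alpha> n v"])
    fix n
    have "of_nat n *s y ^ n *s op_exp scale \<alpha> n v = y ^ n *s of_nat n *s op_exp scale \<alpha> n v"
      by (rule scale_left_commute)
    also have "\<dots> = (\<Sum>i=1..n. of_nat i *s y ^ i *s \<alpha> i (y ^ (n - i) *s op_exp scale \<alpha> (n - i) v))"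
      unfolding op_exp_rec[OF lin comm] scale_sum_right
    proof (intro sum.cong refl)
      fix i assume "i \<in> {1..n}"
      then have *: "y ^ n = y ^ i * y ^ (n - i)" by (simp flip: power_add)
      show "y ^ n *s of_nat i *s \<alpha> i (op_exp scale \<alpha> (n - i) v) =
          of_nat i *s y ^ i *s \<alpha> i (y ^ (n - i) *s op_exp scale \<alpha> (n - i) v)"
        unfolding * lin_scale[OF lin] scale_scale by (simp only: mult_ac)
    qed
    finally show "of_nat n *s y ^ n *s op_exp scale \<alpha> n v =
      (\<Sum>i=1..n. of_nat i *s y ^ i *s \<alpha> i (y ^ (n - i) *s op_exp scale \<alpha> (n - i) v))" .
  next
    show "commuting (\<lambda>n v. y ^ n *s \<alpha> n v) (\<lambda>n v. y ^ n *s \<alpha> n v)"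
      unfolding lin_scale[OF lin] using comm by (auto intro: scale_left_commute)
  qed (intro lin_smult lin)
  then show ?thesis by (simp add: op_exp_0)
qed

lemma op_exp_kill:
  assumes lin: "\<And>n. lin (\<alpha> n)"
    and comm: "commuting \<alpha> \<alpha>"
    and kill: "\<And>i. i > 0 \<Longrightarrow> \<alpha> i v = 0"
  shows "op_exp scale \<alpha> n v = (if n = 0 then v else 0)"
proof -
  have "(if n = 0 then v else 0) = op_exp scale \<alpha> n (if (0::nat) = 0 then v else 0)"
  proof (rule op_exp_unique[OF lin comm, where f = "\<lambda>n. if n = 0 then v else 0"])
    fix n
    have "\<alpha> i (if n - i = 0 then v else 0) = 0" if "i \<in> {1..n}" for i
      using that by (auto simp: kill lin_zero[OF lin])
    then have "(\<Sum>i=1..n. of_nat i *s \<alpha> i (if n - i = 0 then v else 0)) = 0"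
      by (intro sum.neutral) (metis scale_zero_right)
    then show "of_nat n *s (if n = 0 then v else 0) =
        (\<Sum>i=1..n. of_nat i *s \<alpha> i (if n - i = 0 then v else 0))" by simp
  qed
  then show ?thesis by simp
qed

lemma op_exp_mult:
  assumes lin: "\<And>n. lin (\<alpha> n)" "\<And>n. lin (\<beta> n)"
    and comm: "commuting \<alpha> \<alpha>"
      "commuting \<beta> \<beta>"
      "commuting \<alpha> \<beta>"
  shows "(\<Sum>k\<le>n. op_exp scale \<alpha> k (op_exp scale \<beta> (n - k) v)) =
    op_exp scale (\<lambda>n v. \<alpha> n v + \<beta> n v) n v"
proof -
  let ?E = "op_exp scale \<alpha>" and ?F = "op_exp scale \<beta>"
  let ?f = "\<lambda>n. \<Sum>k\<le>n. ?E k (?F (n - k) v)"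
  have linE: "lin (?E k)" for k by (rule lin_op_exp[OF lin(1)])
  have \<beta>E: "\<beta> i (?E k w) = ?E k (\<beta> i w)" if "i > 0" for i k w
    by (rule op_exp_intertwine) (use that in \<open>auto simp: lin comm\<close>)
  have "?f n = op_exp scale (\<lambda>n v. \<alpha> n v + \<beta> n v) n (?f 0)"
  proof (rule op_exp_unique[where f = ?f])
    fix n
    have "of_nat n *s ?f n = (\<Sum>k\<le>n. of_nat k *s ?E k (?F (n - k) v))
        + (\<Sum>k\<le>n. ?E k (of_nat (n - k) *s ?F (n - k) v))"
      unfolding scale_sum_right sum.distrib[symmetric]
      by (rule sum.cong[OF refl]) (simp add: lin_scale[OF linE] flip: scale_left_distrib of_nat_add)
    also have "(\<Sum>k\<le>n. of_nat k *s ?E k (?F (n - k) v)) =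
        (\<Sum>i=1..n. of_nat i *s \<alpha> i (?f (n - i)))"
    proof -
      have "(\<Sum>k\<le>n. of_nat k *s ?E k (?F (n - k) v)) =
        (\<Sum>k\<le>n. \<Sum>i=1..k. of_nat i *s \<alpha> i (?E (k - i) (?F (n - i - (k - i)) v)))"
        unfolding op_exp_rec[OF lin(1) comm(1)] by (intro sum.cong refl) auto
      also have "\<dots> = (\<Sum>i=1..n. \<Sum>k\<le>n-i. of_nat i *s \<alpha> i (?E k (?F (n - i - k) v)))"
        by (rule sum_triangle_swap(3)[symmetric])
      finally show ?thesis by (simp add: lin_sum[OF lin(1)] scale_sum_right)
    qed
    also have "(\<Sum>k\<le>n. ?E k (of_nat (n - k) *s ?F (n - k) v)) =
        (\<Sum>i=1..n. of_nat i *s \<beta> i (?f (n - i)))"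
    proof -
      have "(\<Sum>k\<le>n. ?E k (of_nat (n - k) *s ?F (n - k) v)) =
        (\<Sum>k\<le>n. \<Sum>i=1..n-k. of_nat i *s \<beta> i (?E k (?F (n - i - k) v)))"
        unfolding op_exp_rec[OF lin(2) comm(2)]
        by (intro sum.cong refl) (simp add: lin_sum[OF linE] lin_scale[OF linE] \<beta>E add.commute)
      also have "\<dots> = (\<Sum>i=1..n. \<Sum>k\<le>n-i. of_nat i *s \<beta> i (?E k (?F (n - i - k) v)))"
        by (rule sum_triangle_swap(2)[symmetric])
      finally show ?thesis by (simp add: lin_sum[OF lin(2)] scale_sum_right)
    qed
    finally show "of_nat n *s ?f n = (\<Sum>i=1..n. of_nat i *s (\<alpha> i (?f (n - i)) + \<beta> i (?f (n - i))))"
      by (simp only: scale_right_distrib sum.distrib)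
  qed (simp_all add: lin_plus lin lin_add[OF lin(1)] lin_add[OF lin(2)] comm add_ac)
  then show ?thesis by (simp add: op_exp_0)
qed

text \<open>
  \<open>[\<alpha>, \<cdot>]\<close> is a derivation that maps \<open>\<beta>\<^sub>i\<close> to the scalar \<open>\<gamma>\<close> and kills the other \<open>\<beta>\<^sub>j\<close>, so it multiplies
  the exponential by \<open>\<gamma> x\<^sup>i\<close>.
\<close>

lemma op_exp_commutator:
  assumes lin: "\<And>n. lin (\<beta> n)" "lin \<alpha>"
    and comm: "commuting \<beta> \<beta>"
    and "i > 0" 
    and \<alpha>: "\<And>j v. j > 0 \<Longrightarrow> \<alpha> (\<beta> j v) = \<beta> j (\<alpha> v) + (if j = i then \<gamma> *s v else 0)"
  shows "\<alpha> (op_exp scale \<beta> n v) =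
    op_exp scale \<beta> n (\<alpha> v) + (if i \<le> n then \<gamma> *s op_exp scale \<beta> (n - i) v else 0)"
proof -
  let ?E = "\<lambda>n. op_exp scale \<beta> n v"
  let ?f = "\<lambda>n. \<alpha> (?E n) - (if i \<le> n then \<gamma> *s ?E (n - i) else 0)"
  have "?f n = op_exp scale \<beta> n (?f 0)"
  proof (rule op_exp_unique[OF lin(1) comm, where f = ?f])
    fix n
    have 1: "of_nat n *s \<alpha> (?E n) = (\<Sum>j=1..n. of_nat j *s \<beta> j (\<alpha> (?E (n - j))))
        + (if i \<le> n then of_nat i *s \<gamma> *s ?E (n - i) else 0)"
    proof -
      have "of_nat n *s \<alpha> (?E n) = \<alpha> (of_nat n *s ?E n)" by (simp add: lin_scale[OF lin(2)])
      also have "\<dots> = (\<Sum>j=1..n. of_nat j *s \<alpha> (\<beta> j (?E (n - j))))"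
        unfolding op_exp_rec[OF lin(1) comm] by (simp add: lin_sum[OF lin(2)] lin_scale[OF lin(2)])
      also have "\<dots> = (\<Sum>j=1..n. of_nat j *s \<beta> j (\<alpha> (?E (n - j)))
          + (if j = i then of_nat i *s \<gamma> *s ?E (n - i) else 0))"
        by (intro sum.cong refl) (auto simp: \<alpha> scale_right_distrib)
      finally show ?thesis using \<open>i > 0\<close> by (simp add: sum.distrib)
    qed
    have 2: "of_nat n *s (if i \<le> n then \<gamma> *s ?E (n - i) else 0) =
      (if i \<le> n then of_nat i *s \<gamma> *s ?E (n - i) else 0)
      + (\<Sum>j=1..n. of_nat j *s \<beta> j (if i \<le> n - j then \<gamma> *s ?E (n - j - i) else 0))"
    proof (cases "i \<le> n")
      case True
      have "of_nat n *s \<gamma> *s ?E (n - i) = of_nat i *s \<gamma> *s ?E (n - i) + \<gamma> *s of_nat (n - i) *s ?E (n - i)"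
        using True by (simp add: of_nat_diff algebra_simps flip: scale_left_distrib)
      also have "of_nat (n - i) *s ?E (n - i) = (\<Sum>j=1..n-i. of_nat j *s \<beta> j (?E (n - i - j)))"
        by (rule op_exp_rec[OF lin(1) comm])
      also have "\<gamma> *s (\<Sum>j=1..n-i. of_nat j *s \<beta> j (?E (n - i - j))) =
        (\<Sum>j=1..n. of_nat j *s \<beta> j (if i \<le> n - j then \<gamma> *s ?E (n - j - i) else 0))"
        unfolding scale_sum_right using True
        by (intro sum.mono_neutral_cong_left)
          (auto simp: lin_zero[OF lin(1)] lin_scale[OF lin(1)] add.commute mult.commute)
      finally show ?thesis using True by simp
    next
      case False
      then have "\<not> i \<le> n - j" for j by simp
      with False show ?thesis by (simp add: lin_zero[OF lin(1)])
    qed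
    show "of_nat n *s ?f n = (\<Sum>j=1..n. of_nat j *s \<beta> j (?f (n - j)))"
      unfolding scale_right_diff_distrib 1 2 by (simp add: lin_diff[OF lin(1)] scale_right_diff_distrib sum_subtractf)
  qed
  then show ?thesis using \<open>i > 0\<close> by (simp add: op_exp_0 algebra_simps)
qed

text \<open>
  The coefficientwise form of \<open>exp A(x) exp B(y) = f(xy) exp B(y) exp A(x)\<close> with
  \<open>f(u) = exp (\<Sum>n. \<gamma>\<^sub>n u\<^sup>n)\<close>, where \<open>f\<close> is characterized by its logarithmic derivative. Both sides
  satisfy the recursion of \<open>exp A\<close>: moving \<open>\<alpha>\<^sub>i\<close> through \<open>exp B\<close> produces exactly the additional terms
  that the recursion for the coefficients of \<open>f\<close> accounts for.
\<close>

lemma op_exp_reorder: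
  assumes lin: "\<And>n. lin (\<alpha> n)" "\<And>n. lin (\<beta> n)"
    and comm: "commuting \<alpha> \<alpha>"
      "commuting \<beta> \<beta>"
    and \<alpha>\<beta>: "\<And>i j v. i > 0 \<Longrightarrow> j > 0 \<Longrightarrow> \<alpha> i (\<beta> j v) = \<beta> j (\<alpha> i v) + (if j = i then \<gamma> i *s v else 0)"
    and f: "fps_nth f 0 = 1" "fps_X * fps_deriv f = Abs_fps (\<lambda>n. of_nat n * \<gamma> n) * f"
  shows "op_exp scale \<alpha> m (op_exp scale \<beta> n v) =
    (\<Sum>k\<le>min m n. fps_nth f k *s op_exp scale \<beta> (n - k) (op_exp scale \<alpha> (m - k) v))"
proof -
  let ?A = "op_exp scale \<alpha>"
  \<comment> \<open>the creating coefficients, extended by zero to negative index\<close>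
  let ?C = "\<lambda>k w. if k \<le> n then op_exp scale \<beta> (n - k) w else 0"
  let ?g = "\<lambda>m. \<Sum>k\<le>m. fps_nth f k *s ?C k (?A (m - k) v)"
  have linC: "lin (?C k)" for k
    by (cases "k \<le> n") (simp_all add: lin_op_exp lin lin_0)
  have \<alpha>C: "\<alpha> i (?C k w) = ?C k (\<alpha> i w) + \<gamma> i *s ?C (k + i) w" if "i > 0" for i k w
  proof (cases "k \<le> n")
    case True
    have "\<alpha> i (op_exp scale \<beta> (n - k) w) = op_exp scale \<beta> (n - k) (\<alpha> i w)
      + (if i \<le> n - k then \<gamma> i *s op_exp scale \<beta> (n - k - i) w else 0)"
      by (rule op_exp_commutator[OF lin(2) lin(1) comm(2) that]) (use that in \<open>auto simp: \<alpha>\<beta>\<close>)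
    with True show ?thesis by (auto simp: le_diff_conv add.commute)
  qed (simp add: lin_zero[OF lin(1)])
  have fn: "(\<Sum>i=1..l. of_nat i * \<gamma> i * fps_nth f (l - i)) = of_nat l * fps_nth f l" for l
  proof -
    have "of_nat l * fps_nth f l = fps_nth (fps_X * fps_deriv f) l"
      by (cases l) (simp_all del: of_nat_Suc)
    also have "\<dots> = (\<Sum>i=0..l. of_nat i * \<gamma> i * fps_nth f (l - i))"
      unfolding f(2) by (simp add: fps_mult_nth)
    also have "\<dots> = (\<Sum>i=1..l. of_nat i * \<gamma> i * fps_nth f (l - i))"
      by (intro sum.mono_neutral_right) (auto simp: Suc_le_eq)
    finally show ?thesis by simp
  qed
  have "?g m = op_exp scale \<alpha> m (?g 0)"
  proof (rule op_exp_unique[OF lin(1) comm(1), where f = ?g])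
    fix m
    have "(\<Sum>i=1..m. of_nat i *s \<alpha> i (?g (m - i))) =
      (\<Sum>i=1..m. \<Sum>k\<le>m-i. fps_nth f k *s ?C k (of_nat i *s \<alpha> i (?A (m - k - i) v)))
      + (\<Sum>i=1..m. \<Sum>k\<le>m-i. (of_nat i * \<gamma> i * fps_nth f k) *s ?C (k + i) (?A (m - (k + i)) v))"
      unfolding sum.distrib[symmetric] lin_sum[OF lin(1)] scale_sum_right
      by (intro sum.cong refl)
        (simp only: lin_scale[OF lin(1)] \<alpha>C lin_scale[OF linC] scale_right_distrib scale_scale mult_ac
           atLeastAtMost_iff Suc_le_eq One_nat_def diff_diff_left add.commute)
    also have "(\<Sum>i=1..m. \<Sum>k\<le>m-i. fps_nth f k *s ?C k (of_nat i *s \<alpha> i (?A (m - k - i) v))) =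
      (\<Sum>k\<le>m. fps_nth f k *s ?C k (\<Sum>i=1..m-k. of_nat i *s \<alpha> i (?A (m - k - i) v)))"
      unfolding lin_sum[OF linC] scale_sum_right by (rule sum_triangle_swap(2))
    also have "\<dots> = (\<Sum>k\<le>m. (of_nat (m - k) * fps_nth f k) *s ?C k (?A (m - k) v))"
      unfolding op_exp_rec[OF lin(1) comm(1), symmetric]
      by (simp only: lin_scale[OF linC] scale_scale mult_ac)
    also have "(\<Sum>i=1..m. \<Sum>k\<le>m-i. (of_nat i * \<gamma> i * fps_nth f k) *s ?C (k + i) (?A (m - (k + i)) v)) =
      (\<Sum>l\<le>m. (\<Sum>i=1..l. of_nat i * \<gamma> i * fps_nth f (l - i)) *s ?C l (?A (m - l) v))"
      unfolding sum_triangle_swap(3) scale_sum_left by (intro sum.cong refl) auto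
    also have "\<dots> = (\<Sum>l\<le>m. (of_nat l * fps_nth f l) *s ?C l (?A (m - l) v))"
      by (simp only: fn)
    also have "(\<Sum>k\<le>m. (of_nat (m - k) * fps_nth f k) *s ?C k (?A (m - k) v)) + \<dots> = of_nat m *s ?g m"
      unfolding sum.distrib[symmetric] scale_sum_right
      by (intro sum.cong refl) (simp add: of_nat_diff algebra_simps flip: scale_left_distrib)
    finally show "of_nat m *s ?g m = (\<Sum>i=1..m. of_nat i *s \<alpha> i (?g (m - i)))" by simp
  qed
  also have "?g 0 = op_exp scale \<beta> n v" by (simp add: f op_exp_0)
  finally have "op_exp scale \<alpha> m (op_exp scale \<beta> n v) = ?g m" by simp
  also have "\<dots> = (\<Sum>k\<le>min m n. fps_nth f k *s op_exp scale \<beta> (n - k) (op_exp scale \<alpha> (m - k) v))"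
    by (rule sum.mono_neutral_cong_right) auto
  finally show ?thesis .
qed

end

section \<open>Locally finite sums and eigenspace projections\<close>

lemma Sum_any_iterated:
  fixes g :: "'a \<Rightarrow> 'b \<Rightarrow> 'c::comm_monoid_add"
  assumes "finite {(i, j). g i j \<noteq> 0}"
  shows "Sum_any (\<lambda>i. Sum_any (g i)) = Sum_any (\<lambda>(i, j). g i j)"
proof -
  let ?S = "{(i, j). g i j \<noteq> 0}"
  let ?C = "fst ` ?S \<times> snd ` ?S"
  have "finite ?C" using assms by blast
  moreover have "{i. \<exists>j. g i j \<noteq> 0} \<times> {j. \<exists>i. g i j \<noteq> 0} \<subseteq> ?C" by force
  ultimately show ?thesis by (rule Sum_any.cartesian_product)
qed

lemma Sum_any_bij:
  assumes "bij h" shows "Sum_any (\<lambda>x. g (h x)) = Sum_any g"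
  by (rule Sum_any.reindex_cong[OF assms, symmetric]) (simp add: comp_def)

lemma Sum_any_swap_finite:
  fixes g :: "'a \<Rightarrow> 'b \<Rightarrow> 'c::comm_monoid_add"
  assumes fin: "finite {(i, j). g i j \<noteq> 0}"
  shows "Sum_any (\<lambda>i. Sum_any (g i)) = Sum_any (\<lambda>j. Sum_any (\<lambda>i. g i j))"
proof -
  have "{(j, i). g i j \<noteq> 0} = prod.swap ` {(i, j). g i j \<noteq> 0}" by force
  then have "finite {(j, i). g i j \<noteq> 0}" using fin by simp
  then have "Sum_any (\<lambda>j. Sum_any (\<lambda>i. g i j)) = Sum_any (\<lambda>(j, i). g i j)"
    by (rule Sum_any_iterated)
  also have "\<dots> = Sum_any (\<lambda>(i, j). g i j)"
    by (subst Sum_any_bij[symmetric, where h = prod.swap]) (simp_all add: case_prod_unfold bij_swap)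
  finally show ?thesis using Sum_any_iterated[OF fin] by simp
qed

lemma Sum_any_single:
  assumes "\<And>j. j \<noteq> i \<Longrightarrow> g j = 0" shows "Sum_any g = g i"
  using Sum_any.expand_superset[of "{i}" g] assms by auto

lemma Sum_any_inj:
  assumes "inj h" "\<And>x. x \<notin> range h \<Longrightarrow> g x = 0"
  shows "Sum_any g = Sum_any (\<lambda>y. g (h y))"
proof -
  have "{x. g x \<noteq> 0} = h ` {y. g (h y) \<noteq> 0}" using assms(2) by force
  then show ?thesis
    using sum.reindex[OF inj_on_subset[OF assms(1) subset_UNIV], of g "{y. g (h y) \<noteq> 0}"]
    by (simp add: Sum_any.expand_set)
qed

lemma Sum_any_supported:
  "finite S \<Longrightarrow> (\<And>x. x \<notin> S \<Longrightarrow> g x = 0) \<Longrightarrow> Sum_any g = sum g S"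
  by (rule Sum_any.expand_superset) auto

lemma Sum_any_sum:
  fixes f :: "'a \<Rightarrow> 'b \<Rightarrow> 'c::comm_monoid_add"
  assumes "finite B" "\<And>b. finite {j. f j b \<noteq> 0}"
  shows "Sum_any (\<lambda>j. \<Sum>b\<in>B. f j b) = (\<Sum>b\<in>B. Sum_any (\<lambda>j. f j b))"
  using assms(1)
proof (induction B)
  case (insert b B)
  have "finite {j. (\<Sum>b\<in>B. f j b) \<noteq> 0}"
  proof (rule finite_subset)
    show "{j. (\<Sum>b\<in>B. f j b) \<noteq> 0} \<subseteq> (\<Union>b\<in>B. {j. f j b \<noteq> 0})" by (blast intro: sum.neutral)
  qed (use insert assms(2) in simp)
  with insert assms(2) show ?case by (simp add: Sum_any.distrib)
qed simp

context complex_space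
begin

lemma lin_Sum_any:
  assumes "lin f" "finite {i. g i \<noteq> 0}"
  shows "f (Sum_any g) = Sum_any (\<lambda>i. f (g i))"
proof -
  have "Sum_any (\<lambda>i. f (g i)) = (\<Sum>i\<in>{i. g i \<noteq> 0}. f (g i))"
    by (rule Sum_any.expand_superset) (use assms in \<open>auto simp: lin_zero\<close>)
  then show ?thesis
    using Sum_any.expand_superset[OF assms(2) order_refl] by (simp add: lin_sum[OF assms(1)])
qed

lemma scale_Sum_any: "finite {i. g i \<noteq> 0} \<Longrightarrow> r *s Sum_any g = Sum_any (\<lambda>i. r *s g i)"
  by (rule lin_Sum_any[OF lin_smult[OF lin_id]])

lemma eigenvectors_independent:
  assumes A: "lin A" and "finite S"
    and "\<And>m. m \<in> S \<Longrightarrow> A (u m) = of_int m *s u m" and "(\<Sum>m\<in>S. u m) = 0"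
  shows "\<forall>m\<in>S. u m = 0"
  using assms(2-4)
proof (induction S arbitrary: u)
  case (insert k S)
  \<comment> \<open>applying \<open>A - k\<close> removes the eigenvector for \<open>k\<close>\<close>
  let ?w = "\<lambda>m. of_int (m - k) *s u m"
  have "(\<Sum>m\<in>S. ?w m) = (\<Sum>m\<in>insert k S. A (u m) - of_int k *s u m)"
    using insert by (simp add: scale_left_diff_distrib)
  also have "\<dots> = A (\<Sum>m\<in>insert k S. u m) - of_int k *s (\<Sum>m\<in>insert k S. u m)"
    by (simp only: lin_sum[OF A] scale_sum_right sum_subtractf)
  also have "\<dots> = 0" by (simp only: insert.prems(2) lin_zero[OF A] scale_zero_right diff_zero)
  finally have "\<forall>m\<in>S. ?w m = 0"
    by (rule insert.IH[rotated]) (simp add: insert.prems lin_scale[OF A] scale_left_commute)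
  then have "u m = 0" if "m \<in> S" for m using that insert.hyps by auto
  with insert show ?case by simp
qed simp

text \<open>
  \<open>u\<close> is the decomposition of \<open>v\<close> into eigenvectors of \<open>A\<close> with integral eigenvalues.
\<close>

definition eigdec :: "('v \<Rightarrow> 'v) \<Rightarrow> (int \<Rightarrow> 'v) \<Rightarrow> 'v \<Rightarrow> bool" where
  "eigdec A u v \<longleftrightarrow> finite {m. u m \<noteq> 0} \<and> (\<forall>m. A (u m) = of_int m *s u m) \<and> Sum_any u = v"

lemma eigdec_add:
  assumes "lin A" "eigdec A u v" "eigdec A u' v'"
  shows "eigdec A (\<lambda>m. u m + u' m) (v + v')"
proof -
  have "finite {m. u m + u' m \<noteq> 0}"
    by (rule finite_subset[of _ "{m. u m \<noteq> 0} \<union> {m. u' m \<noteq> 0}"]) (use assms in \<open>auto simp: eigdec_def\<close>)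
  with assms show ?thesis by (simp add: eigdec_def lin_add scale_right_distrib Sum_any.distrib)
qed

lemma eigdec_scale:
  assumes "lin A" "eigdec A u v"
  shows "eigdec A (\<lambda>m. r *s u m) (r *s v)"
proof -
  have "finite {m. r *s u m \<noteq> 0}"
    by (rule finite_subset[of _ "{m. u m \<noteq> 0}"]) (use assms in \<open>auto simp: eigdec_def\<close>)
  with assms show ?thesis by (auto simp: eigdec_def lin_scale scale_left_commute scale_Sum_any)
qed

lemma eigdec_eigenvector:
  assumes "lin A" "A v = of_int k *s v"
  shows "eigdec A (\<lambda>m. if m = k then v else 0) v"
  using assms by (auto simp: eigdec_def lin_zero)

lemma eigdec_unique:
  assumes A: "lin A" and u: "eigdec A u v" "eigdec A u' v"
  shows "u = u'"
proof
  fix m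
  have d: "eigdec A (\<lambda>m. u m + (-1) *s u' m) (v + (-1) *s v)"
    by (intro eigdec_add eigdec_scale A u)
  let ?w = "\<lambda>m. u m + (-1) *s u' m"
  have "\<forall>m\<in>{m. ?w m \<noteq> 0}. ?w m = 0"
  proof (rule eigenvectors_independent[OF A])
    show "finite {m. ?w m \<noteq> 0}" and "\<And>m. A (?w m) = of_int m *s ?w m"
      using d unfolding eigdec_def by blast+
    have "Sum_any ?w = v + (-1) *s v" using d unfolding eigdec_def by blast
    then show "sum ?w {m. ?w m \<noteq> 0} = 0"
      by (simp add: Sum_any.expand_set)
  qed
  then show "u m = u' m" by auto
qed

end

locale diagonalizable = complex_space scale
  for scale :: "complex \<Rightarrow> 'v::ab_group_add \<Rightarrow> 'v" (infixr "*s" 75) +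
  fixes A :: "'v \<Rightarrow> 'v"
  assumes lin: "lin A"
    and diag: "v \<in> span {u. \<exists>m. A u = of_int m *s u}"
begin

lemma eig_induct:
  assumes "\<And>m v. A v = of_int m *s v \<Longrightarrow> P v" and "\<And>v w. P v \<Longrightarrow> P w \<Longrightarrow> P (v + w)"
  shows "P v"
  using diag
proof (rule span_induct_alt)
  show "P 0" by (rule assms(1)[of _ 0]) (simp add: lin_zero[OF lin])
  fix r x y assume "x \<in> {u. \<exists>m. A u = of_int m *s u}" "P y"
  then obtain m where "A x = of_int m *s x" by blast
  then have "A (r *s x) = of_int m *s r *s x"
    unfolding lin_scale[OF lin] by (metis scale_left_commute)
  then show "P (r *s x + y)" using assms \<open>P y\<close> by blast
qed

lemma eigdec_exists: "\<exists>u. eigdec A u v"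
  by (induction v rule: eig_induct) (blast intro: eigdec_eigenvector[OF lin] eigdec_add[OF lin])+

text \<open>
  Existence and uniqueness of the projections behind the definite description in \<^const>\<open>eig_proj\<close>.
\<close>

lemma eig_proj_spec:
  "lin (eig_proj scale A m) \<and>
    (\<forall>k u. A u = of_int k *s u \<longrightarrow> eig_proj scale A m u = (if k = m then u else 0))"
  unfolding eig_proj_def
proof (rule theI[where a = "\<lambda>v. (SOME u. eigdec A u v) m"])
  let ?T = "\<lambda>v. (SOME u. eigdec A u v) m"
  have T: "eigdec A (SOME u. eigdec A u v) v" for v by (rule someI_ex[OF eigdec_exists])
  have Teq: "?T v = u m" if "eigdec A u v" for u v
    using eigdec_unique[OF lin T that] by simp
  have "lin ?T"
    unfolding lin_iff using Teq[OF eigdec_add[OF lin T T]] Teq[OF eigdec_scale[OF lin T]] by blast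
  moreover have "?T u = (if k = m then u else 0)" if "A u = of_int k *s u" for k u
    using Teq[OF eigdec_eigenvector[OF lin that]] by simp
  ultimately show *: "lin ?T \<and> (\<forall>k u. A u = of_int k *s u \<longrightarrow> ?T u = (if k = m then u else 0))"
    by blast
  fix T' assume T': "lin T' \<and> (\<forall>k u. A u = of_int k *s u \<longrightarrow> T' u = (if k = m then u else 0))"
  show "T' = ?T"
  proof
    fix v show "T' v = ?T v"
    proof (induction v rule: eig_induct)
      case (1 k v)
      with * T' show ?case by metis
    next
      case (2 v w)
      with * T' show ?case using lin_add[of T' v w] lin_add[of ?T v w] by metis
    qed
  qed
qed

lemma lin_eig_proj: "lin (eig_proj scale A m)"
  using eig_proj_spec by blast

lemma eig_proj_eigenvector:
  "A u = of_int k *s u \<Longrightarrow> eig_proj scale A m u = (if k = m then u else 0)"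
  using eig_proj_spec by blast

lemma eig_proj_commute:
  assumes "lin B" "\<And>v. B (A v) = A (B v)"
  shows "eig_proj scale A m (B v) = B (eig_proj scale A m v)"
proof (induction v rule: eig_induct)
  case (1 k v)
  then have "A (B v) = of_int k *s B v" by (simp flip: assms(2) add: lin_scale[OF assms(1)])
  with 1 show ?case
    by (simp only: eig_proj_eigenvector[of v k] eig_proj_eigenvector[of "B v" k] if_distrib[of B]
      lin_zero[OF assms(1)])
qed (simp add: lin_add[OF lin_eig_proj] lin_add[OF assms(1)])

lemma eig_proj_eigdec: "eigdec A (\<lambda>m. eig_proj scale A m v) v"
proof (induction v rule: eig_induct)
  case (1 k v)
  then show ?case
    using eigdec_eigenvector[OF lin 1] by (simp only: eig_proj_eigenvector[OF 1] eq_commute)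
next
  case (2 v w)
  then show ?case by (simp add: lin_add[OF lin_eig_proj] eigdec_add[OF lin])
qed

lemma finite_eig_proj: "finite {m. eig_proj scale A m v \<noteq> 0}"
  and eig_proj_sum: "Sum_any (\<lambda>m. eig_proj scale A m v) = v"
  and eig_proj_eig: "A (eig_proj scale A m v) = of_int m *s eig_proj scale A m v"
  using eig_proj_eigdec[of v] by (auto simp: eigdec_def)

lemma op_powi_eigenvector:
  assumes "A v = of_int k *s v" shows "op_powi scale x A v = x powi k *s v"
  unfolding op_powi_def eig_proj_eigenvector[OF assms] by (subst Sum_any_single[of k]) auto

lemma lin_op_powi: "lin (op_powi scale x A)"
proof -
  have fin: "finite {m. x powi m *s eig_proj scale A m v \<noteq> 0}" for v
    by (rule finite_subset[OF _ finite_eig_proj[of v]]) auto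
  show ?thesis
    unfolding lin_iff op_powi_def
    using fin by (auto simp: lin_add[OF lin_eig_proj] lin_scale[OF lin_eig_proj] scale_right_distrib
       Sum_any.distrib scale_Sum_any mult.commute[of "_ powi _"])
qed

lemma op_powi_commute:
  assumes "lin B" "\<And>v. B (A v) = A (B v)"
  shows "op_powi scale x A (B v) = B (op_powi scale x A v)"
proof (induction v rule: eig_induct)
  case (1 k v)
  then have "A (B v) = of_int k *s B v" by (simp flip: assms(2) add: lin_scale[OF assms(1)])
  with 1 show ?case
    by (simp only: op_powi_eigenvector[of v k] op_powi_eigenvector[of "B v" k] lin_scale[OF assms(1)])
qed (simp add: lin_add[OF lin_op_powi] lin_add[OF assms(1)])

lemma op_powi_mult:
  "op_powi scale x A (op_powi scale y A v) = op_powi scale (x * y) A v"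
proof (induction v rule: eig_induct)
  case (1 k v)
  then show ?case
    by (simp only: op_powi_eigenvector[OF 1] lin_scale[OF lin_op_powi] power_int_mult_distrib
      scale_scale mult.commute)
qed (simp add: lin_add[OF lin_op_powi])

lemma op_powi_one: "op_powi scale 1 A v = v"
  by (simp add: op_powi_def eig_proj_sum)

end

section \<open>Charges and exponentials of the oscillators\<close>

context boson_oscillators
begin

sublocale complex_space scale
  by unfold_locales

sublocale A0: diagonalizable scale "a 0"
  by (intro diagonalizable.intro diagonalizable_axioms.intro complex_space_axioms linear_a diag_a0)

sublocale C0: diagonalizable scale "c 0"
  by (intro diagonalizable.intro diagonalizable_axioms.intro complex_space_axioms linear_c diag_c0)

notation scale (infixr "*s" 75)

definition charged :: "int \<Rightarrow> int \<Rightarrow> 'v \<Rightarrow> bool" where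
  "charged m l v \<longleftrightarrow> a 0 v = of_int m *s v \<and> c 0 v = of_int l *s v"

lemma charged_add: "charged m l v \<Longrightarrow> charged m l w \<Longrightarrow> charged m l (v + w)"
  by (simp add: charged_def lin_add[OF linear_a] lin_add[OF linear_c] scale_right_distrib)

lemma charged_0: "charged m l 0"
  by (simp add: charged_def lin_zero[OF linear_a] lin_zero[OF linear_c])

lemma charged_scale: "charged m l v \<Longrightarrow> charged m l (r *s v)"
  unfolding charged_def lin_scale[OF linear_a] lin_scale[OF linear_c]
  by (metis scale_left_commute)

lemma charged_sum: "(\<And>i. i \<in> S \<Longrightarrow> charged m l (f i)) \<Longrightarrow> charged m l (sum f S)"
  by (induction S rule: infinite_finite_induct) (auto intro: charged_0 charged_add)

text \<open>
  The two zero modes are simultaneously diagonalizable: the projections onto the eigenspaces of \<open>c\<^sub>0\<close>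
  commute with \<open>a\<^sub>0\<close>, hence split its eigenvectors into joint ones.
\<close>

lemma charged_induct [case_names charged add]:
  assumes ch: "\<And>m l v. charged m l v \<Longrightarrow> P v" and add: "\<And>v w. P v \<Longrightarrow> P w \<Longrightarrow> P (v + w)"
  shows "P v"
proof (induction v rule: A0.eig_induct)
  case (1 m u)
  have "charged m l (eig_proj scale (c 0) l u)" for l
  proof -
    have "a 0 (eig_proj scale (c 0) l u) = eig_proj scale (c 0) l (a 0 u)"
      by (rule C0.eig_proj_commute[symmetric]) (simp_all add: linear_a comm_ac)
    also have "\<dots> = of_int m *s eig_proj scale (c 0) l u"
      by (simp only: 1 lin_scale[OF C0.lin_eig_proj])
    finally show ?thesis by (simp add: charged_def C0.eig_proj_eig)
  qed
  then have "P (eig_proj scale (c 0) l u)" for l by (rule ch)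
  then have "P (\<Sum>l\<in>S. eig_proj scale (c 0) l u)" for S
    by (induction S rule: infinite_finite_induct) (auto intro: add ch[OF charged_0])
  then show ?case using C0.eig_proj_sum[of u] by (metis Sum_any.expand_set)
qed (fact add)

lemma linear_eq_on_charged:
  assumes "lin f" "lin g" "\<And>m l v. charged m l v \<Longrightarrow> f v = g v"
  shows "f v = g v"
  by (induction v rule: charged_induct) (simp_all add: assms(3) lin_add[OF assms(1)] lin_add[OF assms(2)])

text \<open>
  Local finiteness passes from the joint eigenvectors to all vectors, and makes infinite sums of
  operators linear.
\<close>

lemma Sum_any_linear_family:
  assumes F: "\<And>i. lin (F i)" and fin: "\<And>m l v. charged m l v \<Longrightarrow> finite {i. F i v \<noteq> 0}"
  shows "finite {i. F i v \<noteq> 0}" and "lin (\<lambda>v. Sum_any (\<lambda>i. F i v))"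
proof -
  show fin: "finite {i. F i v \<noteq> 0}" for v
  proof (induction v rule: charged_induct)
    case (add v w)
    have "{i. F i (v + w) \<noteq> 0} \<subseteq> {i. F i v \<noteq> 0} \<union> {i. F i w \<noteq> 0}"
      by (auto simp: lin_add[OF F])
    then show ?case by (rule finite_subset) (use add in blast)
  qed (fact fin)
  show "lin (\<lambda>v. Sum_any (\<lambda>i. F i v))"
    unfolding lin_iff using fin
    by (simp add: lin_add[OF F] lin_scale[OF F] Sum_any.distrib scale_Sum_any)
qed

text \<open>
  \<open>shift \<epsilon> \<eta>\<close> is \<open>exp (\<epsilon> Q\<^sub>a + \<eta> Q\<^sub>c)\<close>.
\<close>

definition shift :: "int \<Rightarrow> int \<Rightarrow> 'v \<Rightarrow> 'v" where
  "shift \<epsilon> \<eta> v = exp_charge eQa \<epsilon> (exp_charge eQc \<eta> v)"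

abbreviation sign :: "int \<Rightarrow> bool" where "sign \<epsilon> \<equiv> \<epsilon> = 1 \<or> \<epsilon> = -1"

lemma exp_charge_simps: "exp_charge eQ 1 = eQ" "exp_charge eQ (-1) = inv eQ"
  by (simp_all add: exp_charge_def)

lemma lin_inv:
  assumes "lin f" "bij f" shows "lin (inv f)"
  unfolding lin_iff
proof (intro conjI allI)
  fix x y r
  have "f (inv f x + inv f y) = x + y" "f (r *s inv f x) = r *s x"
    using assms by (simp_all add: lin_add lin_scale bij_is_surj surj_f_inv_f)
  then show "inv f (x + y) = inv f x + inv f y" "inv f (r *s x) = r *s inv f x"
    using assms by (metis bij_inv_eq_iff)+
qed

lemma commute_inv:
  assumes "bij f" "\<And>v. f (g v) = g (f v)" shows "inv f (g v) = g (inv f v)"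
  using assms by (metis bij_inv_eq_iff)

lemma exp_charge_lin: "sign \<epsilon> \<Longrightarrow> lin (exp_charge eQa \<epsilon>)" "sign \<epsilon> \<Longrightarrow> lin (exp_charge eQc \<epsilon>)"
  by (auto simp: exp_charge_simps lin_inv linear_eQa linear_eQc bij_eQa bij_eQc)

lemma exp_charge_commute:
  assumes "sign \<epsilon>"
  shows "(\<And>v. eQa (g v) = g (eQa v)) \<Longrightarrow> exp_charge eQa \<epsilon> (g v) = g (exp_charge eQa \<epsilon> v)"
    and "(\<And>v. eQc (g v) = g (eQc v)) \<Longrightarrow> exp_charge eQc \<epsilon> (g v) = g (exp_charge eQc \<epsilon> v)"
  using assms commute_inv[OF bij_eQa, of g] commute_inv[OF bij_eQc, of g]
  by (auto simp: exp_charge_simps)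

lemma exp_charge_cancel:
  assumes "sign \<epsilon>"
  shows "exp_charge eQa \<epsilon> (exp_charge eQa (- \<epsilon>) v) = v" "exp_charge eQc \<epsilon> (exp_charge eQc (- \<epsilon>) v) = v"
  using assms bij_eQa bij_eQc
  by (auto simp: exp_charge_simps bij_is_surj surj_f_inv_f bij_is_inj)

lemma exp_charge_ac:
  assumes "sign \<epsilon>" "sign \<eta>"
  shows "exp_charge eQa \<epsilon> (exp_charge eQc \<eta> v) = exp_charge eQc \<eta> (exp_charge eQa \<epsilon> v)"
proof (rule exp_charge_commute(1)[OF assms(1)])
  fix v show "eQa (exp_charge eQc \<eta> v) = exp_charge eQc \<eta> (eQa v)"
    by (rule exp_charge_commute(2)[OF assms(2), symmetric]) (simp add: comm_eQ)
qed

lemma exp_charge_same: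
  assumes "sign \<epsilon>" "sign \<eta>"
  shows "exp_charge eQa \<epsilon> (exp_charge eQa \<eta> v) = exp_charge eQa \<eta> (exp_charge eQa \<epsilon> v)"
    "exp_charge eQc \<epsilon> (exp_charge eQc \<eta> v) = exp_charge eQc \<eta> (exp_charge eQc \<epsilon> v)"
  using assms exp_charge_cancel[of \<epsilon> v] exp_charge_cancel[of \<eta> v] by auto

lemma lin_shift: "sign \<epsilon> \<Longrightarrow> sign \<eta> \<Longrightarrow> lin (shift \<epsilon> \<eta>)"
  unfolding shift_def by (rule lin_comp[OF exp_charge_lin])

lemma shift_shift_commute:
  assumes "sign \<epsilon>" "sign \<eta>" "sign \<epsilon>'" "sign \<eta>'"
  shows "shift \<epsilon> \<eta> (shift \<epsilon>' \<eta>' v) = shift \<epsilon>' \<eta>' (shift \<epsilon> \<eta> v)"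
  unfolding shift_def exp_charge_ac[OF assms(3,2), symmetric] exp_charge_same(1)[OF assms(1,3)]
    exp_charge_same(2)[OF assms(2,4)] exp_charge_ac[OF assms(1,4)] ..

lemma shift_cancel:
  assumes "sign \<epsilon>" "sign \<eta>" shows "shift \<epsilon> \<eta> (shift (- \<epsilon>) (- \<eta>) v) = v"
proof -
  have "sign (- \<epsilon>)" "sign (- \<eta>)" using assms by auto
  then show ?thesis
    unfolding shift_def exp_charge_ac[OF \<open>sign (- \<epsilon>)\<close> assms(2), symmetric] exp_charge_cancel[OF assms(1)]
      exp_charge_cancel[OF assms(2)] by simp
qed

lemma exp_charge_eigenvalue:
  assumes eQ: "lin eQ" "bij eQ" and Z: "\<And>w. Z (eQ w) - eQ (Z w) = eQ w"
    and v: "Z v = of_int m *s v" and "sign \<epsilon>"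
  shows "Z (exp_charge eQ \<epsilon> v) = of_int (m + \<epsilon>) *s exp_charge eQ \<epsilon> v"
proof -
  have plus: "Z (eQ w) = eQ (Z w) + eQ w" for w
    using Z[of w] by (simp add: diff_eq_eq add.commute)
  have minus: "Z (inv eQ w) = inv eQ (Z w) - inv eQ w" for w
  proof -
    have "Z w = eQ (Z (inv eQ w)) + w"
      using plus[of "inv eQ w"] by (simp add: bij_is_surj[OF eQ(2)] surj_f_inv_f)
    then have "inv eQ (Z w) = Z (inv eQ w) + inv eQ w"
      by (simp add: lin_add[OF lin_inv[OF eQ]] bij_is_inj[OF eQ(2)])
    then show ?thesis by simp
  qed
  show ?thesis
    using \<open>sign \<epsilon>\<close>
    by (auto simp: exp_charge_simps v lin_scale[OF eQ(1)] lin_scale[OF lin_inv[OF eQ]] plus minus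
      scale_left_distrib scale_left_diff_distrib)
qed

lemma charged_exp_charge:
  assumes "charged m l v" "sign \<epsilon>"
  shows "charged (m + \<epsilon>) l (exp_charge eQa \<epsilon> v)" "charged m (l + \<epsilon>) (exp_charge eQc \<epsilon> v)"
proof -
  have v: "a 0 v = of_int m *s v" "c 0 v = of_int l *s v" using assms by (auto simp: charged_def)
  have "c 0 (exp_charge eQa \<epsilon> v) = exp_charge eQa \<epsilon> (c 0 v)"
      "a 0 (exp_charge eQc \<epsilon> v) = exp_charge eQc \<epsilon> (a 0 v)"
    by (rule exp_charge_commute[OF assms(2), symmetric], simp add: comm_c_eQa comm_a_eQc)+
  then show "charged (m + \<epsilon>) l (exp_charge eQa \<epsilon> v)" "charged m (l + \<epsilon>) (exp_charge eQc \<epsilon> v)"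
    unfolding charged_def
      exp_charge_eigenvalue[OF linear_eQa bij_eQa comm_a0_eQa v(1) assms(2)]
      exp_charge_eigenvalue[OF linear_eQc bij_eQc comm_c0_eQc v(2) assms(2)]
    by (simp_all add: v lin_scale[OF exp_charge_lin(1)[OF assms(2)]] lin_scale[OF exp_charge_lin(2)[OF assms(2)]])
qed

lemma charged_shift:
  "charged m l v \<Longrightarrow> sign \<epsilon> \<Longrightarrow> sign \<eta> \<Longrightarrow> charged (m + \<epsilon>) (l + \<eta>) (shift \<epsilon> \<eta> v)"
  unfolding shift_def by (intro charged_exp_charge)

definition bmode :: "int \<Rightarrow> (nat \<Rightarrow> complex) \<Rightarrow> (nat \<Rightarrow> complex) \<Rightarrow> nat \<Rightarrow> 'v \<Rightarrow> 'v" where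
  "bmode d \<sigma> \<tau> n v = \<sigma> n *s a (d * int n) v + \<tau> n *s c (d * int n) v"

text \<open>
  The coefficients of \<open>exp (\<Sum>n>0. (\<sigma>\<^sub>n a\<^sub>d\<^sub>n + \<tau>\<^sub>n c\<^sub>d\<^sub>n) x\<^sup>n)\<close>, with \<open>d = 1\<close> for annihilating and \<open>d = -1\<close>
  for creating exponentials. They are indexed by integers, with value \<open>0\<close> at negative indices, so that
  sums over all integers can be shifted freely.
\<close>

definition bexp :: "int \<Rightarrow> (nat \<Rightarrow> complex) \<Rightarrow> (nat \<Rightarrow> complex) \<Rightarrow> int \<Rightarrow> 'v \<Rightarrow> 'v" where
  "bexp d \<sigma> \<tau> i v = (if i < 0 then 0 else op_exp scale (bmode d \<sigma> \<tau>) (nat i) v)"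

lemma lin_bmode: "lin (bmode d \<sigma> \<tau> n)"
  unfolding bmode_def by (intro lin_plus lin_smult linear_a linear_c)

lemma lin_bexp: "lin (bexp d \<sigma> \<tau> i)"
  unfolding bexp_def by (cases "i < 0") (simp_all add: lin_0 lin_op_exp lin_bmode)

lemmas bexp_simps = lin_add[OF lin_bexp] lin_scale[OF lin_bexp] lin_sum[OF lin_bexp] lin_zero[OF lin_bexp]

lemma bexp_neg: "i < 0 \<Longrightarrow> bexp d \<sigma> \<tau> i v = 0"
  by (simp add: bexp_def)

lemma bexp_0: "bexp d \<sigma> \<tau> 0 v = v"
  by (simp add: bexp_def op_exp_0)

lemma bmode_commutator:
  assumes "d \<noteq> 0" "d' \<noteq> 0" "i > 0" "j > 0"
  shows "bmode d \<sigma> \<tau> i (bmode d' \<sigma>' \<tau>' j v) = bmode d' \<sigma>' \<tau>' j (bmode d \<sigma> \<tau> i v) +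
    (if d * int i + d' * int j = 0 then
      ((\<sigma> i * \<sigma>' j * (-1) powi (d * int i) + \<tau> i * \<tau>' j) * (qint q (d * int i))\<^sup>2 / of_int (d * int i)) *s v else 0)"
proof -
  let ?n = "d * int i" and ?m = "d' * int j"
  have nz: "?n \<noteq> 0" "?m \<noteq> 0" using assms by auto
  have aa: "a ?n (a ?m v) = a ?m (a ?n v) +
    (if ?n + ?m = 0 then (-1) powi ?n * (qint q ?n)\<^sup>2 / of_int ?n else 0) *s v"
    using comm_aa[OF nz, of v] by (metis add.commute diff_eq_eq)
  have cc: "c ?n (c ?m v) = c ?m (c ?n v) +
    (if ?n + ?m = 0 then (qint q ?n)\<^sup>2 / of_int ?n else 0) *s v"
    using comm_cc[OF nz, of v] by (metis add.commute diff_eq_eq)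
  show ?thesis
    unfolding bmode_def lin_add[OF linear_a] lin_add[OF linear_c] lin_scale[OF linear_a]
      lin_scale[OF linear_c] scale_right_distrib aa cc scale_scale
    by (simp add: comm_ac scale_left_distrib scale_right_distrib algebra_simps add_divide_distrib)
qed

lemma bmode_commuting: "d \<noteq> 0 \<Longrightarrow> commuting (bmode d \<sigma> \<tau>) (bmode d \<sigma>' \<tau>')"
proof (intro allI impI)
  fix i j :: nat and v assume "d \<noteq> 0" "i > 0" "j > 0"
  moreover from this have "d * int i + d * int j \<noteq> 0"
    by (metis add_gr_0 distrib_left mult_eq_0_iff of_nat_0_eq_iff of_nat_add less_irrefl)
  ultimately show "bmode d \<sigma> \<tau> i (bmode d \<sigma>' \<tau>' j v) = bmode d \<sigma>' \<tau>' j (bmode d \<sigma> \<tau> i v)"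
    by (subst bmode_commutator) simp_all
qed

lemma bexp_intertwine:
  assumes "d \<noteq> 0" "lin T" "\<And>i v. i > 0 \<Longrightarrow> T (bmode d \<sigma> \<tau> i v) = bmode d \<sigma> \<tau> i (T v)"
  shows "T (bexp d \<sigma> \<tau> i v) = bexp d \<sigma> \<tau> i (T v)"
proof -
  have "T (op_exp scale (bmode d \<sigma> \<tau>) (nat i) v) = op_exp scale (bmode d \<sigma> \<tau>) (nat i) (T v)"
    using op_exp_intertwine[where \<alpha> = "bmode d \<sigma> \<tau>" and \<beta> = "bmode d \<sigma> \<tau>" and T = T,
        OF lin_bmode lin_bmode assms(2) bmode_commuting bmode_commuting] assms(1,3) by blast
  then show ?thesis by (simp add: bexp_def lin_zero[OF assms(2)])
qed

lemma bexp_commute: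
  assumes "d \<noteq> 0"
  shows "bexp d \<sigma> \<tau> i (bexp d \<sigma>' \<tau>' j v) = bexp d \<sigma>' \<tau>' j (bexp d \<sigma> \<tau> i v)"
proof (rule bexp_intertwine[OF assms lin_bexp])
  fix j :: nat and v assume "j > 0"
  show "bexp d \<sigma> \<tau> i (bmode d \<sigma>' \<tau>' j v) = bmode d \<sigma>' \<tau>' j (bexp d \<sigma> \<tau> i v)"
    by (rule bexp_intertwine[OF assms lin_bmode, symmetric])
      (use bmode_commuting[OF assms] \<open>j > 0\<close> in blast)
qed

lemma bexp_mult:
  assumes "d \<noteq> 0"
  shows "(\<Sum>k\<in>{0..p}. bexp d \<sigma> \<tau> k (bexp d \<sigma>' \<tau>' (p - k) v)) =
    bexp d (\<lambda>n. \<sigma> n + \<sigma>' n) (\<lambda>n. \<tau> n + \<tau>' n) p v"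
proof (cases "p < 0")
  case False
  have eq: "bmode d (\<lambda>n. \<sigma> n + \<sigma>' n) (\<lambda>n. \<tau> n + \<tau>' n) = (\<lambda>n v. bmode d \<sigma> \<tau> n v + bmode d \<sigma>' \<tau>' n v)"
    by (simp add: bmode_def fun_eq_iff scale_left_distrib add_ac)
  have "(\<Sum>k\<in>{0..p}. bexp d \<sigma> \<tau> k (bexp d \<sigma>' \<tau>' (p - k) v)) =
    (\<Sum>k\<le>nat p. op_exp scale (bmode d \<sigma> \<tau>) k (op_exp scale (bmode d \<sigma>' \<tau>') (nat p - k) v))"
    by (rule sum.reindex_bij_witness[where i = int and j = nat])
      (use False in \<open>auto simp: bexp_def nat_diff_distrib\<close>)
  also have "\<dots> = bexp d (\<lambda>n. \<sigma> n + \<sigma>' n) (\<lambda>n. \<tau> n + \<tau>' n) p v"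
    using False op_exp_mult[OF lin_bmode lin_bmode bmode_commuting bmode_commuting bmode_commuting,
      OF assms assms assms] by (simp add: bexp_def eq)
  finally show ?thesis .
qed (simp add: bexp_neg)

lemma bexp_dilate:
  assumes "d \<noteq> 0"
  shows "bexp d (\<lambda>n. y ^ n * \<sigma> n) (\<lambda>n. y ^ n * \<tau> n) i v = y powi i *s bexp d \<sigma> \<tau> i v"
proof -
  have eq: "bmode d (\<lambda>n. y ^ n * \<sigma> n) (\<lambda>n. y ^ n * \<tau> n) = (\<lambda>n v. y ^ n *s bmode d \<sigma> \<tau> n v)"
    by (simp add: bmode_def fun_eq_iff scale_right_distrib)
  show ?thesis
    using op_exp_dilate[OF lin_bmode bmode_commuting[OF assms]]
    by (simp add: bexp_def eq power_int_def)
qed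

lemma bexp_kill:
  assumes "d \<noteq> 0" "\<And>n. n > 0 \<Longrightarrow> bmode d \<sigma> \<tau> n v = 0"
  shows "bexp d \<sigma> \<tau> i v = (if i = 0 then v else 0)"
  using op_exp_kill[OF lin_bmode bmode_commuting[OF assms(1)] assms(2)] by (simp add: bexp_def)

lemma bexp_trivial:
  assumes "d \<noteq> 0" "\<And>n. n > 0 \<Longrightarrow> \<sigma> n = 0" "\<And>n. n > 0 \<Longrightarrow> \<tau> n = 0"
  shows "bexp d \<sigma> \<tau> i v = (if i = 0 then v else 0)"
  by (rule bexp_kill[OF assms(1)]) (simp add: bmode_def assms(2,3))

lemma bexp_cong:
  assumes "d \<noteq> 0" "\<And>n. n > 0 \<Longrightarrow> \<sigma> n = \<sigma>' n" "\<And>n. n > 0 \<Longrightarrow> \<tau> n = \<tau>' n"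
  shows "bexp d \<sigma> \<tau> i v = bexp d \<sigma>' \<tau>' i v"
proof -
  have "op_exp scale (bmode d \<sigma> \<tau>) (nat i) v = op_exp scale (bmode d \<sigma>' \<tau>') (nat i) v"
    by (rule op_exp_intertwine[where T = "\<lambda>v. v", OF lin_bmode lin_bmode lin_id
        bmode_commuting[OF assms(1)] bmode_commuting[OF assms(1)]])
      (simp add: bmode_def assms(2,3))
  then show ?thesis by (simp add: bexp_def)
qed

lemma bexp_eQ:
  assumes "d \<noteq> 0" "sign \<epsilon>" "sign \<eta>"
  shows "shift \<epsilon> \<eta> (bexp d \<sigma> \<tau> i v) = bexp d \<sigma> \<tau> i (shift \<epsilon> \<eta> v)"
proof (rule bexp_intertwine[OF assms(1) lin_shift[OF assms(2,3)]])
  fix i :: nat and v assume "i > 0"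
  then have nz: "d * int i \<noteq> 0" using assms by simp
  have "exp_charge eQa \<epsilon> (bmode d \<sigma> \<tau> i v) = bmode d \<sigma> \<tau> i (exp_charge eQa \<epsilon> v)" for v
    by (rule exp_charge_commute(1)[OF assms(2)])
      (simp add: bmode_def lin_add[OF linear_eQa] lin_scale[OF linear_eQa] comm_a_eQa[OF nz] comm_c_eQa)
  moreover have "exp_charge eQc \<eta> (bmode d \<sigma> \<tau> i v) = bmode d \<sigma> \<tau> i (exp_charge eQc \<eta> v)" for v
    by (rule exp_charge_commute(2)[OF assms(3)])
      (simp add: bmode_def lin_add[OF linear_eQc] lin_scale[OF linear_eQc] comm_c_eQc[OF nz] comm_a_eQc)
  ultimately show "shift \<epsilon> \<eta> (bmode d \<sigma> \<tau> i v) = bmode d \<sigma> \<tau> i (shift \<epsilon> \<eta> v)"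
    by (simp add: shift_def)
qed

lemma zero_mode_bexp:
  assumes "d \<noteq> 0"
  shows "a 0 (bexp d \<sigma> \<tau> i v) = bexp d \<sigma> \<tau> i (a 0 v)" "c 0 (bexp d \<sigma> \<tau> i v) = bexp d \<sigma> \<tau> i (c 0 v)"
  by (rule bexp_intertwine[OF assms linear_a], simp add: bmode_def lin_add[OF linear_a]
        lin_scale[OF linear_a] comm_a0 comm_ac)
    (rule bexp_intertwine[OF assms linear_c], simp add: bmode_def lin_add[OF linear_c]
        lin_scale[OF linear_c] comm_c0 comm_ac[symmetric])

lemma charged_bexp: "d \<noteq> 0 \<Longrightarrow> charged m l v \<Longrightarrow> charged m l (bexp d \<sigma> \<tau> i v)"
  by (simp add: charged_def zero_mode_bexp bexp_simps)

text \<open>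
  The commutator of the \<open>n\<close>-th modes is a scalar proportional to \<open>[n]\<^sub>q\<^sup>2 / n\<close>; the factor \<open>1/n\<close>
  disappears in the logarithmic derivative of \<open>f\<close>.
\<close>

lemma bexp_reorder:
  assumes f: "fps_nth f 0 = 1"
    and \<gamma>: "fps_X * fps_deriv f = Abs_fps (\<lambda>n. (\<sigma> n * \<sigma>' n * (-1) ^ n + \<tau> n * \<tau>' n) * (qint q (int n))\<^sup>2) * f"
  shows "bexp 1 \<sigma> \<tau> m (bexp (-1) \<sigma>' \<tau>' n v) =
    (\<Sum>k\<in>{0..min m n}. fps_nth f (nat k) *s bexp (-1) \<sigma>' \<tau>' (n - k) (bexp 1 \<sigma> \<tau> (m - k) v))"
proof (cases "m < 0 \<or> n < 0")
  case False
  define \<gamma> where "\<gamma> n = (\<sigma> n * \<sigma>' n * (-1) ^ n + \<tau> n * \<tau>' n) * (qint q (int n))\<^sup>2 / of_nat n" for n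
  have com: "bmode 1 \<sigma> \<tau> i (bmode (-1) \<sigma>' \<tau>' j v) = bmode (-1) \<sigma>' \<tau>' j (bmode 1 \<sigma> \<tau> i v)
      + (if j = i then \<gamma> i *s v else 0)" if "i > 0" "j > 0" for i j v
    using bmode_commutator[of 1 "-1" i j \<sigma> \<tau> \<sigma>' \<tau>' v] that by (auto simp: \<gamma>_def)
  have f': "fps_X * fps_deriv f = Abs_fps (\<lambda>n. of_nat n * \<gamma> n) * f"
  proof -
    have "Abs_fps (\<lambda>n. of_nat n * \<gamma> n) =
      Abs_fps (\<lambda>n. (\<sigma> n * \<sigma>' n * (-1) ^ n + \<tau> n * \<tau>' n) * (qint q (int n))\<^sup>2)"
      by (auto simp: fps_eq_iff \<gamma>_def qint_def)
    then show ?thesis using assms(2) by simp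
  qed
  have "bexp 1 \<sigma> \<tau> m (bexp (-1) \<sigma>' \<tau>' n v) =
      op_exp scale (bmode 1 \<sigma> \<tau>) (nat m) (op_exp scale (bmode (-1) \<sigma>' \<tau>') (nat n) v)"
    using False by (simp add: bexp_def)
  also have "\<dots> = (\<Sum>k\<le>min (nat m) (nat n). fps_nth f k *s op_exp scale (bmode (-1) \<sigma>' \<tau>') (nat n - k)
      (op_exp scale (bmode 1 \<sigma> \<tau>) (nat m - k) v))"
    by (rule op_exp_reorder[OF lin_bmode lin_bmode bmode_commuting bmode_commuting com f f']) auto
  also have "\<dots> = (\<Sum>k\<in>{0..min m n}. fps_nth f (nat k) *s bexp (-1) \<sigma>' \<tau>' (n - k) (bexp 1 \<sigma> \<tau> (m - k) v))"
    by (rule sum.reindex_bij_witness[where j = int and i = nat])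
      (use False in \<open>auto simp: bexp_def nat_diff_distrib\<close>)
  finally show ?thesis .
next
  case True
  then have "{0..min m n} = {}" by auto
  with True show ?thesis by (auto simp: bexp_neg bexp_simps)
qed

text \<open>
  The vectors obtained from \<open>v\<close> by annihilation operators of total degree \<open>n\<close>. They vanish for large
  \<open>n\<close>, which bounds all sums below.
\<close>

definition lowered :: "'v \<Rightarrow> int \<Rightarrow> 'v set" where
  "lowered v n = span {foldr a ns (foldr c ms v) |ns ms.
     (\<forall>i\<in>set ns \<union> set ms. i > 0) \<and> sum_list ns + sum_list ms = n}"

lemma lin_mem_span:
  assumes "lin f" "x \<in> span S" "\<And>y. y \<in> S \<Longrightarrow> f y \<in> span S'"
  shows "f x \<in> span S'"
  using assms(2)
  by (induction x rule: span_induct_alt)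
    (auto simp: lin_zero[OF assms(1)] lin_add[OF assms(1)] lin_scale[OF assms(1)]
      intro: span_zero span_add span_scale assms(3))

lemma lowered_mode:
  assumes "w \<in> lowered v n" "i > 0"
  shows "a i w \<in> lowered v (n + i)" "c i w \<in> lowered v (n + i)"
proof -
  have ca: "c i (foldr a ns w) = foldr a ns (c i w)" for ns w
    by (induction ns) (simp_all add: comm_ac[symmetric])
  show "a i w \<in> lowered v (n + i)"
    unfolding lowered_def
  proof (rule lin_mem_span[OF linear_a assms(1)[unfolded lowered_def]])
    fix y assume "y \<in> {foldr a ns (foldr c ms v) |ns ms.
     (\<forall>i\<in>set ns \<union> set ms. i > 0) \<and> sum_list ns + sum_list ms = n}"
    then obtain ns ms where "y = foldr a ns (foldr c ms v)"
      "\<forall>i\<in>set ns \<union> set ms. i > 0" "sum_list ns + sum_list ms = n" by blast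
    with assms(2) show "a i y \<in> span {foldr a ns (foldr c ms v) |ns ms.
      (\<forall>i\<in>set ns \<union> set ms. i > 0) \<and> sum_list ns + sum_list ms = n + i}"
      by (intro span_base CollectI exI[of _ "i # ns"] exI[of _ ms]) auto
  qed
  show "c i w \<in> lowered v (n + i)"
    unfolding lowered_def
  proof (rule lin_mem_span[OF linear_c assms(1)[unfolded lowered_def]])
    fix y assume "y \<in> {foldr a ns (foldr c ms v) |ns ms.
     (\<forall>i\<in>set ns \<union> set ms. i > 0) \<and> sum_list ns + sum_list ms = n}"
    then obtain ns ms where "y = foldr a ns (foldr c ms v)"
      "\<forall>i\<in>set ns \<union> set ms. i > 0" "sum_list ns + sum_list ms = n" by blast
    with assms(2) show "c i y \<in> span {foldr a ns (foldr c ms v) |ns ms.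
      (\<forall>i\<in>set ns \<union> set ms. i > 0) \<and> sum_list ns + sum_list ms = n + i}"
      by (intro span_base CollectI exI[of _ ns] exI[of _ "i # ms"]) (auto simp: ca)
  qed
qed

lemma lowered_subspace:
  "0 \<in> lowered v n" "x \<in> lowered v n \<Longrightarrow> y \<in> lowered v n \<Longrightarrow> x + y \<in> lowered v n"
  "x \<in> lowered v n \<Longrightarrow> r *s x \<in> lowered v n"
  "(\<And>i. i \<in> S \<Longrightarrow> f i \<in> lowered v n) \<Longrightarrow> sum f S \<in> lowered v n"
  unfolding lowered_def by (intro span_zero span_add span_scale span_sum; assumption)+

lemma lowered_op_pow:
  "w \<in> lowered v n \<Longrightarrow> op_pow (bmode 1 \<sigma> \<tau>) k m w \<in> lowered v (n + int m)"
proof (induction k arbitrary: m)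
  case (Suc k)
  have "bmode 1 \<sigma> \<tau> i (op_pow (bmode 1 \<sigma> \<tau>) k (m - i) w) \<in> lowered v (n + int m)" if "i \<in> {1..m}" for i
  proof -
    have "op_pow (bmode 1 \<sigma> \<tau>) k (m - i) w \<in> lowered v (n + int (m - i))" by (rule Suc.IH[OF Suc.prems])
    then have "bmode 1 \<sigma> \<tau> i (op_pow (bmode 1 \<sigma> \<tau>) k (m - i) w) \<in> lowered v (n + int (m - i) + int i)"
      unfolding bmode_def using that lowered_mode[of _ v "n + int (m - i)" "int i"]
      by (intro lowered_subspace(2,3)) auto
    with that show ?thesis by (simp add: of_nat_diff)
  qed
  then show ?case by (auto intro: lowered_subspace)
qed (auto intro: lowered_subspace)

lemma lowered_bexp: "w \<in> lowered v n \<Longrightarrow> bexp 1 \<sigma> \<tau> i w \<in> lowered v (n + i)"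
  unfolding bexp_def op_exp_def
  using lowered_op_pow[of w v n \<sigma> \<tau> _ "nat i"] by (auto intro!: lowered_subspace)

lemma lowered_self: "v \<in> lowered v 0"
  unfolding lowered_def by (intro span_base CollectI exI[of _ "[]"]) simp

lemma lowered_vanish: "\<exists>N. \<forall>n>N. lowered v n = {0}"
proof -
  obtain N where N: "\<forall>ns ms. (\<forall>n \<in> set ns \<union> set ms. n > 0) \<longrightarrow> sum_list ns + sum_list ms > N \<longrightarrow>
      foldr a ns (foldr c ms v) = 0" using smooth by blast
  have "lowered v n = {0}" if "n > N" for n
  proof -
    have "lowered v n \<subseteq> span {0}"
      unfolding lowered_def by (rule span_mono) (use N that in auto)
    with lowered_subspace(1) show ?thesis by auto
  qed
  then show ?thesis by blast
qed

lemma bexp_vanish: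
  obtains N where "N \<ge> 0" "\<And>\<sigma> \<tau> i. i > N \<Longrightarrow> bexp 1 \<sigma> \<tau> i v = 0"
    "\<And>\<sigma> \<tau> i \<sigma>' \<tau>' j. i + j > N \<Longrightarrow> bexp 1 \<sigma> \<tau> i (bexp 1 \<sigma>' \<tau>' j v) = 0"
proof -
  obtain N where "\<forall>n>N. lowered v n = {0}" using lowered_vanish by blast
  then have N: "\<forall>n>max N 0. lowered v n = {0}" by simp
  have 1: "bexp 1 \<sigma> \<tau> i v \<in> lowered v i" for \<sigma> \<tau> i
    using lowered_bexp[OF lowered_self] by simp
  have "bexp 1 \<sigma> \<tau> i (bexp 1 \<sigma>' \<tau>' j v) \<in> lowered v (j + i)" for \<sigma> \<tau> i \<sigma>' \<tau>' j
    by (rule lowered_bexp[OF 1])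
  with N 1 show ?thesis using that[of "max N 0"] by (metis add.commute empty_iff insertE max.cobounded2)
qed

end

section \<open>Normally ordered products\<close>

context boson_oscillators
begin

text \<open>
  The coefficient of \<open>z\<^sup>d\<close> in \<open>C(z) A(1/z)\<close>.
\<close>

definition nord :: "(int \<Rightarrow> 'v \<Rightarrow> 'v) \<Rightarrow> (int \<Rightarrow> 'v \<Rightarrow> 'v) \<Rightarrow> int \<Rightarrow> 'v \<Rightarrow> 'v" where
  "nord C A d v = Sum_any (\<lambda>i. C i (A (i - d) v))"

text \<open>
  The coefficient of \<open>z\<^sup>D w\<^sup>E\<close> in \<open>(\<Sum>k. S\<^sub>k (w/z)\<^sup>k) C\<^sub>1(z) C\<^sub>2(w) A\<^sub>1(1/z) A\<^sub>2(1/w)\<close>. The sequence \<open>S\<close> is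
  indexed by all integers and arbitrary, so it may be the expansion of a rational function in either
  domain, or a delta function.
\<close>

definition wick :: "(int \<Rightarrow> complex) \<Rightarrow> (int \<Rightarrow> 'v \<Rightarrow> 'v) \<Rightarrow> (int \<Rightarrow> 'v \<Rightarrow> 'v) \<Rightarrow> (int \<Rightarrow> 'v \<Rightarrow> 'v) \<Rightarrow>
    (int \<Rightarrow> 'v \<Rightarrow> 'v) \<Rightarrow> int \<Rightarrow> int \<Rightarrow> 'v \<Rightarrow> 'v" where
  "wick S C1 C2 A1 A2 D E v =
    Sum_any (\<lambda>(i, j, k). S k *s C1 i (C2 j (A1 (i - D - k) (A2 (j - E + k) v))))"

definition creator :: "(int \<Rightarrow> 'v \<Rightarrow> 'v) \<Rightarrow> bool" where
  "creator C \<longleftrightarrow> (\<exists>\<sigma> \<tau>. C = bexp (-1) \<sigma> \<tau>)"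

definition annihilator :: "(int \<Rightarrow> 'v \<Rightarrow> 'v) \<Rightarrow> bool" where
  "annihilator A \<longleftrightarrow> (\<exists>\<sigma> \<tau>. A = bexp 1 \<sigma> \<tau>)"

lemma creatorI: "creator (bexp (-1) \<sigma> \<tau>)"
  and annihilatorI: "annihilator (bexp 1 \<sigma> \<tau>)"
  by (auto simp: creator_def annihilator_def)

lemma creatorD:
  assumes "creator C"
  shows "lin (C i)" "i < 0 \<Longrightarrow> C i v = 0" "C 0 v = v" "charged m l v \<Longrightarrow> charged m l (C i v)"
    "sign \<epsilon> \<Longrightarrow> sign \<eta> \<Longrightarrow> shift \<epsilon> \<eta> (C i v) = C i (shift \<epsilon> \<eta> v)"
    "creator C' \<Longrightarrow> C i (C' j v) = C' j (C i v)"
  using assms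
  by (auto simp: creator_def bexp_neg bexp_0 charged_bexp lin_bexp intro: bexp_eQ bexp_commute)

lemma annihilatorD:
  assumes "annihilator A"
  shows "lin (A i)" "i < 0 \<Longrightarrow> A i v = 0" "A 0 v = v" "charged m l v \<Longrightarrow> charged m l (A i v)"
    "sign \<epsilon> \<Longrightarrow> sign \<eta> \<Longrightarrow> shift \<epsilon> \<eta> (A i v) = A i (shift \<epsilon> \<eta> v)"
    "annihilator A' \<Longrightarrow> A i (A' j v) = A' j (A i v)"
  using assms
  by (auto simp: annihilator_def bexp_neg bexp_0 charged_bexp lin_bexp intro: bexp_eQ bexp_commute)

lemma finite_nord:
  assumes "creator C" "annihilator A"
  shows "finite {i. C i (A (i - d) v) \<noteq> 0}"
proof -
  obtain N where N: "\<And>\<sigma> \<tau> i. i > N \<Longrightarrow> bexp 1 \<sigma> \<tau> i v = 0"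
    by (rule bexp_vanish[of v]) blast
  have "{i. C i (A (i - d) v) \<noteq> 0} \<subseteq> {0..N + d}"
  proof (clarify, rule ccontr)
    fix i assume *: "C i (A (i - d) v) \<noteq> 0" "i \<notin> {0..N + d}"
    then have "i < 0 \<or> i - d > N" by auto
    then show False
      using * assms(2) N creatorD(2)[OF assms(1)] lin_zero[OF creatorD(1)[OF assms(1)]]
      by (auto simp: annihilator_def)
  qed
  then show ?thesis by (rule finite_subset) simp
qed

lemma charged_Sum_any: "(\<And>i. charged m l (f i)) \<Longrightarrow> charged m l (Sum_any f)"
  unfolding Sum_any.expand_set by (rule charged_sum)

lemma charged_nord:
  assumes "creator C" "annihilator A" "charged m l v"
  shows "charged m l (nord C A d v)"
  unfolding nord_def by (intro charged_Sum_any creatorD(4)[OF assms(1)] annihilatorD(4)[OF assms(2)] assms)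

lemma shift_nord:
  assumes "creator C" "annihilator A" "sign \<epsilon>" "sign \<eta>"
  shows "shift \<epsilon> \<eta> (nord C A d v) = nord C A d (shift \<epsilon> \<eta> v)"
  unfolding nord_def
  by (subst lin_Sum_any[OF lin_shift[OF assms(3,4)] finite_nord[OF assms(1,2)]])
    (simp add: creatorD(5)[OF assms(1,3,4)] annihilatorD(5)[OF assms(2,3,4)])

text \<open>
  The creation indices are nonnegative and the total degree is fixed, so a bound on the total
  annihilation degree bounds all three summation indices.
\<close>

lemma finite_wick:
  assumes "creator C1" "creator C2" "annihilator A1" "annihilator A2"
  shows "finite {(i, j, k). C1 i (C2 j (A1 (i - D - k) (A2 (j - E + k) v))) \<noteq> 0}"
proof -
  obtain N where N: "\<And>\<sigma> \<tau> i \<sigma>' \<tau>' j. i + j > N \<Longrightarrow> bexp 1 \<sigma> \<tau> i (bexp 1 \<sigma>' \<tau>' j v) = 0"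
    by (rule bexp_vanish[of v]) blast
  let ?M = "N + D + E"
  have "{(i, j, k). C1 i (C2 j (A1 (i - D - k) (A2 (j - E + k) v))) \<noteq> 0} \<subseteq>
    {0..?M} \<times> {0..?M} \<times> {E - ?M..?M - D}"
  proof
    fix x assume "x \<in> {(i, j, k). C1 i (C2 j (A1 (i - D - k) (A2 (j - E + k) v))) \<noteq> 0}"
    then obtain i j k where x: "x = (i, j, k)"
      and *: "C1 i (C2 j (A1 (i - D - k) (A2 (j - E + k) v))) \<noteq> 0" by (cases x) auto
    have z: "C1 i 0 = 0" "C2 j 0 = 0" "A1 (i - D - k) 0 = 0"
      by (simp_all add: lin_zero creatorD(1) annihilatorD(1) assms)
    have "i \<ge> 0" "j \<ge> 0" "i - D - k \<ge> 0" "j - E + k \<ge> 0"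
      using * z creatorD(2)[OF assms(1)] creatorD(2)[OF assms(2)] annihilatorD(2)[OF assms(3)]
        annihilatorD(2)[OF assms(4)] by (metis not_le)+
    moreover have "A1 (i - D - k) (A2 (j - E + k) v) = 0" if "i - D - k + (j - E + k) > N"
      using assms(3,4) N[OF that] by (auto simp: annihilator_def)
    then have "i - D - k + (j - E + k) \<le> N" using * z by fastforce
    ultimately show "x \<in> {0..?M} \<times> {0..?M} \<times> {E - ?M..?M - D}" by (auto simp: x)
  qed
  then show ?thesis by (rule finite_subset) simp
qed

context
  fixes C1 C2 A1 A2
  assumes CA: "creator C1" "creator C2" "annihilator A1" "annihilator A2"
begin

lemma finite_wick_coeff:
  "finite {x. (\<lambda>(i, j, k). S k *s C1 i (C2 j (A1 (i - D - k) (A2 (j - E + k) v)))) x \<noteq> 0}"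
  by (rule finite_subset[OF _ finite_wick[OF CA, of D E v]]) auto

lemma wick_add:
  "wick (\<lambda>k. S k + S' k) C1 C2 A1 A2 D E v = wick S C1 C2 A1 A2 D E v + wick S' C1 C2 A1 A2 D E v"
  unfolding wick_def
  by (subst Sum_any.distrib[OF finite_wick_coeff finite_wick_coeff, symmetric])
    (simp add: case_prod_unfold scale_left_distrib)

lemma wick_scale: "wick (\<lambda>k. r * S k) C1 C2 A1 A2 D E v = r *s wick S C1 C2 A1 A2 D E v"
  unfolding wick_def
  by (subst scale_Sum_any[OF finite_wick_coeff]) (simp add: case_prod_unfold)

lemma wick_zero: "(\<And>k. S k = 0) \<Longrightarrow> wick S C1 C2 A1 A2 D E v = 0"
  by (simp add: wick_def case_prod_unfold)

lemma wick_shift: "wick S C1 C2 A1 A2 D (E - 1) v = wick (\<lambda>k. S (k - 1)) C1 C2 A1 A2 (D - 1) E v"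
proof -
  have "bij (\<lambda>(i, j, k). (i, j, k - 1) :: int \<times> int \<times> int)"
    by (rule o_bij[where g = "\<lambda>(i, j, k). (i, j, k + 1)"]) (auto simp: fun_eq_iff)
  then show ?thesis
    unfolding wick_def
    by (subst Sum_any_bij[symmetric, where h = "\<lambda>(i, j, k). (i, j, k - 1)"])
      (simp_all add: case_prod_unfold algebra_simps)
qed

text \<open>
  Creation operators commute among themselves and so do annihilation operators, so exchanging the
  two fields only reads the coefficients \<open>S\<close>, taken as a series of degree \<open>s\<close> in \<open>z\<close> and \<open>w\<close>, backwards.
\<close>

lemma wick_swap:
  "wick S C2 C1 A2 A1 (E - s) D v = wick (\<lambda>k. S (s - k)) C1 C2 A1 A2 (D - s) E v"
proof -
  have "bij (\<lambda>(i, j, k). (j, i, s - k) :: int \<times> int \<times> int)"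
    by (rule o_bij[where g = "\<lambda>(i, j, k). (j, i, s - k)"]) (auto simp: fun_eq_iff)
  then show ?thesis
    unfolding wick_def
    by (subst Sum_any_bij[symmetric, where h = "\<lambda>(i, j, k). (j, i, s - k)"])
      (simp_all add: case_prod_unfold creatorD(6)[OF CA(2) CA(1)] annihilatorD(6)[OF CA(4) CA(3)]
        algebra_simps)
qed

lemma nord_nord:
  assumes reorder: "\<And>m n v. A1 m (C2 n v) = Sum_any (\<lambda>k. S k *s C2 (n - k) (A1 (m - k) v))"
    and fin: "\<And>m n v. finite {k. S k *s C2 (n - k) (A1 (m - k) v) \<noteq> 0}"
  shows "nord C1 A1 D (nord C2 A2 E v) = wick S C1 C2 A1 A2 D E v"
proof -
  let ?g = "\<lambda>i (j, k). S k *s C1 i (C2 (j - k) (A1 (i - D - k) (A2 (j - E) v)))"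
  have bij: "bij (\<lambda>(i, j, k). (i, j + k, k) :: int \<times> int \<times> int)"
    by (rule o_bij[where g = "\<lambda>(i, j, k). (i, j - k, k)"]) (auto simp: fun_eq_iff)
  have "{(i, jk). ?g i jk \<noteq> 0} \<subseteq> (\<lambda>(i, j, k). (i, j + k, k)) `
      {(i, j, k). C1 i (C2 j (A1 (i - D - k) (A2 (j - E + k) v))) \<noteq> 0}"
  proof clarify
    fix i j k assume "S k *s C1 i (C2 (j - k) (A1 (i - D - k) (A2 (j - E) v))) \<noteq> 0"
    then show "(i, j, k) \<in> (\<lambda>(i, j, k). (i, j + k, k)) `
      {(i, j, k). C1 i (C2 j (A1 (i - D - k) (A2 (j - E + k) v))) \<noteq> 0}"
      by (intro image_eqI[where x = "(i, j - k, k)"]) auto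
  qed
  then have fin3: "finite {(i, jk). ?g i jk \<noteq> 0}"
    by (rule finite_subset) (intro finite_imageI finite_wick CA)
  have fin2: "finite {(j, k). ?g i (j, k) \<noteq> 0}" for i
    by (rule finite_subset[OF _ finite_imageI[OF fin3, of snd]]) force
  have "C1 i (A1 (i - D) (nord C2 A2 E v)) = Sum_any (?g i)" for i
  proof -
    have "C1 i (A1 (i - D) (nord C2 A2 E v)) =
        Sum_any (\<lambda>j. C1 i (A1 (i - D) (C2 j (A2 (j - E) v))))"
      unfolding nord_def
      by (rule lin_Sum_any[OF lin_comp[OF creatorD(1)[OF CA(1)] annihilatorD(1)[OF CA(3)]] finite_nord[OF CA(2,4)]])
    also have "\<dots> = Sum_any (\<lambda>j. Sum_any (\<lambda>k. ?g i (j, k)))"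
      unfolding reorder
      by (subst lin_Sum_any[OF creatorD(1)[OF CA(1)] fin]) (simp add: lin_scale[OF creatorD(1)[OF CA(1)]])
    also have "\<dots> = Sum_any (\<lambda>(j, k). ?g i (j, k))" by (rule Sum_any_iterated[OF fin2])
    finally show ?thesis by simp
  qed
  then have "nord C1 A1 D (nord C2 A2 E v) = Sum_any (\<lambda>i. Sum_any (?g i))"
    by (simp add: nord_def[of C1])
  also have "\<dots> = Sum_any (\<lambda>(i, jk). ?g i jk)" by (rule Sum_any_iterated[OF fin3])
  also have "\<dots> = wick S C1 C2 A1 A2 D E v"
    using Sum_any_bij[OF bij, of "\<lambda>(i, jk). ?g i jk"] unfolding wick_def
    by (simp add: case_prod_unfold algebra_simps)
  finally show ?thesis .
qed

end

text \<open>
  The delta function \<open>\<Sum>k. (y w/z)\<^sup>k\<close> sets \<open>z = y w\<close> in the normally ordered product, where the two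
  creating exponentials multiply to a single one, and likewise the annihilating ones.
\<close>

lemma wick_delta:
  assumes "y \<noteq> 0"
  shows "wick (\<lambda>k. y powi k) (bexp (-1) \<sigma>1 \<tau>1) (bexp (-1) \<sigma>2 \<tau>2) (bexp 1 \<sigma>3 \<tau>3) (bexp 1 \<sigma>4 \<tau>4) D E v =
    y powi (- D) *s nord (bexp (-1) (\<lambda>n. y ^ n * \<sigma>1 n + \<sigma>2 n) (\<lambda>n. y ^ n * \<tau>1 n + \<tau>2 n))
      (bexp 1 (\<lambda>n. inverse y ^ n * \<sigma>3 n + \<sigma>4 n) (\<lambda>n. inverse y ^ n * \<tau>3 n + \<tau>4 n)) (D + E) v"
    (is "wick _ ?C1 ?C2 ?A1 ?A2 D E v = _ *s nord ?C ?A _ v")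
proof -
  let ?g = "\<lambda>(i, j, k). y powi k *s ?C1 i (?C2 j (?A1 (i - D - k) (?A2 (j - E + k) v)))"
  let ?h = "\<lambda>p (i, t). ?g (i, p - i, i - D - t)"
  \<comment> \<open>\<open>p\<close> is the total creation index and \<open>t\<close> the first annihilation index\<close>
  have bij: "bij (\<lambda>(p, i, t). (i, p - i, i - D - t) :: int \<times> int \<times> int)"
    by (rule o_bij[where g = "\<lambda>(i, j, k). (i + j, i, i - D - k)"]) (auto simp: fun_eq_iff)
  have fin: "finite {x. ?g x \<noteq> 0}"
    by (rule finite_wick_coeff) (intro creatorI annihilatorI)+
  have "{(p, it). ?h p it \<noteq> 0} \<subseteq> (\<lambda>(i, j, k). (i + j, i, i - D - k)) ` {x. ?g x \<noteq> 0}"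
  proof
    fix x assume x: "x \<in> {(p, it). ?h p it \<noteq> 0}"
    obtain p i t where "x = (p, i, t)" by (cases x)
    with x show "x \<in> (\<lambda>(i, j, k). (i + j, i, i - D - k)) ` {x. ?g x \<noteq> 0}"
      by (intro image_eqI[where x = "(i, p - i, i - D - t)"]) auto
  qed
  then have fin': "finite {(p, it). ?h p it \<noteq> 0}" by (rule finite_subset) (intro finite_imageI fin)
  have "Sum_any (?h p) = y powi (- D) *s ?C p (?A (p - (D + E)) v)" for p
  proof -
    let ?q = "p - (D + E)"
    have dC: "bexp (-1) (\<lambda>n. y ^ n * \<sigma>1 n) (\<lambda>n. y ^ n * \<tau>1 n) i w = y powi i *s ?C1 i w" for i w
      by (rule bexp_dilate) simp
    have dA: "bexp 1 (\<lambda>n. inverse y ^ n * \<sigma>3 n) (\<lambda>n. inverse y ^ n * \<tau>3 n) t w = y powi (- t) *s ?A1 t w" for t w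
      using bexp_dilate[of 1 "inverse y" \<sigma>3 \<tau>3 t w] by (simp add: power_int_inverse power_int_minus)
    have "Sum_any (?h p) = sum (?h p) ({0..p} \<times> {0..?q})"
    proof (rule Sum_any_supported)
      fix x assume "x \<notin> {0..p} \<times> {0..?q}"
      then obtain i t where x: "x = (i, t)" and "i < 0 \<or> p - i < 0 \<or> t < 0 \<or> ?q - t < 0" by (cases x) auto
      then have "?C1 i (?C2 (p - i) (?A1 t (?A2 (?q - t) v))) = 0"
        using bexp_neg by (auto simp: bexp_simps)
      moreover have "p - i - E + (i - D - t) = ?q - t" "i - D - (i - D - t) = t" by simp_all
      ultimately show "?h p x = 0" unfolding x by (simp only: prod.case scale_zero_right)
    qed simp
    also have "\<dots> = (\<Sum>i\<in>{0..p}. \<Sum>t\<in>{0..?q}. ?h p (i, t))" by (simp add: sum.cartesian_product)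
    also have "\<dots> = (\<Sum>i\<in>{0..p}. \<Sum>t\<in>{0..?q}. y powi (- D) *s y powi i *s ?C1 i (?C2 (p - i)
        (y powi (- t) *s ?A1 t (?A2 (?q - t) v))))"
    proof (intro sum.cong refl)
      fix i t
      have "y powi (i - D - t) = y powi (- D) * y powi i * y powi (- t)"
        using assms by (simp flip: power_int_add add: algebra_simps)
      moreover have "p - i - E + (i - D - t) = ?q - t" "i - D - (i - D - t) = t" by simp_all
      ultimately show "?h p (i, t) = y powi (- D) *s y powi i *s ?C1 i (?C2 (p - i)
        (y powi (- t) *s ?A1 t (?A2 (?q - t) v)))"
        by (simp only: prod.case bexp_simps scale_scale mult.assoc)
    qed
    also have "\<dots> = y powi (- D) *s (\<Sum>i\<in>{0..p}. y powi i *s ?C1 i (?C2 (p - i)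
        (\<Sum>t\<in>{0..?q}. y powi (- t) *s ?A1 t (?A2 (?q - t) v))))"
      by (simp only: bexp_simps(3) scale_sum_right)
    also have "\<dots> = y powi (- D) *s ?C p (?A ?q v)"
      unfolding dC[symmetric] dA[symmetric] by (simp only: bexp_mult one_neq_zero neg_equal_0_iff_equal not_False_eq_True)
    finally show ?thesis .
  qed
  then have "Sum_any (\<lambda>p. Sum_any (?h p)) = y powi (- D) *s nord ?C ?A (D + E) v"
    unfolding nord_def by (simp add: scale_Sum_any[OF finite_nord[OF creatorI annihilatorI]])
  moreover have "Sum_any (\<lambda>p. Sum_any (?h p)) = Sum_any (\<lambda>(p, it). ?h p it)"
    by (rule Sum_any_iterated[OF fin'])
  moreover have "\<dots> = Sum_any ?g"
    using Sum_any_bij[OF bij, of ?g] by (simp add: case_prod_unfold)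
  ultimately show ?thesis by (simp add: wick_def)
qed

end

section \<open>Contraction functions\<close>

text \<open>
  The logarithmic derivative \<open>u d/du\<close> of \<open>1/(1 - b u)\<close>, namely \<open>b u/(1 - b u)\<close>.
\<close>

definition geo :: "complex \<Rightarrow> complex fps" where
  "geo b = Abs_fps (\<lambda>n. if n = 0 then 0 else b ^ n)"

definition lfac :: "complex \<Rightarrow> complex fps" where
  "lfac b = 1 - fps_const b * fps_X"

definition has_logder :: "complex fps \<Rightarrow> complex fps \<Rightarrow> bool" where
  "has_logder f L \<longleftrightarrow> fps_nth f 0 = 1 \<and> fps_X * fps_deriv f = L * f"

lemma lfac_0: "fps_nth (lfac b) 0 = 1"
  by (simp add: lfac_def)

lemma lfac_nz: "lfac b \<noteq> 0"
  using lfac_0 by (metis fps_zero_nth zero_neq_one)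

lemma lfac_inverse: "lfac b * inverse (lfac b) = 1"
  by (rule inverse_mult_eq_1') (simp add: lfac_0)

lemma lfac_inverse_nth: "fps_nth (inverse (lfac b)) n = b ^ n"
proof -
  have "inverse (lfac b) = Abs_fps (\<lambda>n. b ^ n)"
  proof (rule fps_inverse_unique)
    show "lfac b * Abs_fps (\<lambda>n. b ^ n) = 1"
    proof (rule fps_ext)
      fix n show "fps_nth (lfac b * Abs_fps (\<lambda>n. b ^ n)) n = fps_nth 1 n"
        by (cases n) (simp_all add: lfac_def left_diff_distrib mult.assoc)
    qed
  qed
  then show ?thesis by simp
qed

lemma has_logder_mult:
  assumes "has_logder f L" "has_logder g M" shows "has_logder (f * g) (L + M)"
proof -
  have "fps_X * fps_deriv (f * g) = f * (fps_X * fps_deriv g) + (fps_X * fps_deriv f) * g"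
    by (simp add: algebra_simps)
  with assms show ?thesis by (simp add: has_logder_def algebra_simps)
qed

lemma has_logder_lfac: "has_logder (lfac b) (- geo b)"
proof -
  have "geo b * lfac b = fps_const b * fps_X"
  proof (rule fps_ext)
    fix n show "fps_nth (geo b * lfac b) n = fps_nth (fps_const b * fps_X) n"
      by (cases n) (auto simp: geo_def lfac_def right_diff_distrib mult.left_commute[of _ "fps_const b"])
  qed
  then show ?thesis by (simp add: has_logder_def lfac_0 lfac_def mult.commute del: fps_const_neg flip: fps_const_neg)
qed

lemma has_logder_inverse:
  assumes "has_logder f L" shows "has_logder (inverse f) (- L)"
proof -
  have f: "fps_nth f 0 = 1" "fps_X * fps_deriv f = L * f" using assms by (auto simp: has_logder_def)
  have i: "f * inverse f = 1" by (rule inverse_mult_eq_1') (simp add: f)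
  have "fps_deriv (f * inverse f) = 0" by (simp add: i)
  then have "f * fps_deriv (inverse f) = - (fps_deriv f * inverse f)"
    by (simp add: eq_neg_iff_add_eq_0 add.commute)
  then have "fps_X * (inverse f * (f * fps_deriv (inverse f))) = - (inverse f * (fps_X * fps_deriv f) * inverse f)"
    by (simp add: algebra_simps)
  then have "fps_X * ((f * inverse f) * fps_deriv (inverse f)) = - (L * (f * inverse f) * inverse f)"
    unfolding f(2) by (simp add: algebra_simps)
  then show ?thesis by (simp add: i has_logder_def f)
qed

text \<open>
  \<open>(1 - b u)\<^sup>e\<close> for \<open>e = \<plusminus>1\<close>.
\<close>

definition lfac_pow :: "complex \<Rightarrow> int \<Rightarrow> complex fps" where
  "lfac_pow b e = (if e = 1 then lfac b else inverse (lfac b))"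

lemma has_logder_lfac_pow: "e = 1 \<or> e = -1 \<Longrightarrow> has_logder (lfac_pow b e) (- (of_int e * geo b))"
  using has_logder_lfac[of b] has_logder_inverse[OF has_logder_lfac[of b]] by (auto simp: lfac_pow_def)

text \<open>
  Coefficients of a power series as a two-sided sequence.
\<close>

definition coef :: "complex fps \<Rightarrow> int \<Rightarrow> complex" where
  "coef f k = (if k < 0 then 0 else fps_nth f (nat k))"

lemma coef_add: "coef (f + g) k = coef f k + coef g k"
  by (simp add: coef_def)

lemma coef_const_mult: "coef (fps_const r * f) k = r * coef f k"
  by (simp add: coef_def)

lemma coef_X_mult: "coef (fps_X * f) k = coef f (k - 1)"
  by (auto simp: coef_def nat_diff_distrib) 

lemma coef_one: "coef 1 k = (if k = 0 then 1 else 0)"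
  by (auto simp: coef_def)

lemma coef_lfac_mult: "coef (lfac b * f) k = coef f k - b * coef f (k - 1)"
proof -
  have "lfac b * f = f + fps_const (- b) * (fps_X * f)"
    by (simp add: lfac_def algebra_simps fps_const_neg[symmetric] del: fps_const_neg)
  then show ?thesis by (simp only: coef_add coef_const_mult coef_X_mult) simp
qed

lemma coef_lfac: "coef (lfac b) k = (if k = 0 then 1 else if k = 1 then - b else 0)"
  using coef_lfac_mult[of b 1 k] by (auto simp: coef_one)

lemma lin_u_lfac: "\<alpha> \<noteq> 0 \<Longrightarrow> lin_u \<alpha> \<beta> = fps_const \<alpha> * lfac (- \<beta> / \<alpha>)"
  by (rule fps_ext) (simp add: lin_u_def lfac_def right_diff_distrib)

lemma fps_divide_lfac:
  assumes "y \<noteq> 0"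
  shows "fps_const x * lfac b / (fps_const y * lfac b') = fps_const (x / y) * (lfac b * inverse (lfac b'))"
proof -
  have "fps_const x * lfac b = fps_const (x / y) * (lfac b * inverse (lfac b')) * (fps_const y * lfac b')"
  proof -
    have "fps_const (x / y) * (lfac b * inverse (lfac b')) * (fps_const y * lfac b') =
      (fps_const (x / y) * fps_const y) * lfac b * (lfac b' * inverse (lfac b'))"
      by (simp only: mult_ac)
    also have "\<dots> = fps_const x * lfac b" using assms by (simp add: lfac_inverse)
    finally show ?thesis by (rule sym)
  qed
  moreover have "fps_const y * lfac b' \<noteq> 0" using assms lfac_nz by simp
  ultimately show ?thesis by (metis nonzero_mult_div_cancel_right)
qed

text \<open>
  The right-hand side makes sense for all integers \<open>k\<close>. Up to a constant factor it is unchanged when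
  \<open>\<rho>\<close> and \<open>k\<close> are replaced by \<open>1/\<rho>\<close> and \<open>-2-k\<close>, that is, when the expansion in \<open>1/u\<close> is taken; this is
  what turns the sum of the two expansions of a rational function into delta functions.
\<close>

lemma partial_fractions:
  assumes "\<rho> \<noteq> -1" "k \<ge> 0"
  shows "coef (lfac_pow (-1) (-1) * lfac_pow \<rho> (-1)) k = ((-1) powi k + \<rho> powi (k + 1)) / (1 + \<rho>)"
proof -
  have nz: "1 + \<rho> \<noteq> 0" using assms(1) by (metis add.inverse_inverse add_eq_0_iff)
  have "lfac_pow (-1) (-1) * lfac_pow \<rho> (-1) = 
    fps_const (1 / (1 + \<rho>)) * (inverse (lfac (-1)) + fps_const \<rho> * inverse (lfac \<rho>))"
  proof -
    let ?x = "inverse (lfac (-1))" and ?y = "inverse (lfac \<rho>)"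
    have x: "lfac (-1) * ?x = 1" and y: "lfac \<rho> * ?y = 1" by (rule lfac_inverse)+
    have "?x + fps_const \<rho> * ?y = (lfac \<rho> * ?y) * ?x + fps_const \<rho> * (lfac (-1) * ?x) * ?y"
      unfolding x y by simp
    also have "\<dots> = (lfac \<rho> + fps_const \<rho> * lfac (-1)) * (?x * ?y)" by (simp add: algebra_simps)
    also have "lfac \<rho> + fps_const \<rho> * lfac (-1) = fps_const (1 + \<rho>)"
      by (rule fps_ext) (auto simp: lfac_def right_diff_distrib)
    finally have "?x + fps_const \<rho> * ?y = fps_const (1 + \<rho>) * (?x * ?y)" .
    then show ?thesis using nz by (simp add: lfac_pow_def mult.assoc[symmetric])
  qed
  then have "coef (lfac_pow (-1) (-1) * lfac_pow \<rho> (-1)) k = (1 / (1 + \<rho>)) * ((-1) ^ nat k + \<rho> * \<rho> ^ nat k)"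
    using assms(2) by (simp only: coef_const_mult coef_add) (simp add: coef_def lfac_inverse_nth)
  moreover have "\<rho> powi (k + 1) = \<rho> * \<rho> ^ nat k"
    using assms(2) by (simp add: power_int_def nat_add_distrib)
  ultimately show ?thesis using assms(2) by (simp add: power_int_def)
qed

section \<open>Vertex operators and their products\<close>

text \<open>
  The parameter \<open>r\<close> is the square root of \<open>q\<close> that the currents use.
\<close>

locale osp_bosons = boson_oscillators scale q a c eQa eQc
  for scale :: "complex \<Rightarrow> 'v::ab_group_add \<Rightarrow> 'v" (infixr "*s" 75)
    and q :: complex and a c :: "int \<Rightarrow> 'v \<Rightarrow> 'v" and eQa eQc :: "'v \<Rightarrow> 'v" +
  fixes r :: complex
  assumes q_nz: "q \<noteq> 0" and generic: "n > 0 \<Longrightarrow> q ^ n \<noteq> 1" and r_sq: "r\<^sup>2 = q"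
begin

abbreviation (input) "\<kappa> \<equiv> q - inverse q"

lemma r_nz: "r \<noteq> 0"
  using q_nz r_sq by auto

lemma qq_nz: "q - inverse q \<noteq> 0"
proof
  assume "q - inverse q = 0"
  then have "q ^ 2 = 1" using q_nz by (metis eq_iff_diff_eq_0 power2_eq_square right_inverse)
  with generic[of 2] show False by simp
qed

lemma qint_nz: "n > 0 \<Longrightarrow> qint q (int n) \<noteq> 0"
proof
  assume "n > 0" "qint q (int n) = 0"
  then have "q ^ n = inverse (q ^ n)" using qq_nz by (simp add: qint_def power_int_minus)
  then have "q ^ (n + n) = 1" using q_nz by (simp add: power_add field_simps)
  with generic[of "n + n"] \<open>n > 0\<close> show False by simp
qed

lemma qint_mult: "\<kappa> * qint q (int n) = q ^ n - inverse q ^ n"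
  using qq_nz by (simp add: qint_def power_int_minus power_inverse)

text \<open>
  The creating and the annihilating factor of \<open>:exp (\<epsilon> a(z; h/2) + \<eta> c(xz)):\<close>.
\<close>

definition cr :: "int \<Rightarrow> int \<Rightarrow> int \<Rightarrow> complex \<Rightarrow> int \<Rightarrow> 'v \<Rightarrow> 'v" where
  "cr \<epsilon> h \<eta> x = bexp (-1) (\<lambda>n. - (of_int \<epsilon> * r powi (h * int n) / qint q (- int n)))
     (\<lambda>n. - (of_int \<eta> * x powi int n / qint q (- int n)))"

definition an :: "int \<Rightarrow> int \<Rightarrow> int \<Rightarrow> complex \<Rightarrow> int \<Rightarrow> 'v \<Rightarrow> 'v" where
  "an \<epsilon> h \<eta> x = bexp 1 (\<lambda>n. - (of_int \<epsilon> * r powi (h * int n) / qint q (int n)))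
     (\<lambda>n. - (of_int \<eta> * x powi (- int n) / qint q (int n)))"

lemma cr: "creator (cr \<epsilon> h \<eta> x)" and an: "annihilator (an \<epsilon> h \<eta> x)"
  unfolding cr_def an_def by (rule creatorI annihilatorI)+

abbreviation V :: "int \<Rightarrow> int \<Rightarrow> int \<Rightarrow> complex \<Rightarrow> 'v ser" where
  "V \<epsilon> h \<eta> x \<equiv> vertex scale q r a c eQa eQc \<epsilon> h \<eta> x"

lemma ser_up_bexp:
  "ser_up (op_exp scale (\<lambda>n v. \<sigma> n *s a (- int n) v + \<tau> n *s c (- int n) v)) = bexp (-1) \<sigma> \<tau>"
proof -
  have eq: "bmode (-1) \<sigma> \<tau> = (\<lambda>n v. \<sigma> n *s a (- int n) v + \<tau> n *s c (- int n) v)"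
    by (simp add: fun_eq_iff bmode_def)
  show ?thesis unfolding eq[symmetric] by (auto simp: fun_eq_iff ser_up_def bexp_def)
qed

lemma ser_down_bexp:
  "ser_down (op_exp scale (\<lambda>n v. \<sigma> n *s a (int n) v + \<tau> n *s c (int n) v)) = (\<lambda>k. bexp 1 \<sigma> \<tau> (- k))"
proof -
  have eq: "bmode 1 \<sigma> \<tau> = (\<lambda>n v. \<sigma> n *s a (int n) v + \<tau> n *s c (int n) v)"
    by (simp add: fun_eq_iff bmode_def)
  show ?thesis unfolding eq[symmetric] by (auto simp: fun_eq_iff ser_down_def bexp_def)
qed

lemma sign_mult_sign: "sign \<epsilon> \<Longrightarrow> sign \<eta> \<Longrightarrow> sign (\<epsilon> * \<eta>)"
  by auto

text \<open>
  On a vector of weight \<open>w\<close>, \<open>xz\<close> to the power \<open>\<epsilon>Z\<close> is the single monomial \<open>(xz)\<^sup>\<epsilon>\<^sup>w\<close>.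
\<close>

lemma ser_zpow_charged:
  assumes Z: "diagonalizable scale Z" "\<forall>m l v. charged m l v \<longrightarrow> Z v = of_int (w m l) *s v"
    and D: "\<And>k. lin (D k)" "\<forall>k m l v. charged m l v \<longrightarrow> charged m l (D k v)" and "sign \<epsilon>"
  shows "charged m l v \<Longrightarrow>
      ser_mult (ser_zpow scale Z \<epsilon> x) D k v = x powi (\<epsilon> * w m l) *s D (k - \<epsilon> * w m l) v"
    and "lin (ser_mult (ser_zpow scale Z \<epsilon> x) D k)"
proof -
  interpret Z: diagonalizable scale Z by (rule Z(1))
  have supp: "x powi i *s eig_proj scale Z (\<epsilon> * i) (D (k - i) v) =
    (if i = \<epsilon> * w m l then x powi i *s D (k - i) v else 0)" if "charged m l v" for i k m l v
  proof -
    have "Z (D (k - i) v) = of_int (w m l) *s D (k - i) v"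
      using Z(2) D(2)[rule_format, OF that] by blast
    note Z.eig_proj_eigenvector[OF this, of "\<epsilon> * i"]
    moreover have "w m l = \<epsilon> * i \<longleftrightarrow> i = \<epsilon> * w m l" using \<open>sign \<epsilon>\<close> by auto
    ultimately show ?thesis
      by (cases "i = \<epsilon> * w m l") (simp_all only: simp_thms if_True if_False scale_zero_right)
  qed
  show "ser_mult (ser_zpow scale Z \<epsilon> x) D k v = x powi (\<epsilon> * w m l) *s D (k - \<epsilon> * w m l) v"
    if "charged m l v"
    unfolding ser_mult_def ser_zpow_def supp[OF that] by (subst Sum_any_single[of "\<epsilon> * w m l"]) auto
  show "lin (ser_mult (ser_zpow scale Z \<epsilon> x) D k)"
    unfolding ser_mult_def[abs_def] ser_zpow_def
  proof (rule Sum_any_linear_family)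
    fix i show "lin (\<lambda>v. x powi i *s eig_proj scale Z (\<epsilon> * i) (D (k - i) v))"
      by (rule lin_smult[OF lin_comp[OF Z.lin_eig_proj D(1)]])
    fix m l v assume ch: "charged m l v"
    show "finite {i. x powi i *s eig_proj scale Z (\<epsilon> * i) (D (k - i) v) \<noteq> 0}"
      unfolding supp[OF ch] by (rule finite_subset[of _ "{\<epsilon> * w m l}"]) auto
  qed
qed

context
  fixes \<epsilon> \<eta> :: int
  assumes sgn: "sign \<epsilon>" "sign \<eta>"
begin

lemma vertex_factors:
  obtains G where "V \<epsilon> h \<eta> x = ser_mult (cr \<epsilon> h \<eta> x) G" "\<And>k. lin (G k)"
    "\<And>k m l v. charged m l v \<Longrightarrow>
      G k v = x powi (\<eta> * l) *s shift \<epsilon> \<eta> (an \<epsilon> h \<eta> x (\<epsilon> * m + \<eta> * l - k) v)"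
proof -
  let ?A = "\<lambda>k. an \<epsilon> h \<eta> x (- k)"
  let ?C = "ser_mult (ser_zpow scale (c 0) \<eta> x) ?A"
  let ?G = "\<lambda>k v. shift \<epsilon> \<eta> (ser_mult (ser_zpow scale (a 0) \<epsilon> 1) ?C k v)"
  have A: "lin (?A k)" "\<forall>k m l v. charged m l v \<longrightarrow> charged m l (?A k v)" for k
    by (simp_all add: annihilatorD[OF an])
  have zero: "\<forall>m l v. charged m l v \<longrightarrow> c 0 v = of_int l *s v"
    "\<forall>m l v. charged m l v \<longrightarrow> a 0 v = of_int m *s v"
    by (simp_all add: charged_def)
  note C = ser_zpow_charged[where w = "\<lambda>m l. l" and D = ?A, OF C0.diagonalizable_axioms zero(1) A sgn(2)]
  have C': "\<forall>k m l v. charged m l v \<longrightarrow> charged m l (?C k v)"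
  proof (intro allI impI)
    fix k m l v assume "charged m l v"
    then show "charged m l (?C k v)" unfolding C(1)[OF \<open>charged m l v\<close>] using A(2) by (blast intro: charged_scale)
  qed
  note G = ser_zpow_charged[where w = "\<lambda>m l. m" and D = ?C, OF A0.diagonalizable_axioms zero(2) C(2) C' sgn(1)]
  have "V \<epsilon> h \<eta> x = ser_mult (cr \<epsilon> h \<eta> x) ?G"
    unfolding vertex_def ser_up_bexp ser_down_bexp cr_def an_def shift_def ..
  moreover have "lin (?G k)" for k
    by (rule lin_comp[OF lin_shift[OF sgn] G(2)])
  moreover have "?G k v = x powi (\<eta> * l) *s shift \<epsilon> \<eta> (an \<epsilon> h \<eta> x (\<epsilon> * m + \<eta> * l - k) v)"
    if "charged m l v" for k m l v
    unfolding G(1)[OF that] C(1)[OF that] by (simp add: lin_scale[OF lin_shift[OF sgn]] algebra_simps)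
  ultimately show ?thesis by (rule that)
qed

text \<open>
  Powers of the zero modes become a scalar and a shift of the degree, and the charge shift commutes
  with the nonzero modes.
\<close>

lemma vertex_charged:
  assumes "charged m l v"
  shows "V \<epsilon> h \<eta> x k v =
    x powi (\<eta> * l) *s shift \<epsilon> \<eta> (nord (cr \<epsilon> h \<eta> x) (an \<epsilon> h \<eta> x) (k - \<epsilon> * m - \<eta> * l) v)"
proof -
  let ?C = "cr \<epsilon> h \<eta> x" and ?A = "an \<epsilon> h \<eta> x"
  obtain G where V: "V \<epsilon> h \<eta> x = ser_mult ?C G"
    "\<And>k. G k v = x powi (\<eta> * l) *s shift \<epsilon> \<eta> (?A (\<epsilon> * m + \<eta> * l - k) v)"
    using vertex_factors[of h x] assms by metis
  let ?f = "\<lambda>i. ?C i (?A (i - (k - \<epsilon> * m - \<eta> * l)) v)"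
  have fin: "finite {i. ?f i \<noteq> 0}" by (rule finite_nord[OF cr an])
  have "V \<epsilon> h \<eta> x k v = Sum_any (\<lambda>i. x powi (\<eta> * l) *s shift \<epsilon> \<eta> (?f i))"
    unfolding V(1) ser_mult_def V(2)
    by (simp add: lin_scale[OF creatorD(1)[OF cr]] creatorD(5)[OF cr sgn] algebra_simps)
  also have "\<dots> = x powi (\<eta> * l) *s shift \<epsilon> \<eta> (Sum_any ?f)"
    by (rule lin_Sum_any[OF lin_smult[OF lin_shift[OF sgn]] fin, symmetric])
  finally show ?thesis by (simp add: nord_def)
qed

lemma lin_vertex: "lin (V \<epsilon> h \<eta> x k)"
proof -
  let ?C = "cr \<epsilon> h \<eta> x" and ?A = "an \<epsilon> h \<eta> x"
  obtain G where V: "V \<epsilon> h \<eta> x = ser_mult ?C G" and G: "\<And>k. lin (G k)"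
    "\<And>k m l v. charged m l v \<Longrightarrow> G k v = x powi (\<eta> * l) *s shift \<epsilon> \<eta> (?A (\<epsilon> * m + \<eta> * l - k) v)"
    using vertex_factors[of h x] by metis
  show ?thesis
    unfolding V ser_mult_def[abs_def]
  proof (rule Sum_any_linear_family)
    fix i show "lin (\<lambda>v. ?C i (G (k - i) v))" by (rule lin_comp[OF creatorD(1)[OF cr] G(1)])
    fix m l v assume "charged m l v"
    note G = G(2)[OF this]
    let ?f = "\<lambda>i. ?C i (?A (i - (k - \<epsilon> * m - \<eta> * l)) v)"
    have "?C i (G (k - i) v) = x powi (\<eta> * l) *s shift \<epsilon> \<eta> (?f i)" for i
      unfolding G by (simp add: lin_scale[OF creatorD(1)[OF cr]] creatorD(5)[OF cr sgn] algebra_simps)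
    then have "?C i (G (k - i) v) = 0" if "?f i = 0" for i
      by (simp only: that lin_zero[OF lin_shift[OF sgn]] scale_zero_right)
    then have "{i. ?C i (G (k - i) v) \<noteq> 0} \<subseteq> {i. ?f i \<noteq> 0}" by blast
    then show "finite {i. ?C i (G (k - i) v) \<noteq> 0}"
      by (rule finite_subset) (rule finite_nord[OF cr an])
  qed
qed

lemma charged_vertex:
  "charged m l v \<Longrightarrow> charged (m + \<epsilon>) (l + \<eta>) (V \<epsilon> h \<eta> x k v)"
  by (simp add: vertex_charged charged_scale charged_shift[OF _ sgn] charged_nord[OF cr an])

end

text \<open>
  The function \<open>(1 + b u)\<^sup>e (1 - \<rho> u)\<^sup>g\<close> of \<open>u = w/z\<close>: the first factor comes from the oscillators \<open>a\<close>,
  whose commutator carries the sign \<open>(-1)\<^sup>n\<close>, the second one from the oscillators \<open>c\<close>.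
\<close>

definition contraction :: "int \<Rightarrow> int \<Rightarrow> complex \<Rightarrow> complex \<Rightarrow> complex fps" where
  "contraction e g b \<rho> = lfac_pow (- b) e * lfac_pow \<rho> g"

lemma an_cr_reorder:
  assumes "sign \<epsilon>" "sign \<eta>" "sign \<epsilon>'" "sign \<eta>'" "x \<noteq> 0"
  shows "an \<epsilon> h \<eta> x i (cr \<epsilon>' h' \<eta>' x' j v) = Sum_any (\<lambda>k. coef (contraction (\<epsilon> * \<epsilon>') (\<eta> * \<eta>') (r powi (h + h')) (x' / x)) k *s
      cr \<epsilon>' h' \<eta>' x' (j - k) (an \<epsilon> h \<eta> x (i - k) v))" (is "_ = Sum_any (\<lambda>k. coef ?f k *s _)")
    and "finite {k. coef (contraction (\<epsilon> * \<epsilon>') (\<eta> * \<eta>') (r powi (h + h')) (x' / x)) k *s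
      cr \<epsilon>' h' \<eta>' x' (j - k) (an \<epsilon> h \<eta> x (i - k) v) \<noteq> 0}"
proof -
  have supp: "coef ?f k *s cr \<epsilon>' h' \<eta>' x' (j - k) (an \<epsilon> h \<eta> x (i - k) v) = 0" if "k \<notin> {0..min i j}" for k
    using that creatorD(2)[OF cr, of "j - k"] annihilatorD(2)[OF an, of "i - k"]
    by (auto simp: coef_def lin_zero[OF creatorD(1)[OF cr]])
  then have "{k. coef ?f k *s cr \<epsilon>' h' \<eta>' x' (j - k) (an \<epsilon> h \<eta> x (i - k) v) \<noteq> 0} \<subseteq> {0..min i j}"
    by blast
  then show "finite {k. coef ?f k *s cr \<epsilon>' h' \<eta>' x' (j - k) (an \<epsilon> h \<eta> x (i - k) v) \<noteq> 0}"
    by (rule finite_subset) simp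
  let ?\<gamma> = "\<lambda>n. (- (of_int \<epsilon> * r powi (h * int n) / qint q (int n)) * - (of_int \<epsilon>' * r powi (h' * int n) / qint q (- int n)) * (-1) ^ n
      + - (of_int \<eta> * x powi (- int n) / qint q (int n)) * - (of_int \<eta>' * x' powi int n / qint q (- int n)))
      * (qint q (int n))\<^sup>2"
  have "has_logder ?f (- (of_int (\<epsilon> * \<epsilon>') * geo (- (r powi (h + h')))) + - (of_int (\<eta> * \<eta>') * geo (x' / x)))"
    unfolding contraction_def by (intro has_logder_mult has_logder_lfac_pow sign_mult_sign assms)
  moreover have "- (of_int (\<epsilon> * \<epsilon>') * geo (- (r powi (h + h')))) + - (of_int (\<eta> * \<eta>') * geo (x' / x)) = Abs_fps ?\<gamma>"
  proof (rule fps_ext)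
    fix n
    show "fps_nth (- (of_int (\<epsilon> * \<epsilon>') * geo (- (r powi (h + h')))) + - (of_int (\<eta> * \<eta>') * geo (x' / x))) n = fps_nth (Abs_fps ?\<gamma>) n"
    proof (cases "n = 0")
      case True
      then show ?thesis by (simp add: geo_def qint_def)
    next
      case False
      then have Q: "qint q (int n) \<noteq> 0" by (simp add: qint_nz)
      have pw: "(- (r powi (h + h'))) ^ n = (-1) ^ n * r powi (h * int n) * r powi (h' * int n)"
        using r_nz by (subst power_minus) (simp add: power_int_add power_mult_distrib power_int_mult)
      have px: "(x' / x) ^ n = x powi (- int n) * x' powi int n"
        by (simp add: power_int_minus power_mult_distrib power_inverse divide_inverse mult.commute)
      have \<gamma>: "?\<gamma> n = - (of_int \<epsilon> * of_int \<epsilon>' * ((-1) ^ n * r powi (h * int n) * r powi (h' * int n)))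
          - of_int \<eta> * of_int \<eta>' * (x powi (- int n) * x' powi int n)"
        using Q unfolding qint_minus by (simp add: field_simps power2_eq_square)
      have "fps_nth (of_int e * f) n = of_int e * fps_nth f n" for e and f :: "complex fps"
        by (metis fps_mult_left_const_nth fps_of_int)
      then have "fps_nth (- (of_int (\<epsilon> * \<epsilon>') * geo (- (r powi (h + h')))) + - (of_int (\<eta> * \<eta>') * geo (x' / x))) n =
          - (of_int (\<epsilon> * \<epsilon>') * (- (r powi (h + h'))) ^ n) + - (of_int (\<eta> * \<eta>') * (x' / x) ^ n)"
        using False by (simp add: geo_def del: of_int_mult)
      also have "\<dots> = ?\<gamma> n" unfolding \<gamma> pw px of_int_mult by simp
      finally show ?thesis by simp
    qed
  qed
  ultimately have f: "fps_nth ?f 0 = 1" "fps_X * fps_deriv ?f = Abs_fps ?\<gamma> * ?f"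
    unfolding has_logder_def by simp_all
  have "an \<epsilon> h \<eta> x i (cr \<epsilon>' h' \<eta>' x' j v) = (\<Sum>k\<in>{0..min i j}. fps_nth ?f (nat k) *s
      cr \<epsilon>' h' \<eta>' x' (j - k) (an \<epsilon> h \<eta> x (i - k) v))"
    unfolding cr_def an_def by (rule bexp_reorder[OF f])
  also have "\<dots> = (\<Sum>k\<in>{0..min i j}. coef ?f k *s cr \<epsilon>' h' \<eta>' x' (j - k) (an \<epsilon> h \<eta> x (i - k) v))"
    by (rule sum.cong) (auto simp: coef_def)
  also have "\<dots> = Sum_any (\<lambda>k. coef ?f k *s cr \<epsilon>' h' \<eta>' x' (j - k) (an \<epsilon> h \<eta> x (i - k) v))"
    by (rule Sum_any_supported[OF _ supp, symmetric]) simp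
  finally show "an \<epsilon> h \<eta> x i (cr \<epsilon>' h' \<eta>' x' j v) = Sum_any (\<lambda>k. coef ?f k *s
      cr \<epsilon>' h' \<eta>' x' (j - k) (an \<epsilon> h \<eta> x (i - k) v))" .
qed

text \<open>
  Besides the contraction, the zero modes contribute the leading monomial
  \<open>z\<^sup>\<epsilon>\<^sup>\<epsilon>\<^sup>' (x z)\<^sup>\<eta>\<^sup>\<eta>\<^sup>'\<close>, because the second vertex operator has already shifted the charges.
\<close>

lemma vertex_vertex:
  assumes "sign \<epsilon>" "sign \<eta>" "sign \<epsilon>'" "sign \<eta>'" "x \<noteq> 0" "charged m l v"
  shows "V \<epsilon> h \<eta> x i (V \<epsilon>' h' \<eta>' x' j v) =
    (x powi (\<eta> * l) * x' powi (\<eta>' * l) * x powi (\<eta> * \<eta>')) *s shift \<epsilon> \<eta> (shift \<epsilon>' \<eta>'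
      (wick (coef (contraction (\<epsilon> * \<epsilon>') (\<eta> * \<eta>') (r powi (h + h')) (x' / x)))
        (cr \<epsilon> h \<eta> x) (cr \<epsilon>' h' \<eta>' x') (an \<epsilon> h \<eta> x) (an \<epsilon>' h' \<eta>' x')
        (i - \<epsilon> * m - \<eta> * l - (\<epsilon> * \<epsilon>' + \<eta> * \<eta>')) (j - \<epsilon>' * m - \<eta>' * l) v))"
proof -
  let ?C1 = "cr \<epsilon> h \<eta> x" and ?C2 = "cr \<epsilon>' h' \<eta>' x'" and ?A1 = "an \<epsilon> h \<eta> x" and ?A2 = "an \<epsilon>' h' \<eta>' x'"
  let ?d = "j - \<epsilon>' * m - \<eta>' * l" and ?e = "i - \<epsilon> * m - \<eta> * l - (\<epsilon> * \<epsilon>' + \<eta> * \<eta>')"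
  have ch: "charged (m + \<epsilon>') (l + \<eta>') (shift \<epsilon>' \<eta>' (nord ?C2 ?A2 ?d v))"
    by (intro charged_shift charged_nord cr an assms)
  have e: "i - \<epsilon> * (m + \<epsilon>') - \<eta> * (l + \<eta>') = ?e" by (simp add: algebra_simps)
  have "V \<epsilon> h \<eta> x i (V \<epsilon>' h' \<eta>' x' j v) = (x' powi (\<eta>' * l) * x powi (\<eta> * (l + \<eta>'))) *s
      shift \<epsilon> \<eta> (shift \<epsilon>' \<eta>' (nord ?C1 ?A1 ?e (nord ?C2 ?A2 ?d v)))"
    by (simp add: vertex_charged[OF assms(3,4,6)] lin_scale[OF lin_vertex[OF assms(1,2)]]
      vertex_charged[OF assms(1,2) ch] e shift_nord[OF cr an assms(3,4), symmetric])
  also have "nord ?C1 ?A1 ?e (nord ?C2 ?A2 ?d v) =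
      wick (coef (contraction (\<epsilon> * \<epsilon>') (\<eta> * \<eta>') (r powi (h + h')) (x' / x))) ?C1 ?C2 ?A1 ?A2 ?e ?d v"
    by (rule nord_nord[OF cr cr an an an_cr_reorder[OF assms(1-5)]])
  also have "x' powi (\<eta>' * l) * x powi (\<eta> * (l + \<eta>')) = x powi (\<eta> * l) * x' powi (\<eta>' * l) * x powi (\<eta> * \<eta>')"
    using assms(5) by (simp add: distrib_left power_int_add)
  finally show ?thesis .
qed

text \<open>
  The opposite order gives the same normally ordered product at the same degrees; only the coefficient
  sequence differs, being an expansion in \<open>z/w\<close>.
\<close>

lemma vertex_vertex_reverse:
  assumes "sign \<epsilon>" "sign \<eta>" "sign \<epsilon>'" "sign \<eta>'" "x' \<noteq> 0" "charged m l v"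
  shows "V \<epsilon>' h' \<eta>' x' j (V \<epsilon> h \<eta> x i v) =
    (x powi (\<eta> * l) * x' powi (\<eta>' * l) * x' powi (\<eta> * \<eta>')) *s shift \<epsilon> \<eta> (shift \<epsilon>' \<eta>'
      (wick (\<lambda>k. coef (contraction (\<epsilon> * \<epsilon>') (\<eta> * \<eta>') (r powi (h + h')) (x / x')) (\<epsilon> * \<epsilon>' + \<eta> * \<eta>' - k))
        (cr \<epsilon> h \<eta> x) (cr \<epsilon>' h' \<eta>' x') (an \<epsilon> h \<eta> x) (an \<epsilon>' h' \<eta>' x')
        (i - \<epsilon> * m - \<eta> * l - (\<epsilon> * \<epsilon>' + \<eta> * \<eta>')) (j - \<epsilon>' * m - \<eta>' * l) v))"
proof -
  let ?s = "\<epsilon> * \<epsilon>' + \<eta> * \<eta>'"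
  let ?S = "coef (contraction (\<epsilon> * \<epsilon>') (\<eta> * \<eta>') (r powi (h + h')) (x / x'))"
  let ?C1 = "cr \<epsilon> h \<eta> x" and ?C2 = "cr \<epsilon>' h' \<eta>' x'" and ?A1 = "an \<epsilon> h \<eta> x" and ?A2 = "an \<epsilon>' h' \<eta>' x'"
  have "wick ?S ?C2 ?C1 ?A2 ?A1 (E - ?s) D v = wick (\<lambda>k. ?S (?s - k)) ?C1 ?C2 ?A1 ?A2 (D - ?s) E v" for D E
    by (rule wick_swap) (rule cr an)+
  then show ?thesis
    using vertex_vertex[OF assms(3,4,1,2,5,6), of h' j h x i]
      shift_shift_commute[OF assms(3,4,1,2)]
    by (simp add: mult.commute add.commute[of h'])
qed

end

section \<open>Exchange of two vertex operators\<close>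

context complex_space
begin

lemma smult2_lin:
  "smult2 scale (lin_zw \<alpha> \<beta>) D i j v = \<alpha> *s D (i - 1) j v + \<beta> *s D i (j - 1) v"
proof -
  have "smult2 scale (lin_zw \<alpha> \<beta>) D i j v =
      (\<Sum>(k, l)\<in>{(1, 0), (0, 1)}. lin_zw \<alpha> \<beta> k l *s D (i - k) (j - l) v)"
    unfolding smult2_def by (rule Sum_any_supported) (auto simp: lin_zw_def split: if_splits)
  then show ?thesis by (simp add: lin_zw_def)
qed

lemma smult2_delta_in_w:
  "smult2 scale (delta_wz b) (in_w D) i j v = b powi (- i) *s D (i + j) v"
proof -
  have "smult2 scale (delta_wz b) (in_w D) i j v =
      (\<Sum>(k, l)\<in>{(i, - i)}. delta_wz b k l *s in_w D (i - k) (j - l) v)"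
    unfolding smult2_def by (rule Sum_any_supported) (auto simp: delta_wz_def in_w_def split: if_splits)
  then show ?thesis by (simp add: delta_wz_def in_w_def add.commute)
qed

lemma smult2_delta_in_z:
  "smult2 scale (delta_wz b) (in_z D) i j v = b powi j *s D (i + j) v"
proof -
  have "smult2 scale (delta_wz b) (in_z D) i j v =
      (\<Sum>(k, l)\<in>{(- j, j)}. delta_wz b k l *s in_z D (i - k) (j - l) v)"
    unfolding smult2_def by (rule Sum_any_supported) (auto simp: delta_wz_def in_z_def split: if_splits)
  then show ?thesis by (simp add: delta_wz_def in_z_def)
qed

end

text \<open>
  \<open>S\<close> and \<open>R\<close> are the functions of the two orders. When \<open>x' = -b x\<close>, the \<open>a\<close>- and \<open>c\<close>-contractions
  cancel in one order, and in the other order the linear prefactor cancels the denominator.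
\<close>

lemma exchange_coefficients:
  fixes b x x' :: complex and g :: int
  assumes nz: "b \<noteq> 0" "x \<noteq> 0" "x' \<noteq> 0"
    and rel: "g = 1 \<and> x' = x \<or> g = -1 \<and> x' = - b * x \<or> g = -1 \<and> x = - b * x'"
  defines "S \<equiv> \<lambda>k. x powi g * coef (lfac (- b) * lfac_pow (x' / x) g) k"
    and "R \<equiv> \<lambda>k. x' powi g * coef (lfac (- b) * lfac_pow (x / x') g) (1 + g - k)"
  shows "S k + inverse b * S (k - 1) + (inverse b * R k + R (k - 1)) = 0"
proof -
  have inv: "coef (inverse (lfac d)) k - d * coef (inverse (lfac d)) (k - 1) = (if k = 0 then 1 else 0)" for d k
    using coef_lfac_mult[of d "inverse (lfac d)" k] by (simp add: lfac_inverse coef_one)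
  \<comment> \<open>one order has no denominator, the other one is regular after multiplication by the prefactor\<close>
  have half: "y * ((if k = 0 then 1 else 0) + inverse b * (if k = 1 then 1 else 0)) +
      y' * (inverse b * coef (lfac (- b) * inverse (lfac (- inverse b))) (- k)
        + coef (lfac (- b) * inverse (lfac (- inverse b))) (1 - k)) = 0"
    if "y = - b * y'" for y y' k
  proof -
    let ?c = "coef (inverse (lfac (- inverse b)))"
    have 1: "?c (1 - k) + inverse b * ?c (- k) = (if k = 1 then 1 else 0)"
      using inv[of "- inverse b" "1 - k"] by (auto split: if_splits)
    have 2: "b * ?c (- k) + ?c (- k - 1) = b * (if k = 0 then 1 else 0)"
      using inv[of "- inverse b" "- k"] nz(1) by (auto simp: field_simps split: if_splits)
    have "inverse b * coef (lfac (- b) * inverse (lfac (- inverse b))) (- k)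
        + coef (lfac (- b) * inverse (lfac (- inverse b))) (1 - k)
      = (?c (1 - k) + inverse b * ?c (- k)) + (b * ?c (- k) + ?c (- k - 1))"
      using nz(1) by (simp add: coef_lfac_mult algebra_simps)
    then show ?thesis unfolding 1 2 using nz(1) that by (simp add: algebra_simps)
  qed
  consider "g = 1" "x' = x" | "g = -1" "x' = - b * x" | "g = -1" "x = - b * x'" using rel by blast
  then show ?thesis
  proof cases
    case 1
    then show ?thesis using nz
      by (auto simp: S_def R_def lfac_pow_def coef_lfac_mult coef_lfac field_simps)
  next
    case 2
    then have "x' / x = - b" "x / x' = - inverse b" using nz by (auto simp: field_simps)
    then have "S k + inverse b * S (k - 1) + (inverse b * R k + R (k - 1)) =
      inverse x * ((if k = 0 then 1 else 0) + inverse b * (if k = 1 then 1 else 0)) +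
      inverse x' * (inverse b * coef (lfac (- b) * inverse (lfac (- inverse b))) (- k)
        + coef (lfac (- b) * inverse (lfac (- inverse b))) (1 - k))"
      using 2(1) by (simp add: S_def R_def lfac_pow_def lfac_inverse coef_one power_int_minus algebra_simps)
    also have "\<dots> = 0" by (rule half) (use 2 nz in \<open>simp add: field_simps\<close>)
    finally show ?thesis .
  next
    case 3
    then have "x' / x = - inverse b" "x / x' = - b" using nz by (auto simp: field_simps)
    then have "S k + inverse b * S (k - 1) + (inverse b * R k + R (k - 1)) =
      inverse x' * ((if 1 - k = 0 then 1 else 0) + inverse b * (if 1 - k = 1 then 1 else 0)) +
      inverse x * (inverse b * coef (lfac (- b) * inverse (lfac (- inverse b))) (- (1 - k))
        + coef (lfac (- b) * inverse (lfac (- inverse b))) (1 - (1 - k)))"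
      using 3(1) by (simp add: S_def R_def lfac_pow_def lfac_inverse coef_one power_int_minus algebra_simps)
    also have "\<dots> = 0" by (rule half) (use 3 nz in \<open>simp add: field_simps\<close>)
    finally show ?thesis .
  qed
qed

context osp_bosons
begin

context
  fixes \<epsilon> \<eta> \<epsilon>' \<eta>' h h' :: int and x x' :: complex
  assumes sgn: "sign \<epsilon>" "sign \<eta>" "sign \<epsilon>'" "sign \<eta>'" and x: "x \<noteq> 0" "x' \<noteq> 0"
begin

text \<open>
  The normally ordered product of the two vertex operators with a coefficient sequence \<open>S\<close>, on a vector
  of charges \<open>(m, l)\<close>. The degrees are those common to both orders of the product.
\<close>

definition wick_pair :: "int \<Rightarrow> int \<Rightarrow> (int \<Rightarrow> complex) \<Rightarrow> int \<Rightarrow> int \<Rightarrow> 'v \<Rightarrow> 'v" where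
  "wick_pair m l S i j v = (x powi (\<eta> * l) * x' powi (\<eta>' * l)) *s shift \<epsilon> \<eta> (shift \<epsilon>' \<eta>'
      (wick S (cr \<epsilon> h \<eta> x) (cr \<epsilon>' h' \<eta>' x') (an \<epsilon> h \<eta> x) (an \<epsilon>' h' \<eta>' x')
        (i - \<epsilon> * m - \<eta> * l - (\<epsilon> * \<epsilon>' + \<eta> * \<eta>')) (j - \<epsilon>' * m - \<eta>' * l) v))"

lemma lin_shifts: "lin (\<lambda>v. shift \<epsilon> \<eta> (shift \<epsilon>' \<eta>' v))"
  by (rule lin_comp[OF lin_shift[OF sgn(1,2)] lin_shift[OF sgn(3,4)]])

lemma wick_pair_add: "wick_pair m l (\<lambda>k. S k + S' k) i j v = wick_pair m l S i j v + wick_pair m l S' i j v"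
  unfolding wick_pair_def wick_add[OF cr cr an an] lin_add[OF lin_shifts] scale_right_distrib ..

lemma wick_pair_scale: "wick_pair m l (\<lambda>k. y * S k) i j v = y *s wick_pair m l S i j v"
  unfolding wick_pair_def wick_scale[OF cr cr an an] lin_scale[OF lin_shifts] by (rule scale_left_commute)

lemma wick_pair_zero: "(\<And>k. S k = 0) \<Longrightarrow> wick_pair m l S i j v = 0"
  unfolding wick_pair_def by (simp only: wick_zero[OF cr cr an an] lin_zero[OF lin_shifts] scale_zero_right)

lemma wick_pair_shift: "wick_pair m l S i (j - 1) v = wick_pair m l (\<lambda>k. S (k - 1)) (i - 1) j v"
proof -
  have *: "j - 1 - \<epsilon>' * m - \<eta>' * l = j - \<epsilon>' * m - \<eta>' * l - 1"
    "i - 1 - \<epsilon> * m - \<eta> * l - (\<epsilon> * \<epsilon>' + \<eta> * \<eta>') = i - \<epsilon> * m - \<eta> * l - (\<epsilon> * \<epsilon>' + \<eta> * \<eta>') - 1"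
    by simp_all
  show ?thesis unfolding wick_pair_def * wick_shift[OF cr cr an an] ..
qed

lemma vertex_vertex_pair:
  assumes "charged m l v"
  shows "V \<epsilon> h \<eta> x i (V \<epsilon>' h' \<eta>' x' j v) =
    wick_pair m l (\<lambda>k. x powi (\<eta> * \<eta>') * coef (contraction (\<epsilon> * \<epsilon>') (\<eta> * \<eta>') (r powi (h + h')) (x' / x)) k) i j v"
  "V \<epsilon>' h' \<eta>' x' j (V \<epsilon> h \<eta> x i v) =
    wick_pair m l (\<lambda>k. x' powi (\<eta> * \<eta>') * coef (contraction (\<epsilon> * \<epsilon>') (\<eta> * \<eta>') (r powi (h + h')) (x / x'))
      (\<epsilon> * \<epsilon>' + \<eta> * \<eta>' - k)) i j v"
  unfolding wick_pair_scale
  by (simp_all only: vertex_vertex[OF sgn x(1) assms] vertex_vertex_reverse[OF sgn x(2) assms] wick_pair_def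
    scale_scale mult_ac)

text \<open>
  The coefficient of \<open>z\<^sup>i w\<^sup>j\<close> in
  \<open>(z + b\<^sup>-\<^sup>1 w) V(z) V'(w) + (b\<^sup>-\<^sup>1 z + w) V'(w) V(z)\<close>.
\<close>

lemma vertex_exchange:
  assumes same: "\<epsilon>' = \<epsilon>" "h' = h"
    and b: "b = r powi (h + h)"
    and rel: "\<eta> * \<eta>' = 1 \<and> x' = x \<or> \<eta> * \<eta>' = -1 \<and> x' = - b * x \<or> \<eta> * \<eta>' = -1 \<and> x = - b * x'"
  shows "V \<epsilon> h \<eta> x (i - 1) (V \<epsilon>' h' \<eta>' x' j v) + inverse b *s V \<epsilon> h \<eta> x i (V \<epsilon>' h' \<eta>' x' (j - 1) v) +
    (inverse b *s V \<epsilon>' h' \<eta>' x' j (V \<epsilon> h \<eta> x (i - 1) v) + V \<epsilon>' h' \<eta>' x' (j - 1) (V \<epsilon> h \<eta> x i v)) = 0"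
  (is "?L v = 0")
proof (rule linear_eq_on_charged[where f = ?L and g = "\<lambda>v. 0"])
  note linV = lin_vertex[OF sgn(1,2)] lin_vertex[OF sgn(3,4)]
  show "lin ?L"
    by (intro lin_plus lin_smult lin_comp[OF linV(1) linV(2)] lin_comp[OF linV(2) linV(1)])
  show "lin (\<lambda>v. 0)" by (rule lin_0)
  fix m l v assume ch: "charged m l v"
  have "\<epsilon> * \<epsilon>' = 1" using sgn same by auto
  then have contr: "contraction (\<epsilon> * \<epsilon>') g (r powi (h + h')) \<rho> = lfac (- b) * lfac_pow \<rho> g"
    "\<epsilon> * \<epsilon>' + \<eta> * \<eta>' = 1 + \<eta> * \<eta>'" for g \<rho>
    by (simp_all add: contraction_def lfac_pow_def b same)
  let ?S = "\<lambda>k. x powi (\<eta> * \<eta>') * coef (lfac (- b) * lfac_pow (x' / x) (\<eta> * \<eta>')) k"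
  let ?R = "\<lambda>k. x' powi (\<eta> * \<eta>') * coef (lfac (- b) * lfac_pow (x / x') (\<eta> * \<eta>')) (1 + \<eta> * \<eta>' - k)"
  have "b \<noteq> 0" using r_nz by (simp add: b)
  have "?L v =
    wick_pair m l (\<lambda>k. ?S k + inverse b * ?S (k - 1) + (inverse b * ?R k + ?R (k - 1))) (i - 1) j v"
    unfolding vertex_vertex_pair[OF ch] contr wick_pair_shift wick_pair_add[of m l] wick_pair_scale[of m l "inverse b"] ..
  also have "\<dots> = 0"
    by (rule wick_pair_zero) (rule exchange_coefficients[OF \<open>b \<noteq> 0\<close> x rel])
  finally show "?L v = 0" .
qed

text \<open>
  The \<open>a\<close>- and \<open>c\<close>-contractions cancel in both orders, leaving the leading coefficients \<open>x\<close> and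
  \<open>x' = -x\<close>.
\<close>

lemma vertex_anticommute:
  assumes opp: "\<epsilon>' = - \<epsilon>" "h' = - h" and rel: "\<eta>' = \<eta>" "x' = - x" and ch: "charged m l v"
  shows "V \<epsilon> h \<eta> x i (V \<epsilon>' h' \<eta>' x' j v) + V \<epsilon>' h' \<eta>' x' j (V \<epsilon> h \<eta> x i v) = 0"
proof -
  have "\<epsilon> * \<epsilon>' = -1" "\<eta> * \<eta>' = 1" using sgn opp rel by auto
  moreover have "x' / x = -1" "x / x' = -1" using x rel by auto
  ultimately have "contraction (\<epsilon> * \<epsilon>') (\<eta> * \<eta>') (r powi (h + h')) (x' / x) = 1"
    "contraction (\<epsilon> * \<epsilon>') (\<eta> * \<eta>') (r powi (h + h')) (x / x') = 1" "\<epsilon> * \<epsilon>' + \<eta> * \<eta>' = 0"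
    using lfac_inverse[of "-1"] by (simp_all add: contraction_def lfac_pow_def opp mult.commute)
  then show ?thesis
    unfolding vertex_vertex_pair[OF ch] wick_pair_add[symmetric] using \<open>\<eta> * \<eta>' = 1\<close>
    by (intro wick_pair_zero) (auto simp: coef_one rel(2))
qed

text \<open>
  Both orders are expansions of \<open>1/(x (z + w)(z - \<rho> w))\<close>, with opposite signs and in opposite domains.
  Their sum is given by the same closed formula for all \<open>k\<close>, including \<open>k = -1\<close>, where both
  expansions have no term.
\<close>

lemma vertex_anticommutator:
  assumes opp: "\<epsilon>' = - \<epsilon>" "h' = - h" "\<eta>' = - \<eta>" and \<rho>: "x' = \<rho> * x" "\<rho> \<noteq> -1" and ch: "charged m l v"
  shows "V \<epsilon> h \<eta> x i (V \<epsilon>' h' \<eta>' x' j v) + V \<epsilon>' h' \<eta>' x' j (V \<epsilon> h \<eta> x i v) =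
    (\<rho> powi (- \<eta> * l) / (x * (1 + \<rho>))) *s
     (wick (\<lambda>k. (-1) powi k) (cr \<epsilon> h \<eta> x) (cr \<epsilon>' h' \<eta>' x') (an \<epsilon> h \<eta> x) (an \<epsilon>' h' \<eta>' x')
        (i - \<epsilon> * m - \<eta> * l + 2) (j + \<epsilon> * m + \<eta> * l) v
    + \<rho> *s wick (\<lambda>k. \<rho> powi k) (cr \<epsilon> h \<eta> x) (cr \<epsilon>' h' \<eta>' x') (an \<epsilon> h \<eta> x) (an \<epsilon>' h' \<eta>' x')
        (i - \<epsilon> * m - \<eta> * l + 2) (j + \<epsilon> * m + \<eta> * l) v)"
proof -
  have sg: "\<epsilon> * \<epsilon>' = -1" "\<eta> * \<eta>' = -1" using sgn opp by auto
  have \<rho>0: "\<rho> \<noteq> 0" using x \<rho> by auto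
  have nz: "1 + \<rho> \<noteq> 0" using \<rho>(2) by (metis add.inverse_inverse add_eq_0_iff)
  have quot: "x' / x = \<rho>" "x / x' = inverse \<rho>" using x \<rho> \<rho>0 by (simp_all add: field_simps)
  have contr: "contraction (\<epsilon> * \<epsilon>') (\<eta> * \<eta>') (r powi (h + h')) y = lfac_pow (-1) (-1) * lfac_pow y (-1)" for y
    unfolding contraction_def sg by (simp add: opp(2))
  have i\<rho>: "inverse \<rho> \<noteq> -1" using \<rho>(2) by (metis inverse_inverse_eq inverse_minus_eq inverse_1)
  have coefs: "x powi (\<eta> * \<eta>') * coef (lfac_pow (-1) (-1) * lfac_pow \<rho> (-1)) k +
      x' powi (\<eta> * \<eta>') * coef (lfac_pow (-1) (-1) * lfac_pow (inverse \<rho>) (-1)) (- 2 - k) =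
      (1 / (x * (1 + \<rho>))) * ((-1) powi k + \<rho> * \<rho> powi k)" for k
  proof -
    have p1: "\<rho> powi (k + 1) = \<rho> * \<rho> powi k" using \<rho>0 by (simp add: power_int_add)
    consider "k \<ge> 0" | "k = -1" | "k \<le> -2" by linarith
    then show ?thesis
    proof cases
      case 1
      then have "coef (lfac_pow (-1) (-1) * lfac_pow (inverse \<rho>) (-1)) (- 2 - k) = 0" by (simp add: coef_def)
      then show ?thesis
        unfolding partial_fractions[OF \<rho>(2) 1] p1 sg
        by (simp add: power_int_minus divide_inverse mult_ac)
    next
      case 2
      then show ?thesis using \<rho>0 by (simp add: coef_def power_int_minus)
    next
      case 3
      then have z: "coef (lfac_pow (-1) (-1) * lfac_pow \<rho> (-1)) k = 0" by (simp add: coef_def)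
      have "inverse \<rho> powi (- 2 - k + 1) = \<rho> * \<rho> powi k"
        using p1 by (simp add: power_int_inverse flip: power_int_minus)
      moreover have "(-1) powi (- 2 - k) = ((-1) powi k :: complex)"
        using power_int_minus_one_minus[of "k + 2"]
        by (simp add: power_int_add minus_diff_commute[of 2 k])
      ultimately have "coef (lfac_pow (-1) (-1) * lfac_pow (inverse \<rho>) (-1)) (- 2 - k) =
          ((-1) powi k + \<rho> * \<rho> powi k) / (1 + inverse \<rho>)"
        using partial_fractions[OF i\<rho>, of "- 2 - k"] 3 by simp
      moreover have "x' powi (\<eta> * \<eta>') / (1 + inverse \<rho>) = 1 / (x * (1 + \<rho>))"
        using \<rho>0 nz x unfolding \<rho>(1) sg by (simp add: power_int_minus field_simps)
      ultimately show ?thesis unfolding z by (simp add: divide_inverse mult_ac)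
    qed
  qed
  have "x powi (\<eta> * l) * x' powi (\<eta>' * l) = \<rho> powi (- \<eta> * l)"
    using x \<rho>0 unfolding \<rho>(1) opp
    by (simp add: power_int_mult_distrib power_int_minus field_simps)
  moreover have "shift \<epsilon> \<eta> (shift \<epsilon>' \<eta>' w) = w" for w unfolding opp by (rule shift_cancel[OF sgn(1,2)])
  moreover have "i - \<epsilon> * m - \<eta> * l - (\<epsilon> * \<epsilon>' + \<eta> * \<eta>') = i - \<epsilon> * m - \<eta> * l + 2"
    "j - \<epsilon>' * m - \<eta>' * l = j + \<epsilon> * m + \<eta> * l"
    by (simp only: sg) (simp add: opp)
  ultimately have wick_pair: "wick_pair m l S i j v = \<rho> powi (- \<eta> * l) *s
      wick S (cr \<epsilon> h \<eta> x) (cr \<epsilon>' h' \<eta>' x') (an \<epsilon> h \<eta> x) (an \<epsilon>' h' \<eta>' x')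
        (i - \<epsilon> * m - \<eta> * l + 2) (j + \<epsilon> * m + \<eta> * l) v" for S
    unfolding wick_pair_def by (simp only:)
  have "\<epsilon> * \<epsilon>' + \<eta> * \<eta>' = - 2" using sg by simp
  then show ?thesis
    unfolding vertex_vertex_pair[OF ch] wick_pair_add[symmetric] contr quot
    by (simp only: coefs wick_pair_scale wick_pair_add) (simp add: wick_pair scale_right_distrib mult.commute)
qed

end

end

section \<open>The quadratic relations of \<open>X\<^sup>+\<close> and of \<open>X\<^sup>-\<close>\<close>

context complex_space
begin

text \<open>
  The exchange relation is bilinear in the two currents, so it suffices to have it for each ordered pair
  of summands.
\<close>

lemma exchange_sum:
  assumes lin: "\<And>k. lin (U k)" "\<And>k. lin (W k)"
    and ex: "\<And>A B i j v. A \<in> {U, W} \<Longrightarrow> B \<in> {U, W} \<Longrightarrow>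
      A (i - 1) (B j v) + y *s A i (B (j - 1) v) + (y *s B j (A (i - 1) v) + B (j - 1) (A i v)) = 0"
    and X: "\<And>k v. X k v = F *s (U k v + W k v)"
  shows "smult2 scale (lin_zw 1 y) (prod_zw X X) i j v + smult2 scale (lin_zw y 1) (prod_wz X X) i j v = 0"
proof -
  have XX: "X k (X l w) = (F * F) *s (U k (U l w) + U k (W l w) + (W k (U l w) + W k (W l w)))" for k l w
    by (simp add: X lin_add[OF lin(1)] lin_add[OF lin(2)] lin_scale[OF lin(1)] lin_scale[OF lin(2)]
      scale_right_distrib add_ac)
  let ?e = "\<lambda>A B. A (i - 1) (B j v) + y *s A i (B (j - 1) v) + (y *s B j (A (i - 1) v) + B (j - 1) (A i v))"
  have "smult2 scale (lin_zw 1 y) (prod_zw X X) i j v + smult2 scale (lin_zw y 1) (prod_wz X X) i j v =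
    (F * F) *s (?e U U + ?e U W + (?e W U + ?e W W))"
    by (simp add: smult2_lin prod_zw_def prod_wz_def XX scale_right_distrib mult_ac add_ac)
  then show ?thesis by (simp add: ex)
qed

end

context osp_bosons
begin

abbreviation Xp :: "'v ser" where "Xp \<equiv> X_plus scale q r a c eQa eQc"
abbreviation Xm :: "'v ser" where "Xm \<equiv> X_minus scale q r a c eQa eQc"

lemma lin_X: "lin (Xp k)" "lin (Xm k)"
  unfolding X_plus_def[abs_def] X_minus_def[abs_def]
  by (intro lin_smult lin_plus lin_vertex; simp)+

lemma Xp_Xp:
  "smult2 scale (lin_zw 1 q) (prod_zw Xp Xp) i j v + smult2 scale (lin_zw q 1) (prod_wz Xp Xp) i j v = 0"
proof (rule exchange_sum[where U = "V 1 (-1) 1 r" and W = "V 1 (-1) (-1) (- inverse r)" and F = "F_plus r"])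
  let ?b = "r powi (-1 + -1)"
  have b: "inverse ?b = q" "?b = inverse q"
    using r_sq by (simp_all add: power_int_minus)
  have rr: "r * r = q" using r_sq by (simp add: power2_eq_square)
  have x: "- inverse r = - ?b * r" unfolding b using r_nz by (simp add: field_simps flip: rr)
  fix A B i j v
  assume "A \<in> {V 1 (-1) 1 r, V 1 (-1) (-1) (- inverse r)}" "B \<in> {V 1 (-1) 1 r, V 1 (-1) (-1) (- inverse r)}"
  then obtain \<eta> x \<eta>' x' where "A = V 1 (-1) \<eta> x" "B = V 1 (-1) \<eta>' x'"
    "sign \<eta>" "sign \<eta>'" "x \<noteq> 0" "x' \<noteq> 0"
    "\<eta> * \<eta>' = 1 \<and> x' = x \<or> \<eta> * \<eta>' = -1 \<and> x' = - ?b * x \<or> \<eta> * \<eta>' = -1 \<and> x = - ?b * x'"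
    using x r_nz by fastforce
  then show "A (i - 1) (B j v) + q *s A i (B (j - 1) v) + (q *s B j (A (i - 1) v) + B (j - 1) (A i v)) = 0"
    using vertex_exchange[of 1 \<eta> 1 \<eta>' x x' "-1" "-1" ?b i j v] b by simp
qed (simp_all add: lin_vertex X_plus_def)

lemma Xm_Xm:
  "smult2 scale (lin_zw 1 (inverse q)) (prod_zw Xm Xm) i j v +
    smult2 scale (lin_zw (inverse q) 1) (prod_wz Xm Xm) i j v = 0"
proof (rule exchange_sum[where U = "V (-1) 1 1 (- r)" and W = "V (-1) 1 (-1) (inverse r)" and F = "F_minus q"])
  let ?b = "r powi (1 + 1)"
  have b: "?b = q" using r_sq by simp
  have rr: "r * r = q" using r_sq by (simp add: power2_eq_square)
  have x: "- r = - ?b * inverse r" unfolding b using r_nz by (simp add: field_simps flip: rr)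
  fix A B i j v
  assume "A \<in> {V (-1) 1 1 (- r), V (-1) 1 (-1) (inverse r)}" "B \<in> {V (-1) 1 1 (- r), V (-1) 1 (-1) (inverse r)}"
  then obtain \<eta> x \<eta>' x' where "A = V (-1) 1 \<eta> x" "B = V (-1) 1 \<eta>' x'"
    "sign \<eta>" "sign \<eta>'" "x \<noteq> 0" "x' \<noteq> 0"
    "\<eta> * \<eta>' = 1 \<and> x' = x \<or> \<eta> * \<eta>' = -1 \<and> x' = - ?b * x \<or> \<eta> * \<eta>' = -1 \<and> x = - ?b * x'"
    using x r_nz by fastforce
  then show "A (i - 1) (B j v) + inverse q *s A i (B (j - 1) v) +
      (inverse q *s B j (A (i - 1) v) + B (j - 1) (A i v)) = 0"
    using vertex_exchange[of "-1" \<eta> "-1" \<eta>' x x' 1 1 ?b i j v] b by simp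
qed (simp_all add: lin_vertex X_minus_def)

end

section \<open>The currents \<open>\<psi>\<^sup>\<plusminus>\<close> and their relations\<close>

context complex_space
begin

text \<open>
  Once \<open>L\<close> has been moved to the right of \<open>X\<close>, it meets its inverse, and only the term of degree \<open>0\<close> of
  the product \<open>L R = 1\<close> survives. The triangular support of \<open>L\<close> and \<open>R\<close> makes all sums finite.
\<close>

lemma conjugate_down:
  assumes move: "\<And>k j v. L k (X j v) = Sum_any (\<lambda>b. coef g b *s X (j - b) (L (k + b) v))"
    and L: "\<And>k v. k > 0 \<Longrightarrow> L k v = 0" and R: "\<And>k v. k > 0 \<Longrightarrow> R k v = 0"
    and lin: "\<And>k. lin (X k)" "\<And>k. lin (L k)"
    and inv: "ser_mult L R = ser_one"
  shows "prod_zwz L X R = smult2 scale (expand_wz g) (in_w X)"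
proof (intro ext)
  fix i j v
  let ?t = "\<lambda>b k. coef g b *s X (j - b) (L (k + b) (R (i - k) v))"
  have "?t b k = 0" if "(b, k) \<notin> {0..- i} \<times> {i..0}" for b k
  proof -
    have "b < 0 \<or> k + b > 0 \<or> i - k > 0" using that by auto
    then show ?thesis
      by (auto simp: coef_def L R lin_zero[OF lin(1)] lin_zero[OF lin(2)])
  qed
  then have sub: "{(b, k). ?t b k \<noteq> 0} \<subseteq> {0..- i} \<times> {i..0}" by blast
  have fin: "finite {(b, k). ?t b k \<noteq> 0}" by (rule finite_subset[OF sub]) simp
  have "prod_zwz L X R i j v = Sum_any (\<lambda>k. Sum_any (\<lambda>b. ?t b k))"
    by (simp add: prod_zwz_def move)
  also have "\<dots> = Sum_any (\<lambda>b. Sum_any (\<lambda>k. ?t b k))" by (rule Sum_any_swap_finite[OF fin, symmetric])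
  also have "\<dots> = Sum_any (\<lambda>b. if b = - i then coef g (- i) *s X (i + j) v else 0)"
  proof (rule arg_cong[where f = Sum_any], rule ext)
    fix b
    have finb: "finite {k. L (k + b) (R (i - k) v) \<noteq> 0}"
    proof (rule finite_subset)
      show "{k. L (k + b) (R (i - k) v) \<noteq> 0} \<subseteq> {i..- b}"
      proof
        fix k assume "k \<in> {k. L (k + b) (R (i - k) v) \<noteq> 0}"
        then have "\<not> k + b > 0" "\<not> i - k > 0" using L R lin_zero[OF lin(2)] by auto
        then show "k \<in> {i..- b}" by simp
      qed
    qed simp
    have "Sum_any (\<lambda>k. ?t b k) = coef g b *s X (j - b) (Sum_any (\<lambda>k. L (k + b) (R (i - k) v)))"
      by (rule lin_Sum_any[OF lin_smult[OF lin(1)] finb, symmetric])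
    also have "Sum_any (\<lambda>k. L (k + b) (R (i - k) v)) = ser_mult L R (i + b) v"
      unfolding ser_mult_def
      by (subst Sum_any_bij[symmetric, where h = "\<lambda>k. k + b" and g = "\<lambda>k. L k (R (i + b - k) v)"])
        (auto intro!: o_bij[where g = "\<lambda>k. k - b"])
    finally show "Sum_any (\<lambda>k. ?t b k) = (if b = - i then coef g (- i) *s X (i + j) v else 0)"
      by (auto simp: inv ser_one_def lin_zero[OF lin(1)] add.commute)
  qed
  also have "\<dots> = coef g (- i) *s X (i + j) v"
    by (subst Sum_any_single[of "- i"]) auto
  also have "\<dots> = smult2 scale (expand_wz g) (in_w X) i j v"
  proof -
    have "smult2 scale (expand_wz g) (in_w X) i j v =
        (\<Sum>(k, l)\<in>{(i, - i)}. expand_wz g k l *s in_w X (i - k) (j - l) v)"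
      unfolding smult2_def by (rule Sum_any_supported) (auto simp: expand_wz_def in_w_def split: if_splits)
    then show ?thesis by (simp add: expand_wz_def in_w_def coef_def add.commute)
  qed
  finally show "prod_zwz L X R i j v = smult2 scale (expand_wz g) (in_w X) i j v" .
qed

text \<open>
  The same for series in \<open>z\<close>, with \<open>R\<close> moved to the left.
\<close>

lemma conjugate_up:
  assumes move: "\<And>k j v. X j (R k v) = Sum_any (\<lambda>b. coef g b *s R (k - b) (X (j + b) v))"
    and L: "\<And>k v. k < 0 \<Longrightarrow> L k v = 0" and R: "\<And>k v. k < 0 \<Longrightarrow> R k v = 0"
    and lin: "\<And>k. lin (L k)" "\<And>k. lin (R k)"
    and inv: "ser_mult L R = ser_one"
  shows "prod_zwz L X R = smult2 scale (expand_zw g) (in_w X)"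
proof (intro ext)
  fix i j v
  let ?t = "\<lambda>b k. coef g b *s L k (R (i - k - b) (X (j + b) v))"
  have "?t b k = 0" if "(b, k) \<notin> {0..i} \<times> {0..i}" for b k
  proof -
    have "b < 0 \<or> k < 0 \<or> i - k - b < 0" using that by auto
    then show ?thesis
      by (auto simp: coef_def L R lin_zero[OF lin(1)] lin_zero[OF lin(2)])
  qed
  then have sub: "{(b, k). ?t b k \<noteq> 0} \<subseteq> {0..i} \<times> {0..i}" by blast
  have fin: "finite {(b, k). ?t b k \<noteq> 0}" by (rule finite_subset[OF sub]) simp
  have fink: "finite {b. coef g b *s R (k - b) (X (j + b) v) \<noteq> 0}" for k
  proof (rule finite_subset)
    show "{b. coef g b *s R (k - b) (X (j + b) v) \<noteq> 0} \<subseteq> {0..k}"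
    proof
      fix b assume "b \<in> {b. coef g b *s R (k - b) (X (j + b) v) \<noteq> 0}"
      then have "\<not> b < 0" "\<not> k - b < 0" using R by (auto simp: coef_def)
      then show "b \<in> {0..k}" by simp
    qed
  qed simp
  have "prod_zwz L X R i j v = Sum_any (\<lambda>k. Sum_any (\<lambda>b. ?t b k))"
    unfolding prod_zwz_def move lin_Sum_any[OF lin(1) fink] lin_scale[OF lin(1)] ..
  also have "\<dots> = Sum_any (\<lambda>b. Sum_any (\<lambda>k. ?t b k))" by (rule Sum_any_swap_finite[OF fin, symmetric])
  also have "\<dots> = Sum_any (\<lambda>b. if b = i then coef g i *s X (i + j) v else 0)"
  proof (rule arg_cong[where f = Sum_any], rule ext)
    fix b
    have finb: "finite {k. L k (R (i - k - b) (X (j + b) v)) \<noteq> 0}"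
    proof (rule finite_subset)
      show "{k. L k (R (i - k - b) (X (j + b) v)) \<noteq> 0} \<subseteq> {0..i - b}"
      proof
        fix k assume "k \<in> {k. L k (R (i - k - b) (X (j + b) v)) \<noteq> 0}"
        then have "\<not> k < 0" "\<not> i - k - b < 0" using L R lin_zero[OF lin(1)] by auto
        then show "k \<in> {0..i - b}" by simp
      qed
    qed simp
    have "Sum_any (\<lambda>k. ?t b k) = coef g b *s Sum_any (\<lambda>k. L k (R (i - k - b) (X (j + b) v)))"
      by (rule scale_Sum_any[OF finb, symmetric])
    also have "Sum_any (\<lambda>k. L k (R (i - k - b) (X (j + b) v))) = ser_mult L R (i - b) (X (j + b) v)"
      by (simp add: ser_mult_def algebra_simps)
    finally show "Sum_any (\<lambda>k. ?t b k) = (if b = i then coef g i *s X (i + j) v else 0)"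
      by (auto simp: inv ser_one_def add.commute)
  qed
  also have "\<dots> = coef g i *s X (i + j) v"
    by (subst Sum_any_single[of i]) auto
  also have "\<dots> = smult2 scale (expand_zw g) (in_w X) i j v"
  proof -
    have "smult2 scale (expand_zw g) (in_w X) i j v =
        (\<Sum>(k, l)\<in>{(i, - i)}. expand_zw g k l *s in_w X (i - k) (j - l) v)"
      unfolding smult2_def by (rule Sum_any_supported) (auto simp: expand_zw_def in_w_def split: if_splits)
    then show ?thesis by (simp add: expand_zw_def in_w_def coef_def add.commute)
  qed
  finally show "prod_zwz L X R i j v = smult2 scale (expand_zw g) (in_w X) i j v" .
qed

end

context osp_bosons
begin

text \<open>
  \<open>y\<close> to the power \<open>a\<^sub>0\<close> times \<open>exp (s \<Sum>n>0. a\<^sub>d\<^sub>n z\<^sup>-\<^sup>d\<^sup>n)\<close>, which covers \<open>\<psi>\<^sup>\<plusminus>\<close> and their inverses.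
\<close>

definition Psi :: "int \<Rightarrow> complex \<Rightarrow> complex \<Rightarrow> 'v ser" where
  "Psi d y s k v = op_powi scale y (a 0) (bexp d (\<lambda>_. s) (\<lambda>_. 0) (- d * k) v)"

lemma psi_plus_Psi: "psi_plus scale q a = Psi 1 q \<kappa>"
proof -
  have eq: "bmode 1 (\<lambda>_. q - inverse q) (\<lambda>_. 0) = (\<lambda>n v. \<kappa> *s a (int n) v)"
    by (simp add: fun_eq_iff bmode_def)
  show ?thesis unfolding psi_plus_def[abs_def] eq[symmetric]
    by (auto simp: fun_eq_iff Psi_def ser_down_def bexp_def)
qed

lemma psi_minus_Psi: "psi_minus scale q a = Psi (-1) (inverse q) (- \<kappa>)"
proof -
  have eq: "bmode (-1) (\<lambda>_. - \<kappa>) (\<lambda>_. 0) = (\<lambda>n v. (- \<kappa>) *s a (- int n) v)"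
    by (simp add: fun_eq_iff bmode_def)
  show ?thesis unfolding psi_minus_def[abs_def] eq[symmetric]
    by (auto simp: fun_eq_iff Psi_def ser_up_def bexp_def)
qed

lemma lin_Psi: "lin (Psi d y s k)"
  unfolding Psi_def[abs_def] by (rule lin_comp[OF A0.lin_op_powi lin_bexp])

lemma op_powi_bexp: "d \<noteq> 0 \<Longrightarrow> op_powi scale y (a 0) (bexp d \<sigma> \<tau> i v) = bexp d \<sigma> \<tau> i (op_powi scale y (a 0) v)"
  by (rule A0.op_powi_commute[OF lin_bexp]) (simp add: zero_mode_bexp)

lemma op_powi_charged: "charged m l v \<Longrightarrow> op_powi scale y (a 0) v = y powi m *s v"
  by (rule A0.op_powi_eigenvector) (simp add: charged_def)

lemma Psi_charged:
  "d \<noteq> 0 \<Longrightarrow> charged m l v \<Longrightarrow> Psi d y s k v = y powi m *s bexp d (\<lambda>_. s) (\<lambda>_. 0) (- d * k) v"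
  unfolding Psi_def by (rule op_powi_charged[OF charged_bexp])

lemma Psi_Psi:
  assumes "d \<noteq> 0" "d' \<noteq> 0"
  shows "Psi d y s i (Psi d' y' s' j v) =
    op_powi scale (y * y') (a 0) (bexp d (\<lambda>_. s) (\<lambda>_. 0) (- d * i) (bexp d' (\<lambda>_. s') (\<lambda>_. 0) (- d' * j) v))"
  unfolding Psi_def by (simp only: A0.op_powi_mult op_powi_bexp[OF assms(1), symmetric])

lemma Psi_commute:
  assumes "d \<noteq> 0" shows "Psi d y s i (Psi d y' s' j v) = Psi d y' s' j (Psi d y s i v)"
  unfolding Psi_Psi[OF assms assms] bexp_commute[OF assms, of "\<lambda>_. s"] by (simp only: mult.commute)

lemma Psi_vanish: "d * k > 0 \<Longrightarrow> Psi d y s k v = 0"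
  by (simp add: Psi_def bexp_neg lin_zero[OF A0.lin_op_powi])

lemma Psi_inverse:
  assumes "d = 1 \<or> d = -1" "y * y' = 1"
  shows "ser_mult (Psi d y s) (Psi d y' (- s)) = ser_one"
proof (intro ext)
  fix k v
  have d: "d \<noteq> 0" "d * d = 1" using assms(1) by auto
  let ?p = "- d * k"
  let ?t = "\<lambda>i. bexp d (\<lambda>_. s) (\<lambda>_. 0) i (bexp d (\<lambda>_. - s) (\<lambda>_. 0) (?p - i) v)"
  have bij: "bij (\<lambda>i. - d * i)" by (rule o_bij[where g = "\<lambda>i. - d * i"]) (use d in \<open>auto simp: fun_eq_iff simp flip: mult.assoc\<close>)
  have "Psi d y s i (Psi d y' (- s) (k - i) v) = ?t (- d * i)" for i
  proof -
    have "- d * (k - i) = ?p - - d * i" by (simp add: algebra_simps)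
    then show ?thesis
      unfolding Psi_Psi[OF d(1) d(1)] assms(2) A0.op_powi_one by (simp only:)
  qed
  then have "ser_mult (Psi d y s) (Psi d y' (- s)) k v = Sum_any (\<lambda>i. ?t (- d * i))"
    by (simp only: ser_mult_def)
  also have "\<dots> = Sum_any ?t" by (rule Sum_any_bij[OF bij])
  also have "\<dots> = sum ?t {0..?p}"
    by (rule Sum_any_supported) (auto simp: bexp_neg bexp_simps not_le)
  also have "\<dots> = bexp d (\<lambda>_. s + - s) (\<lambda>_. 0 + 0) ?p v" by (rule bexp_mult[OF d(1)])
  also have "\<dots> = (if ?p = 0 then v else 0)" by (rule bexp_trivial[OF d(1)]) simp_all
  also have "\<dots> = ser_one k v" using d(1) by (auto simp: ser_one_def)
  finally show "ser_mult (Psi d y s) (Psi d y' (- s)) k v = ser_one k v" .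
qed

lemma fps_of_int_nth: "fps_nth (of_int e * f) n = of_int e * fps_nth (f :: complex fps) n"
  by (metis fps_mult_left_const_nth fps_of_int)

text \<open>
  \<open>((1 + p u/q) / (1 + q p u))\<^sup>e\<close>.
\<close>

definition psi_factor :: "int \<Rightarrow> complex \<Rightarrow> complex fps" where
  "psi_factor e p = lfac_pow (- (q * p)) (- e) * lfac_pow (- (p / q)) e"

lemma psi_factor_logder:
  assumes "sign e"
  shows "has_logder (psi_factor e p) (Abs_fps (\<lambda>n. of_int e * p ^ n * (-1) ^ n * \<kappa> * qint q (int n)))"
proof -
  have "has_logder (psi_factor e p) (- (of_int (- e) * geo (- (q * p))) + - (of_int e * geo (- (p / q))))"
    unfolding psi_factor_def by (intro has_logder_mult has_logder_lfac_pow) (use assms in auto)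
  moreover have "- (of_int (- e) * geo (- (q * p))) + - (of_int e * geo (- (p / q))) =
    Abs_fps (\<lambda>n. of_int e * p ^ n * (-1) ^ n * \<kappa> * qint q (int n))"
  proof (rule fps_ext)
    fix n
    have "(- (q * p)) ^ n = (-1) ^ n * q ^ n * p ^ n" "(- (p / q)) ^ n = (-1) ^ n * inverse q ^ n * p ^ n"
      by (subst power_minus, simp add: power_mult_distrib power_divide divide_inverse power_inverse)+
    then have "fps_nth (- (of_int (- e) * geo (- (q * p))) + - (of_int e * geo (- (p / q)))) n =
       (if n = 0 then 0 else of_int e * p ^ n * (-1) ^ n * (q ^ n - inverse q ^ n))"
      unfolding fps_add_nth fps_neg_nth fps_of_int_nth geo_def by (simp add: algebra_simps)
    also have "\<dots> = of_int e * p ^ n * (-1) ^ n * (q ^ n - inverse q ^ n)" by simp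
    also have "\<dots> = of_int e * p ^ n * (-1) ^ n * \<kappa> * qint q (int n)"
      unfolding qint_mult[symmetric] by (simp only: mult.assoc)
    finally show "fps_nth (- (of_int (- e) * geo (- (q * p))) + - (of_int e * geo (- (p / q)))) n =
      fps_nth (Abs_fps (\<lambda>n. of_int e * p ^ n * (-1) ^ n * \<kappa> * qint q (int n))) n" by simp
  qed
  ultimately show ?thesis by simp
qed

lemma psi_reorder:
  assumes e: "sign e" and sg: "sign \<epsilon>"
  shows "bexp 1 (\<lambda>_. of_int e * \<kappa>) (\<lambda>_. 0) i (cr \<epsilon> h \<eta> x j v) =
    (\<Sum>b\<in>{0..min i j}. fps_nth (psi_factor (e * \<epsilon>) (r powi h)) (nat b) *s
      cr \<epsilon> h \<eta> x (j - b) (bexp 1 (\<lambda>_. of_int e * \<kappa>) (\<lambda>_. 0) (i - b) v))"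
    and "an \<epsilon> h \<eta> x i (bexp (-1) (\<lambda>_. of_int e * \<kappa>) (\<lambda>_. 0) j v) =
    (\<Sum>b\<in>{0..min i j}. fps_nth (psi_factor (- (e * \<epsilon>)) (r powi h)) (nat b) *s
      bexp (-1) (\<lambda>_. of_int e * \<kappa>) (\<lambda>_. 0) (j - b) (an \<epsilon> h \<eta> x (i - b) v))"
proof -
  have pw: "r powi (h * int n) = (r powi h) ^ n" for n by (simp add: power_int_mult)
  have 0: "qint q 0 = 0" by (simp add: qint_def)
  have eq: "(of_int e * \<kappa> * - (of_int \<epsilon> * r powi (h * int n) / qint q (- int n)) * (-1) ^ n
      + 0 * - (of_int \<eta> * x powi int n / qint q (- int n))) * (qint q (int n))\<^sup>2 =
    of_int (e * \<epsilon>) * (r powi h) ^ n * (-1) ^ n * \<kappa> * qint q (int n)" for n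
    using qint_nz[of n] by (cases "n = 0") (simp_all add: 0 qint_minus pw power2_eq_square mult_ac)
  have eq': "(- (of_int \<epsilon> * r powi (h * int n) / qint q (int n)) * (of_int e * \<kappa>) * (-1) ^ n
      + - (of_int \<eta> * x powi (- int n) / qint q (int n)) * 0) * (qint q (int n))\<^sup>2 =
    of_int (- (e * \<epsilon>)) * (r powi h) ^ n * (-1) ^ n * \<kappa> * qint q (int n)" for n
    using qint_nz[of n] by (cases "n = 0") (simp_all add: 0 pw power2_eq_square mult_ac)
  have s: "sign (e * \<epsilon>)" "sign (- (e * \<epsilon>))" using sign_mult_sign[OF e sg] by auto
  show "bexp 1 (\<lambda>_. of_int e * \<kappa>) (\<lambda>_. 0) i (cr \<epsilon> h \<eta> x j v) =
    (\<Sum>b\<in>{0..min i j}. fps_nth (psi_factor (e * \<epsilon>) (r powi h)) (nat b) *s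
      cr \<epsilon> h \<eta> x (j - b) (bexp 1 (\<lambda>_. of_int e * \<kappa>) (\<lambda>_. 0) (i - b) v))"
    unfolding cr_def
    by (rule bexp_reorder) (use psi_factor_logder[OF s(1)] in \<open>simp_all only: has_logder_def eq\<close>)
  show "an \<epsilon> h \<eta> x i (bexp (-1) (\<lambda>_. of_int e * \<kappa>) (\<lambda>_. 0) j v) =
    (\<Sum>b\<in>{0..min i j}. fps_nth (psi_factor (- (e * \<epsilon>)) (r powi h)) (nat b) *s
      bexp (-1) (\<lambda>_. of_int e * \<kappa>) (\<lambda>_. 0) (j - b) (an \<epsilon> h \<eta> x (i - b) v))"
    unfolding an_def
    by (rule bexp_reorder) (use psi_factor_logder[OF s(2)] in \<open>simp_all only: has_logder_def eq'\<close>)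
qed

lemma reorder_extend:
  fixes i j :: int
  shows "(\<And>b. b > j \<Longrightarrow> f b = 0) \<Longrightarrow> (\<Sum>b\<in>{0..min i j}. f b) = (\<Sum>b\<in>{0..i}. (f b :: 'v))"
    and "(\<And>b. b > i \<Longrightarrow> f b = 0) \<Longrightarrow> (\<Sum>b\<in>{0..min i j}. f b) = (\<Sum>b\<in>{0..j}. f b)"
  by (rule sum.mono_neutral_left; auto)+

context
  fixes \<epsilon> h \<eta> :: int and x :: complex
  assumes sgn: "sign \<epsilon>" "sign \<eta>"
begin

lemma psi_nord_down:
  assumes e: "sign e"
  defines "E \<equiv> bexp 1 (\<lambda>_. of_int e * \<kappa>) (\<lambda>_. 0)"
  shows "E i (nord (cr \<epsilon> h \<eta> x) (an \<epsilon> h \<eta> x) d v) =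
    (\<Sum>b\<in>{0..i}. coef (psi_factor (e * \<epsilon>) (r powi h)) b *s nord (cr \<epsilon> h \<eta> x) (an \<epsilon> h \<eta> x) (d - b) (E (i - b) v))"
proof -
  let ?C = "cr \<epsilon> h \<eta> x" and ?A = "an \<epsilon> h \<eta> x"
  let ?g = "coef (psi_factor (e * \<epsilon>) (r powi h))"
  have E: "annihilator E" unfolding E_def by (rule annihilatorI)
  have "E i (?C j (?A (j - d) v)) = (\<Sum>b\<in>{0..i}. ?g b *s ?C (j - b) (?A (j - d) (E (i - b) v)))" for j
  proof -
    have "E i (?C j (?A (j - d) v)) = (\<Sum>b\<in>{0..min i j}. ?g b *s ?C (j - b) (E (i - b) (?A (j - d) v)))"
      unfolding E_def psi_reorder(1)[OF e sgn(1)] by (rule sum.cong) (auto simp: coef_def)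
    also have "\<dots> = (\<Sum>b\<in>{0..i}. ?g b *s ?C (j - b) (E (i - b) (?A (j - d) v)))"
      by (rule reorder_extend) (simp add: creatorD(2)[OF cr])
    finally show ?thesis by (simp only: annihilatorD(6)[OF E an])
  qed
  then have "E i (nord ?C ?A d v) = Sum_any (\<lambda>j. \<Sum>b\<in>{0..i}. ?g b *s ?C (j - b) (?A (j - d) (E (i - b) v)))"
    unfolding nord_def lin_Sum_any[OF annihilatorD(1)[OF E] finite_nord[OF cr an]] by simp
  also have "\<dots> = (\<Sum>b\<in>{0..i}. Sum_any (\<lambda>j. ?g b *s ?C (j - b) (?A (j - d) (E (i - b) v))))"
  proof (rule Sum_any_sum)
    fix b
    show "finite {j. ?g b *s ?C (j - b) (?A (j - d) (E (i - b) v)) \<noteq> 0}"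
    proof (rule finite_subset)
      show "{j. ?g b *s ?C (j - b) (?A (j - d) (E (i - b) v)) \<noteq> 0} \<subseteq>
          (\<lambda>j. j + b) ` {j. ?C j (?A (j - (d - b)) (E (i - b) v)) \<noteq> 0}"
      proof
        fix j assume "j \<in> {j. ?g b *s ?C (j - b) (?A (j - d) (E (i - b) v)) \<noteq> 0}"
        then show "j \<in> (\<lambda>j. j + b) ` {j. ?C j (?A (j - (d - b)) (E (i - b) v)) \<noteq> 0}"
          by (intro image_eqI[where x = "j - b"]) auto
      qed
    qed (intro finite_imageI finite_nord cr an)
  qed simp
  also have "\<dots> = (\<Sum>b\<in>{0..i}. ?g b *s nord ?C ?A (d - b) (E (i - b) v))"
  proof (rule sum.cong[OF refl])
    fix b
    have bij: "bij (\<lambda>j. j + b :: int)" by (rule o_bij[where g = "\<lambda>j. j - b"]) auto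
    show "Sum_any (\<lambda>j. ?g b *s ?C (j - b) (?A (j - d) (E (i - b) v))) =
        ?g b *s nord ?C ?A (d - b) (E (i - b) v)"
      unfolding nord_def scale_Sum_any[OF finite_nord[OF cr an]]
      by (subst Sum_any_bij[OF bij, symmetric]) (simp add: algebra_simps)
  qed
  finally show ?thesis .
qed

lemma psi_nord_up:
  assumes e: "sign e"
  defines "E \<equiv> bexp (-1) (\<lambda>_. of_int e * \<kappa>) (\<lambda>_. 0)"
  shows "nord (cr \<epsilon> h \<eta> x) (an \<epsilon> h \<eta> x) d (E i v) =
    (\<Sum>b\<in>{0..i}. coef (psi_factor (- (e * \<epsilon>)) (r powi h)) b *s E (i - b) (nord (cr \<epsilon> h \<eta> x) (an \<epsilon> h \<eta> x) (d + b) v))"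
proof -
  let ?C = "cr \<epsilon> h \<eta> x" and ?A = "an \<epsilon> h \<eta> x"
  let ?g = "coef (psi_factor (- (e * \<epsilon>)) (r powi h))"
  have E: "creator E" unfolding E_def by (rule creatorI)
  have "?C j (?A (j - d) (E i v)) = (\<Sum>b\<in>{0..i}. ?g b *s E (i - b) (?C j (?A (j - (d + b)) v)))" for j
  proof -
    have "?A (j - d) (E i v) = (\<Sum>b\<in>{0..min (j - d) i}. ?g b *s E (i - b) (?A (j - d - b) v))"
      unfolding E_def psi_reorder(2)[OF e sgn(1)] by (rule sum.cong) (auto simp: coef_def)
    also have "\<dots> = (\<Sum>b\<in>{0..i}. ?g b *s E (i - b) (?A (j - d - b) v))"
      by (rule reorder_extend) (simp add: annihilatorD(2)[OF an] lin_zero[OF creatorD(1)[OF E]])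
    finally show ?thesis
      by (simp add: lin_sum[OF creatorD(1)[OF cr]] lin_scale[OF creatorD(1)[OF cr]] creatorD(6)[OF cr E]
        diff_diff_eq)
  qed
  then have "nord ?C ?A d (E i v) = Sum_any (\<lambda>j. \<Sum>b\<in>{0..i}. ?g b *s E (i - b) (?C j (?A (j - (d + b)) v)))"
    by (simp add: nord_def)
  also have "\<dots> = (\<Sum>b\<in>{0..i}. Sum_any (\<lambda>j. ?g b *s E (i - b) (?C j (?A (j - (d + b)) v))))"
  proof (rule Sum_any_sum)
    fix b
    show "finite {j. ?g b *s E (i - b) (?C j (?A (j - (d + b)) v)) \<noteq> 0}"
      by (rule finite_subset[OF _ finite_nord[OF cr an, of \<epsilon> h \<eta> x \<epsilon> h \<eta> x "d + b" v]])
        (auto simp: lin_zero[OF creatorD(1)[OF E]])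
  qed simp
  also have "\<dots> = (\<Sum>b\<in>{0..i}. ?g b *s E (i - b) (nord ?C ?A (d + b) v))"
    unfolding nord_def lin_Sum_any[OF lin_smult[OF creatorD(1)[OF E]] finite_nord[OF cr an]] ..
  finally show ?thesis .
qed

end

text \<open>
  The contraction of the exponentials, together with the factor \<open>y\<^sup>\<epsilon>\<close> that \<open>y\<close> to the power \<open>a\<^sub>0\<close> acquires
  from the charge shift.
\<close>

lemma Psi_vertex_down:
  assumes sgn: "sign \<epsilon>" "sign \<eta>" and e: "sign e" and y: "y \<noteq> 0"
  shows "Psi 1 y (of_int e * \<kappa>) k (V \<epsilon> h \<eta> x j v) =
    (\<Sum>b\<in>{0..- k}. coef (fps_const (y powi \<epsilon>) * psi_factor (e * \<epsilon>) (r powi h)) b *s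
      V \<epsilon> h \<eta> x (j - b) (Psi 1 y (of_int e * \<kappa>) (k + b) v))"
    (is "?L v = ?R v")
proof (rule linear_eq_on_charged[where f = ?L and g = ?R])
  let ?P = "Psi 1 y (of_int e * \<kappa>)" and ?V = "V \<epsilon> h \<eta> x"
  let ?g = "coef (psi_factor (e * \<epsilon>) (r powi h))"
  note linV = lin_vertex[OF sgn]
  show "lin ?L" by (rule lin_comp[OF lin_Psi linV])
  show "lin ?R" by (intro lin_setsum lin_smult lin_comp[OF linV lin_Psi])
  fix m l v assume ch: "charged m l v"
  let ?E = "bexp 1 (\<lambda>_. of_int e * \<kappa>) (\<lambda>_. 0)"
  let ?N = "nord (cr \<epsilon> h \<eta> x) (an \<epsilon> h \<eta> x)" and ?d = "j - \<epsilon> * m - \<eta> * l"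
  have chE: "charged m l (?E i v)" for i using ch by (simp add: charged_bexp)
  have "?L v = y powi (m + \<epsilon>) *s ?E (- k) (?V j v)"
    using Psi_charged[OF one_neq_zero charged_vertex[OF sgn ch]] by simp
  also have "?E (- k) (?V j v) = x powi (\<eta> * l) *s shift \<epsilon> \<eta> (?E (- k) (?N ?d v))"
    unfolding vertex_charged[OF sgn ch] lin_scale[OF lin_bexp]
    by (simp only: bexp_eQ[OF one_neq_zero sgn])
  also have "?E (- k) (?N ?d v) = (\<Sum>b\<in>{0..- k}. ?g b *s ?N (?d - b) (?E (- k - b) v))"
    by (rule psi_nord_down[OF sgn e])
  also have "y powi (m + \<epsilon>) *s x powi (\<eta> * l) *s shift \<epsilon> \<eta> \<dots> =
     (\<Sum>b\<in>{0..- k}. (y powi \<epsilon> * ?g b) *s y powi m *s x powi (\<eta> * l) *s shift \<epsilon> \<eta> (?N (?d - b) (?E (- k - b) v)))"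
    unfolding lin_sum[OF lin_shift[OF sgn]] lin_scale[OF lin_shift[OF sgn]] scale_sum_right scale_scale
    by (intro sum.cong refl arg_cong2[where f = scale])
      (simp add: power_int_add[OF disjI1[OF y]] mult_ac)
  also have "\<dots> = ?R v"
  proof (intro sum.cong refl)
    fix b
    have d: "j - b - \<epsilon> * m - \<eta> * l = ?d - b" and kb: "- 1 * (k + b) = - k - b" by simp_all
    show "(y powi \<epsilon> * ?g b) *s y powi m *s x powi (\<eta> * l) *s shift \<epsilon> \<eta> (?N (?d - b) (?E (- k - b) v)) =
      coef (fps_const (y powi \<epsilon>) * psi_factor (e * \<epsilon>) (r powi h)) b *s ?V (j - b) (?P (k + b) v)"
      unfolding Psi_charged[OF one_neq_zero ch] kb lin_scale[OF linV] vertex_charged[OF sgn chE] d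
        coef_const_mult ..
  qed
  finally show "?L v = ?R v" .
qed

lemma Psi_vertex_up:
  assumes sgn: "sign \<epsilon>" "sign \<eta>" and e: "sign e" and y: "y \<noteq> 0"
  shows "V \<epsilon> h \<eta> x j (Psi (-1) y (of_int e * \<kappa>) k v) =
    (\<Sum>b\<in>{0..k}. coef (fps_const (y powi (- \<epsilon>)) * psi_factor (- (e * \<epsilon>)) (r powi h)) b *s
      Psi (-1) y (of_int e * \<kappa>) (k - b) (V \<epsilon> h \<eta> x (j + b) v))"
    (is "?L v = ?R v")
proof (rule linear_eq_on_charged[where f = ?L and g = ?R])
  let ?P = "Psi (-1) y (of_int e * \<kappa>)" and ?V = "V \<epsilon> h \<eta> x"
  let ?g = "coef (psi_factor (- (e * \<epsilon>)) (r powi h))"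
  note linV = lin_vertex[OF sgn]
  have d0: "(-1::int) \<noteq> 0" by simp
  show "lin ?L" by (rule lin_comp[OF linV lin_Psi])
  show "lin ?R" by (intro lin_setsum lin_smult lin_comp[OF lin_Psi linV])
  fix m l v assume ch: "charged m l v"
  let ?E = "bexp (-1) (\<lambda>_. of_int e * \<kappa>) (\<lambda>_. 0)"
  let ?N = "nord (cr \<epsilon> h \<eta> x) (an \<epsilon> h \<eta> x)" and ?d = "j - \<epsilon> * m - \<eta> * l"
  have chE: "charged m l (?E i v)" for i using ch by (simp add: charged_bexp)
  have mk: "- (-1) * i = i" for i :: int by simp
  have "?L v = y powi m *s x powi (\<eta> * l) *s shift \<epsilon> \<eta> (?N ?d (?E k v))"
    unfolding Psi_charged[OF d0 ch] mk lin_scale[OF linV] vertex_charged[OF sgn chE] ..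
  also have "?N ?d (?E k v) = (\<Sum>b\<in>{0..k}. ?g b *s ?E (k - b) (?N (?d + b) v))"
    by (rule psi_nord_up[OF sgn e])
  also have "y powi m *s x powi (\<eta> * l) *s shift \<epsilon> \<eta> \<dots> =
     (\<Sum>b\<in>{0..k}. (y powi (- \<epsilon>) * ?g b) *s y powi (m + \<epsilon>) *s x powi (\<eta> * l) *s
        ?E (k - b) (shift \<epsilon> \<eta> (?N (?d + b) v)))"
    unfolding lin_sum[OF lin_shift[OF sgn]] lin_scale[OF lin_shift[OF sgn]] scale_sum_right scale_scale
      bexp_eQ[OF d0 sgn]
    by (intro sum.cong refl arg_cong2[where f = scale])
      (use y in \<open>simp add: power_int_add power_int_minus\<close>)
  also have "\<dots> = ?R v"
  proof (intro sum.cong refl)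
    fix b
    have d: "j + b - \<epsilon> * m - \<eta> * l = ?d + b" by simp
    show "(y powi (- \<epsilon>) * ?g b) *s y powi (m + \<epsilon>) *s x powi (\<eta> * l) *s
        ?E (k - b) (shift \<epsilon> \<eta> (?N (?d + b) v)) =
      coef (fps_const (y powi (- \<epsilon>)) * psi_factor (- (e * \<epsilon>)) (r powi h)) b *s ?P (k - b) (?V (j + b) v)"
    proof -
      have "?P (k - b) (?V (j + b) v) = y powi (m + \<epsilon>) *s ?E (k - b) (?V (j + b) v)"
        using Psi_charged[OF d0 charged_vertex[OF sgn ch]] by (simp only: mk)
      then show ?thesis
        unfolding vertex_charged[OF sgn ch] d coef_const_mult lin_scale[OF lin_bexp] by (simp only:)
    qed
  qed
  finally show "?L v = ?R v" .
qed

lemma psi_conjugate_down: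
  assumes sg: "sign \<epsilon>" and e: "sign e" and y: "y * y' = 1"
    and X: "\<And>k v. X k v = F *s (V \<epsilon> h 1 x k v + V \<epsilon> h (-1) x' k v)"
  shows "prod_zwz (Psi 1 y (of_int e * \<kappa>)) X (Psi 1 y' (- (of_int e * \<kappa>))) =
    smult2 scale (expand_wz (fps_const (y powi \<epsilon>) * psi_factor (e * \<epsilon>) (r powi h))) (in_w X)"
proof (rule conjugate_down)
  let ?P = "Psi 1 y (of_int e * \<kappa>)"
  let ?g = "fps_const (y powi \<epsilon>) * psi_factor (e * \<epsilon>) (r powi h)"
  have y0: "y \<noteq> 0" using y by auto
  have one: "sign 1" "sign (-1)" by simp_all
  show linX: "lin (X k)" for k
    unfolding X[abs_def] by (intro lin_smult lin_plus lin_vertex[OF sg] one)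
  show "lin (?P k)" for k by (rule lin_Psi)
  show "?P k v = 0" if "k > 0" for k v using that by (simp add: Psi_vanish)
  show "Psi 1 y' (- (of_int e * \<kappa>)) k v = 0" if "k > 0" for k v
    using that by (simp add: Psi_vanish)
  show "ser_mult ?P (Psi 1 y' (- (of_int e * \<kappa>))) = ser_one"
    by (rule Psi_inverse[OF _ y]) simp
  fix k j v
  have "?P k (X j v) = (\<Sum>b\<in>{0..- k}. coef ?g b *s X (j - b) (?P (k + b) v))"
    unfolding X lin_scale[OF lin_Psi] lin_add[OF lin_Psi] Psi_vertex_down[OF sg one(1) e y0]
      Psi_vertex_down[OF sg one(2) e y0] sum.distrib[symmetric] scale_sum_right
      scale_right_distrib[symmetric]
    by (intro sum.cong refl scale_left_commute)
  also have "\<dots> = Sum_any (\<lambda>b. coef ?g b *s X (j - b) (?P (k + b) v))"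
    by (rule Sum_any_supported[symmetric]) (auto simp: coef_def Psi_vanish lin_zero[OF linX] not_le)
  finally show "?P k (X j v) = Sum_any (\<lambda>b. coef ?g b *s X (j - b) (?P (k + b) v))" .
qed

lemma psi_conjugate_up:
  assumes sg: "sign \<epsilon>" and e: "sign e" and y: "y * y' = 1"
    and X: "\<And>k v. X k v = F *s (V \<epsilon> h 1 x k v + V \<epsilon> h (-1) x' k v)"
  shows "prod_zwz (Psi (-1) y' (- (of_int e * \<kappa>))) X (Psi (-1) y (of_int e * \<kappa>)) =
    smult2 scale (expand_zw (fps_const (y powi (- \<epsilon>)) * psi_factor (- (e * \<epsilon>)) (r powi h))) (in_w X)"
proof (rule conjugate_up)
  let ?P = "Psi (-1) y (of_int e * \<kappa>)"
  let ?g = "fps_const (y powi (- \<epsilon>)) * psi_factor (- (e * \<epsilon>)) (r powi h)"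
  have y0: "y \<noteq> 0" using y by auto
  have one: "sign 1" "sign (-1)" by simp_all
  show "lin (Psi (-1) y' (- (of_int e * \<kappa>)) k)" "lin (?P k)" for k by (rule lin_Psi)+
  show "?P k v = 0" if "k < 0" for k v using that by (simp add: Psi_vanish)
  show "Psi (-1) y' (- (of_int e * \<kappa>)) k v = 0" if "k < 0" for k v
    using that by (simp add: Psi_vanish)
  show "ser_mult (Psi (-1) y' (- (of_int e * \<kappa>))) ?P = ser_one"
    using Psi_inverse[of "-1" y' y "- (of_int e * \<kappa>)"] y by (simp add: mult.commute)
  fix k j v
  have "X j (?P k v) = (\<Sum>b\<in>{0..k}. coef ?g b *s ?P (k - b) (X (j + b) v))"
    unfolding X lin_scale[OF lin_Psi] lin_add[OF lin_Psi] Psi_vertex_up[OF sg one(1) e y0]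
      Psi_vertex_up[OF sg one(2) e y0] sum.distrib[symmetric] scale_sum_right
      scale_right_distrib[symmetric]
    by (intro sum.cong refl scale_left_commute)
  also have "\<dots> = Sum_any (\<lambda>b. coef ?g b *s ?P (k - b) (X (j + b) v))"
    by (rule Sum_any_supported[symmetric]) (auto simp: coef_def Psi_vanish not_le)
  finally show "X j (?P k v) = Sum_any (\<lambda>b. coef ?g b *s ?P (k - b) (X (j + b) v))" .
qed

lemma lin_u_quotient:
  assumes "\<alpha> \<noteq> 0" "\<alpha>' \<noteq> 0"
  shows "lin_u \<alpha> \<beta> / lin_u \<alpha>' \<beta>' =
    fps_const (\<alpha> / \<alpha>') * (lfac (- \<beta> / \<alpha>) * inverse (lfac (- \<beta>' / \<alpha>')))"
  unfolding lin_u_lfac[OF assms(1)] lin_u_lfac[OF assms(2)] by (rule fps_divide_lfac[OF assms(2)])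

text \<open>
  The four structure functions are \<open>psi_factor\<close> with exponent \<open>\<plusminus>1\<close>, up to the power of \<open>q\<close> that arises
  when \<open>q\<close> to the power \<open>\<plusminus>a\<^sub>0\<close> passes the charge shift of the current.
\<close>

lemma psi_X_relations:
  "prod_zwz (Psi 1 (inverse q) (- \<kappa>)) Xp (Psi 1 q \<kappa>) =
     smult2 scale (expand_wz (lin_u r q / lin_u (r * q) 1)) (in_w Xp)" (is ?R1)
  "prod_zwz (Psi (-1) q \<kappa>) Xp (Psi (-1) (inverse q) (- \<kappa>)) =
     smult2 scale (expand_zw (lin_u q (inverse r) / lin_u 1 (inverse r * q))) (in_w Xp)" (is ?R2)
  "prod_zwz (Psi 1 q \<kappa>) Xm (Psi 1 (inverse q) (- \<kappa>)) =
     smult2 scale (expand_wz (lin_u (inverse r) q / lin_u (inverse r * q) 1)) (in_w Xm)" (is ?R3)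
  "prod_zwz (Psi (-1) (inverse q) (- \<kappa>)) Xm (Psi (-1) q \<kappa>) =
     smult2 scale (expand_zw (lin_u q r / lin_u 1 (r * q))) (in_w Xm)" (is ?R4)
proof -
  have q: "q * inverse q = 1" "inverse q * q = 1" using q_nz by simp_all
  have rq: "r * r = q" using r_sq by (simp add: power2_eq_square)
  have f1: "lin_u r q / lin_u (r * q) 1 = fps_const (inverse q powi 1) * psi_factor (-1 * 1) (r powi (-1))"
    using r_nz q_nz unfolding psi_factor_def lfac_pow_def
    by (subst lin_u_quotient) (simp_all add: field_simps power_int_minus)
  have f2: "lin_u q (inverse r) / lin_u 1 (inverse r * q) =
      fps_const (inverse q powi (- 1)) * psi_factor (- (-1 * 1)) (r powi (-1))"
    using r_nz q_nz unfolding psi_factor_def lfac_pow_def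
    by (subst lin_u_quotient) (simp_all add: field_simps power_int_minus)
  have f3: "lin_u (inverse r) q / lin_u (inverse r * q) 1 =
      fps_const (q powi (-1)) * psi_factor (1 * -1) (r powi 1)"
    using r_nz q_nz unfolding psi_factor_def lfac_pow_def
    by (subst lin_u_quotient) (simp_all add: field_simps power_int_minus)
  have f4: "lin_u q r / lin_u 1 (r * q) = fps_const (q powi (- (-1))) * psi_factor (- (1 * -1)) (r powi 1)"
    using r_nz q_nz unfolding psi_factor_def lfac_pow_def
    by (subst lin_u_quotient) (simp_all add: field_simps power_int_minus)
  have Xp: "Xp k v = F_plus r *s (V 1 (-1) 1 r k v + V 1 (-1) (-1) (- inverse r) k v)" for k v
    by (rule X_plus_def)
  have Xm: "Xm k v = F_minus q *s (V (-1) 1 1 (- r) k v + V (-1) 1 (-1) (inverse r) k v)" for k v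
    by (rule X_minus_def)
  have e: "of_int (-1) * \<kappa> = - \<kappa>" "of_int 1 * \<kappa> = \<kappa>" "- (of_int (-1) * \<kappa>) = \<kappa>" "- (of_int 1 * \<kappa>) = - \<kappa>"
    by simp_all
  show ?R1
    using psi_conjugate_down[of 1 "-1" "inverse q" q Xp, OF _ _ q(2) Xp] unfolding e f1 by simp
  show ?R2
    using psi_conjugate_up[of 1 "-1" "inverse q" q Xp, OF _ _ q(2) Xp] unfolding e f2 by simp
  show ?R3
    using psi_conjugate_down[of "-1" 1 q "inverse q" Xm, OF _ _ q(1) Xm] unfolding e f3 by simp
  show ?R4
    using psi_conjugate_up[of "-1" 1 q "inverse q" Xm, OF _ _ q(1) Xm] unfolding e f4 by simp
qed

text \<open>
  The contraction has the logarithmic derivative \<open>-\<Sum>n. (-1)\<^sup>n (q\<^sup>n - q\<^sup>-\<^sup>n)\<^sup>2 u\<^sup>n\<close>; expanding the square gives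
  \<open>(1 + q\<^sup>2 u)(1 + q\<^sup>-\<^sup>2 u)/(1 + u)\<^sup>2\<close>.
\<close>

lemma psi_psi_relation:
  "prod_zw (Psi 1 q \<kappa>) (Psi (-1) (inverse q) (- \<kappa>)) =
    smult2 scale (expand_wz ((lin_u (r * q) (inverse r) * lin_u (inverse r) (r * q)) /
       (lin_u r (inverse r * q) * lin_u (inverse r * q) r))) (prod_wz (Psi (-1) (inverse q) (- \<kappa>)) (Psi 1 q \<kappa>))"
proof (intro ext)
  fix i j v
  let ?f = "(lfac_pow (- (q\<^sup>2)) 1 * lfac_pow (- inverse (q\<^sup>2)) 1) * (lfac_pow (-1) (-1) * lfac_pow (-1) (-1))"
  let ?A = "bexp 1 (\<lambda>_. \<kappa>) (\<lambda>_. 0)" and ?C = "bexp (-1) (\<lambda>_. - \<kappa>) (\<lambda>_. 0)"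
  have rq: "inverse r * q = r" using r_sq r_nz by (simp add: power2_eq_square field_simps)
  have f: "(lin_u (r * q) (inverse r) * lin_u (inverse r) (r * q)) /
       (lin_u r (inverse r * q) * lin_u (inverse r * q) r) = ?f"
  proof -
    have l: "lin_u (r * q) (inverse r) = fps_const (r * q) * lfac (- inverse (q\<^sup>2))"
      "lin_u (inverse r) (r * q) = fps_const (inverse r) * lfac (- (q\<^sup>2))"
      "lin_u r r = fps_const r * lfac (-1)"
      using r_nz q_nz by (subst lin_u_lfac; simp add: r_sq[symmetric] field_simps power2_eq_square)+
    have D: "lin_u r r * lin_u r r \<noteq> 0" unfolding l using r_nz lfac_nz by simp
    have "?f * (lin_u r r * lin_u r r) = (lfac (- (q\<^sup>2)) * lfac (- inverse (q\<^sup>2))) * (fps_const r * fps_const r) *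
        ((lfac (-1) * inverse (lfac (-1))) * (lfac (-1) * inverse (lfac (-1))))"
      unfolding l lfac_pow_def by (simp add: mult_ac)
    also have "\<dots> = lin_u (r * q) (inverse r) * lin_u (inverse r) (r * q)"
    proof -
      have "fps_const r * fps_const r = fps_const (r * q) * fps_const (inverse r)"
      proof -
        have "r * q * inverse r = q" using r_nz by (simp add: field_simps)
        moreover have "r * r = q" using r_sq by (simp add: power2_eq_square)
        ultimately show ?thesis by (simp only: fps_const_mult)
      qed
      then show ?thesis unfolding l lfac_inverse by (simp only: mult_ac mult_1_left)
    qed
    finally show ?thesis unfolding rq using D by (metis nonzero_mult_div_cancel_right)
  qed
  have "has_logder ?f ((- (of_int 1 * geo (- (q\<^sup>2))) + - (of_int 1 * geo (- inverse (q\<^sup>2)))) +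
      (- (of_int (-1) * geo (-1)) + - (of_int (-1) * geo (-1))))"
    by (intro has_logder_mult has_logder_lfac_pow) simp_all
  moreover have "(- (of_int 1 * geo (- (q\<^sup>2))) + - (of_int 1 * geo (- inverse (q\<^sup>2)))) +
      (- (of_int (-1) * geo (-1)) + - (of_int (-1) * geo (-1))) =
    Abs_fps (\<lambda>n. (\<kappa> * - \<kappa> * (-1) ^ n + 0 * 0) * (qint q (int n))\<^sup>2)"
  proof (rule fps_ext)
    fix n
    have "(\<kappa> * - \<kappa> * (-1) ^ n + 0 * 0) * (qint q (int n))\<^sup>2 = - ((-1) ^ n * (\<kappa> * qint q (int n))\<^sup>2)"
      by (simp add: power2_eq_square algebra_simps)
    also have "\<dots> = - ((-1) ^ n * (q ^ n - inverse q ^ n)\<^sup>2)" unfolding qint_mult ..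
    also have "\<dots> = - ((- (q\<^sup>2)) ^ n) - (- inverse (q\<^sup>2)) ^ n + 2 * (-1) ^ n"
    proof -
      have pow: "(- (q\<^sup>2)) ^ n = (-1) ^ n * (q ^ n)\<^sup>2" "(- inverse (q\<^sup>2)) ^ n = (-1) ^ n * (inverse q ^ n)\<^sup>2"
        by (subst power_minus, simp add: power_mult[symmetric] mult.commute power_inverse)+
      have "(q ^ n - inverse q ^ n)\<^sup>2 = (q ^ n)\<^sup>2 + (inverse q ^ n)\<^sup>2 - 2 * (q ^ n * inverse q ^ n)"
        by (simp add: power2_eq_square algebra_simps)
      also have "q ^ n * inverse q ^ n = 1" using q_nz by (simp flip: power_mult_distrib)
      finally have sq: "(q ^ n - inverse q ^ n)\<^sup>2 = (q ^ n)\<^sup>2 + (inverse q ^ n)\<^sup>2 - 2 * 1" .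
      show ?thesis unfolding pow sq by (simp add: algebra_simps)
    qed
    finally have R: "(\<kappa> * - \<kappa> * (-1) ^ n + 0 * 0) * (qint q (int n))\<^sup>2 =
      - ((- (q\<^sup>2)) ^ n) - (- inverse (q\<^sup>2)) ^ n + 2 * (-1) ^ n" .
    show "fps_nth ((- (of_int 1 * geo (- (q\<^sup>2))) + - (of_int 1 * geo (- inverse (q\<^sup>2)))) +
      (- (of_int (-1) * geo (-1)) + - (of_int (-1) * geo (-1)))) n =
      fps_nth (Abs_fps (\<lambda>n. (\<kappa> * - \<kappa> * (-1) ^ n + 0 * 0) * (qint q (int n))\<^sup>2)) n"
      unfolding fps_add_nth fps_neg_nth fps_of_int_nth fps_nth_Abs_fps R geo_def by simp
  qed
  ultimately have re: "?A m (?C n w) = (\<Sum>k\<in>{0..min m n}. fps_nth ?f (nat k) *s ?C (n - k) (?A (m - k) w))" for m n w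
    by (intro bexp_reorder) (simp_all only: has_logder_def)
  have d: "(1::int) \<noteq> 0" "(-1::int) \<noteq> 0" by simp_all
  have "prod_zw (Psi 1 q \<kappa>) (Psi (-1) (inverse q) (- \<kappa>)) i j v = ?A (- i) (?C j v)"
    unfolding prod_zw_def Psi_Psi[OF d] using q_nz by (simp add: A0.op_powi_one)
  also have "\<dots> = (\<Sum>k\<in>{0..min (- i) j}. coef ?f k *s ?C (j - k) (?A (- i - k) v))"
    unfolding re by (rule sum.cong) (auto simp: coef_def)
  also have "\<dots> = Sum_any (\<lambda>k. coef ?f k *s ?C (j - k) (?A (- i - k) v))"
    by (rule Sum_any_supported[symmetric]) (auto simp: coef_def bexp_neg bexp_simps not_le min_less_iff_disj)
  also have "\<dots> = Sum_any (\<lambda>k. (\<lambda>(k, l). expand_wz ?f k l *s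
      prod_wz (Psi (-1) (inverse q) (- \<kappa>)) (Psi 1 q \<kappa>) (i - k) (j - l) v) (- k, k))"
  proof (rule arg_cong[where f = Sum_any], rule ext)
    fix k
    have *: "- (-1) * (j - k) = j - k" "- 1 * (i - - k) = - i - k" by simp_all
    have "prod_wz (Psi (-1) (inverse q) (- \<kappa>)) (Psi 1 q \<kappa>) (i - - k) (j - k) v = ?C (j - k) (?A (- i - k) v)"
      unfolding prod_wz_def Psi_Psi[OF d(2,1)] * using q_nz by (simp add: A0.op_powi_one)
    then show "coef ?f k *s ?C (j - k) (?A (- i - k) v) = (\<lambda>(k, l). expand_wz ?f k l *s
      prod_wz (Psi (-1) (inverse q) (- \<kappa>)) (Psi 1 q \<kappa>) (i - k) (j - l) v) (- k, k)"
      by (simp add: expand_wz_def coef_def)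
  qed
  also have "\<dots> = Sum_any (\<lambda>(k, l). expand_wz ?f k l *s
      prod_wz (Psi (-1) (inverse q) (- \<kappa>)) (Psi 1 q \<kappa>) (i - k) (j - l) v)"
  proof (rule Sum_any_inj[symmetric])
    show "inj (\<lambda>k::int. (- k, k))" by (rule injI) simp
    fix z :: "int \<times> int" assume "z \<notin> range (\<lambda>k. (- k, k))"
    then have "fst z + snd z \<noteq> 0" by (cases z) (auto simp: image_iff add_eq_0_iff2)
    then show "(\<lambda>(k, l). expand_wz ?f k l *s
      prod_wz (Psi (-1) (inverse q) (- \<kappa>)) (Psi 1 q \<kappa>) (i - k) (j - l) v) z = 0"
      by (simp add: case_prod_unfold expand_wz_def)
  qed
  finally show "prod_zw (Psi 1 q \<kappa>) (Psi (-1) (inverse q) (- \<kappa>)) i j v =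
    smult2 scale (expand_wz ((lin_u (r * q) (inverse r) * lin_u (inverse r) (r * q)) /
       (lin_u r (inverse r * q) * lin_u (inverse r * q) r)))
      (prod_wz (Psi (-1) (inverse q) (- \<kappa>)) (Psi 1 q \<kappa>)) i j v"
    unfolding f by (simp only: smult2_def)
qed

end

section \<open>The anticommutator of \<open>X\<^sup>+\<close> and \<open>X\<^sup>-\<close>\<close>

context osp_bosons
begin

lemma nord_trivial_annihilator:
  assumes "\<And>i v. A i v = (if i = 0 then v else 0)" "creator C"
  shows "nord C A d v = C d v"
  unfolding nord_def
  by (subst Sum_any_single[of d]) (auto simp: assms(1) lin_zero[OF creatorD(1)[OF assms(2)]])

lemma nord_trivial_creator:
  assumes "\<And>i v. C i v = (if i = 0 then v else 0)"
  shows "nord C A d v = A (- d) v"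
  unfolding nord_def by (subst Sum_any_single[of 0]) (auto simp: assms)

lemma r_inverse_q: "inverse q * r = inverse r" "q * inverse r = r"
  using r_nz r_sq by (auto simp: power2_eq_square field_simps)

lemma r_power_q: "q ^ n = r ^ n * r ^ n"
  by (simp add: power_mult_distrib[symmetric] r_sq[symmetric] power2_eq_square)

text \<open>
  The two pairs of summands of \<open>X\<^sup>+(z)\<close> and \<open>X\<^sup>-(w)\<close> with opposite charges of \<open>c\<close>, which contribute the
  delta functions at \<open>w = q z\<close> and at \<open>w = z/q\<close>.
\<close>

abbreviation wickA :: "(int \<Rightarrow> complex) \<Rightarrow> int \<Rightarrow> int \<Rightarrow> 'v \<Rightarrow> 'v" where
  "wickA S \<equiv> wick S (cr 1 (-1) 1 r) (cr (-1) 1 (-1) (inverse r)) (an 1 (-1) 1 r) (an (-1) 1 (-1) (inverse r))"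

abbreviation wickB :: "(int \<Rightarrow> complex) \<Rightarrow> int \<Rightarrow> int \<Rightarrow> 'v \<Rightarrow> 'v" where
  "wickB S \<equiv> wick S (cr 1 (-1) (-1) (- inverse r)) (cr (-1) 1 1 (- r)) (an 1 (-1) (-1) (- inverse r)) (an (-1) 1 1 (- r))"

text \<open>
  At \<open>z = w/q\<close> the annihilation operators and all oscillators \<open>c\<close> cancel, and the exponents of the
  remaining \<open>a\<^sub>-\<^sub>n\<close> add up to \<open>-(q - q\<^sup>-\<^sup>1) r\<^sup>-\<^sup>n\<close>, that is, to \<open>\<psi>\<^sup>-\<close> at \<open>w/r = r z\<close>.
\<close>

lemma fuse_minus:
  "wickA (\<lambda>k. inverse q powi k) D E v =
    (inverse q powi (- D) * inverse r powi (D + E)) *s bexp (-1) (\<lambda>_. - \<kappa>) (\<lambda>_. 0) (D + E) v"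
proof -
  have qr: "q ^ n = r ^ n * r ^ n" "q ^ n \<noteq> 0" "r ^ n \<noteq> 0" for n using q_nz r_nz by (simp_all add: r_power_q)
  have "- \<kappa> * qint q (int n) = inverse q ^ n - q ^ n" for n
    using qint_mult[of n] by (simp add: algebra_simps)
  then have \<kappa>: "- \<kappa> = (inverse q ^ n - q ^ n) / qint q (int n)" if "n > 0" for n
    using qint_nz[OF that] by (simp add: eq_divide_eq)
  have A: "bexp 1 (\<lambda>n. inverse (inverse q) ^ n * - (of_int 1 * r powi (-1 * int n) / qint q (int n)) +
        - (of_int (-1) * r powi (1 * int n) / qint q (int n)))
      (\<lambda>n. inverse (inverse q) ^ n * - (of_int 1 * r powi (- int n) / qint q (int n)) +
        - (of_int (-1) * inverse r powi (- int n) / qint q (int n))) i w = (if i = 0 then w else 0)" for i w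
    by (rule bexp_trivial) (use r_nz in \<open>simp_all add: power_int_minus qr(1) power_inverse field_simps\<close>)
  have C: "bexp (-1) (\<lambda>n. inverse q ^ n * - (of_int 1 * r powi (-1 * int n) / qint q (- int n)) +
        - (of_int (-1) * r powi (1 * int n) / qint q (- int n)))
      (\<lambda>n. inverse q ^ n * - (of_int 1 * r powi int n / qint q (- int n)) +
        - (of_int (-1) * inverse r powi int n / qint q (- int n))) i w =
      bexp (-1) (\<lambda>n. inverse r ^ n * - \<kappa>) (\<lambda>n. inverse r ^ n * 0) i w" for i w
  proof (rule bexp_cong)
    fix n :: nat assume n: "n > 0"
    show "inverse q ^ n * - (of_int 1 * r powi (-1 * int n) / qint q (- int n)) +
        - (of_int (-1) * r powi (1 * int n) / qint q (- int n)) = inverse r ^ n * - \<kappa>"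
      unfolding \<kappa>[OF n] qint_minus using qint_nz[OF n] r_nz
      by (simp add: power_int_minus qr(1) power_inverse field_simps)
    show "inverse q ^ n * - (of_int 1 * r powi int n / qint q (- int n)) +
        - (of_int (-1) * inverse r powi int n / qint q (- int n)) = inverse r ^ n * 0"
      unfolding qint_minus using qint_nz[OF n] r_nz
      by (simp add: power_int_minus qr(1) power_inverse field_simps)
  qed simp
  have iq: "inverse q \<noteq> 0" and d: "(-1::int) \<noteq> 0" using q_nz by simp_all
  show ?thesis
    unfolding cr_def an_def wick_delta[OF iq] nord_trivial_annihilator[OF A creatorI] C bexp_dilate[OF d] scale_scale ..
qed

text \<open>
  At \<open>z = q w\<close> the creation operators and all oscillators \<open>c\<close> cancel, leaving \<open>\<psi>\<^sup>+\<close> at \<open>r w\<close>.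
\<close>

lemma fuse_plus:
  "wickB (\<lambda>k. q powi k) D E v =
    (q powi (- D) * r powi (D + E)) *s bexp 1 (\<lambda>_. \<kappa>) (\<lambda>_. 0) (- (D + E)) v"
proof -
  have qr: "q ^ n = r ^ n * r ^ n" "q ^ n \<noteq> 0" "r ^ n \<noteq> 0" for n using q_nz r_nz by (simp_all add: r_power_q)
  have \<kappa>: "\<kappa> = (q ^ n - inverse q ^ n) / qint q (int n)" if "n > 0" for n
    using qint_nz[OF that] qint_mult[of n] by (simp add: eq_divide_eq)
  have neg: "(- inverse r) powi (int n) = (-1) ^ n * inverse r ^ n"
    "(- r) powi (int n) = (-1) ^ n * r ^ n" for n
    by (simp_all, (subst power_minus, simp)+)
  have inv1: "inverse ((-1) ^ n) = ((-1) ^ n :: complex)" for n by (simp flip: power_inverse)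
  have C: "bexp (-1) (\<lambda>n. q ^ n * - (of_int 1 * r powi (-1 * int n) / qint q (- int n)) +
        - (of_int (-1) * r powi (1 * int n) / qint q (- int n)))
      (\<lambda>n. q ^ n * - (of_int (-1) * (- inverse r) powi int n / qint q (- int n)) +
        - (of_int 1 * (- r) powi int n / qint q (- int n))) i w = (if i = 0 then w else 0)" for i w
    unfolding neg
    by (rule bexp_trivial) (use r_nz in \<open>simp_all add: power_int_minus qr(1) power_inverse field_simps\<close>)
  have A: "bexp 1 (\<lambda>n. inverse q ^ n * - (of_int 1 * r powi (-1 * int n) / qint q (int n)) +
        - (of_int (-1) * r powi (1 * int n) / qint q (int n)))
      (\<lambda>n. inverse q ^ n * - (of_int (-1) * (- inverse r) powi (- int n) / qint q (int n)) +
        - (of_int 1 * (- r) powi (- int n) / qint q (int n))) i w =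
      bexp 1 (\<lambda>n. inverse r ^ n * \<kappa>) (\<lambda>n. inverse r ^ n * 0) i w" for i w
  proof (rule bexp_cong)
    fix n :: nat assume n: "n > 0"
    show "inverse q ^ n * - (of_int 1 * r powi (-1 * int n) / qint q (int n)) +
        - (of_int (-1) * r powi (1 * int n) / qint q (int n)) = inverse r ^ n * \<kappa>"
      unfolding \<kappa>[OF n] using qint_nz[OF n] r_nz
      by (simp add: power_int_minus qr(1) power_inverse field_simps)
    show "inverse q ^ n * - (of_int (-1) * (- inverse r) powi (- int n) / qint q (int n)) +
        - (of_int 1 * (- r) powi (- int n) / qint q (int n)) = inverse r ^ n * 0"
      unfolding power_int_minus neg using qint_nz[OF n] r_nz
      by (simp add: inv1 qr(1) power_inverse field_simps)
  qed simp
  have d: "(1::int) \<noteq> 0" by simp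
  have "inverse r powi (- (D + E)) = r powi (D + E)"
    unfolding power_int_inverse power_int_minus by simp
  then show ?thesis
    unfolding cr_def an_def wick_delta[OF q_nz] nord_trivial_creator[OF C] A bexp_dilate[OF d]
    by (simp only: scale_scale)
qed

text \<open>
  At \<open>w = -z\<close> both pairs become \<open>:exp (a(z; -1/2) - a(-z; 1/2) + c(rz) - c(-z/r)):\<close>. The parity condition
  makes the signs \<open>(-1)\<^sup>D\<close> of the delta functions agree.
\<close>

lemma fuse_minus_one:
  assumes "D + E = D' + E'" "even (D - D')"
  shows "wickA (\<lambda>k. (-1) powi k) D E v =
    wickB (\<lambda>k. (-1) powi k) D' E' v"
proof -
  have neg: "(- inverse r) powi (int n) = (-1) ^ n * inverse r ^ n"
    "(- r) powi (int n) = (-1) ^ n * r ^ n" for n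
    by (simp_all, (subst power_minus, simp)+)
  have inv1: "inverse ((-1) ^ n) = ((-1) ^ n :: complex)" "((-1) ^ n * ((-1) ^ n * y)) = (y :: complex)" for n y
    by (simp_all flip: power_inverse mult.assoc power_mult_distrib)
  have C: "(\<lambda>n. (-1) ^ n * - (of_int 1 * r powi int n / qint q (- int n)) +
        - (of_int (-1) * inverse r powi int n / qint q (- int n))) =
      (\<lambda>n. (-1) ^ n * - (of_int (-1) * (- inverse r) powi int n / qint q (- int n)) +
        - (of_int 1 * (- r) powi int n / qint q (- int n)))"
    unfolding neg by (rule ext) (simp add: inv1 divide_inverse mult.assoc)
  have A: "(\<lambda>n. inverse (-1) ^ n * - (of_int 1 * r powi (- int n) / qint q (int n)) +
        - (of_int (-1) * inverse r powi (- int n) / qint q (int n))) =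
      (\<lambda>n. inverse (-1) ^ n * - (of_int (-1) * (- inverse r) powi (- int n) / qint q (int n)) +
        - (of_int 1 * (- r) powi (- int n) / qint q (int n)))"
    unfolding power_int_minus neg by (rule ext) (simp add: inv1 divide_inverse mult.assoc)
  have "(-1) powi (- D) = ((-1) powi (- D') :: complex)"
  proof -
    obtain k where "D = D' + 2 * k" using assms(2) by (elim evenE) (simp add: algebra_simps)
    then have "(-1) powi D = ((-1) powi D' :: complex)" by (simp add: power_int_add power_int_mult)
    then show ?thesis unfolding power_int_minus by simp
  qed
  moreover have "(-1::complex) \<noteq> 0" by simp
  note wick_delta[OF this]
  ultimately show ?thesis
    unfolding cr_def an_def by (simp only: C A assms(1))
qed

text \<open>
  Of the four pairs of summands, \<open>vertex_anticommute\<close> removes two. For the other two, the delta functions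
  at \<open>w = -z\<close> cancel, and those at \<open>w = z/q\<close> and \<open>w = q z\<close> give \<open>\<psi>\<^sup>+\<close> and \<open>\<psi>\<^sup>-\<close>; the constants combine by
  \<open>r (r + r\<^sup>-\<^sup>1) = 1 + q\<close>.
\<close>

lemma Xp_Xm:
  "prod_zw Xp Xm i j v + prod_wz Xm Xp i j v =
    (1 / \<kappa>) *s (smult2 scale (delta_wz (r\<^sup>2)) (in_w (dilate scale r (Psi 1 q \<kappa>))) (i + 1) (j + 1) v
      - smult2 scale (delta_wz (inverse (r\<^sup>2))) (in_z (dilate scale r (Psi (-1) (inverse q) (- \<kappa>)))) (i + 1) (j + 1) v)"
proof -
  let ?P = "Psi 1 q \<kappa>" and ?M = "Psi (-1) (inverse q) (- \<kappa>)"
  let ?n = "i + 1 + (j + 1)"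
  have "Xp i (Xm j v) + Xm j (Xp i v) = (1 / \<kappa>) *s (q powi (- (i + 1)) *s r powi ?n *s ?P ?n v -
      inverse q powi (j + 1) *s r powi ?n *s ?M ?n v)" (is "?L v = ?R v")
  proof (rule linear_eq_on_charged[where f = ?L and g = ?R])
    show "lin ?L"
      by (rule lin_plus[OF lin_comp[OF lin_X] lin_comp[OF lin_X(2,1)]])
    show "lin ?R"
      by (intro lin_smult lin_minus lin_Psi)
    fix m l v assume ch: "charged m l v"
    let ?U = "V 1 (-1) 1 r" and ?W = "V 1 (-1) (-1) (- inverse r)"
      and ?S = "V (-1) 1 1 (- r)" and ?T = "V (-1) 1 (-1) (inverse r)"
    let ?A = "bexp 1 (\<lambda>_. \<kappa>) (\<lambda>_. 0) (- ?n) v" and ?C = "bexp (-1) (\<lambda>_. - \<kappa>) (\<lambda>_. 0) ?n v"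
    have q1: "1 + q \<noteq> 0"
    proof
      assume "1 + q = 0"
      then have "q = -1" by (metis add.commute eq_neg_iff_add_eq_0)
      then have "q ^ 2 = 1" by simp
      with generic[of 2] show False by simp
    qed
    then have qm: "q \<noteq> -1" "inverse q \<noteq> -1"
      by (metis add.right_inverse, metis add.right_inverse inverse_inverse_eq inverse_minus_eq inverse_1)
    have rr: "r * r = q" using r_sq by (simp add: power2_eq_square)
    have US: "?U i (?S j v) + ?S j (?U i v) = 0" and WT: "?W i (?T j v) + ?T j (?W i v) = 0"
      using r_nz by (auto intro!: vertex_anticommute ch)
    \<comment> \<open>the contribution of the delta function at \<open>w = -z\<close>, common to both pairs\<close>
    let ?w1 = "wickA (\<lambda>k. (-1) powi k) (i - m - l + 2) (j + m + l) v"
    have "?U i (?T j v) + ?T j (?U i v) = (inverse q powi (- 1 * l) / (r * (1 + inverse q))) *s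
        (?w1 + inverse q *s (inverse q powi (- (i - m - l + 2)) * inverse r powi ?n) *s ?C)"
    proof -
      have x: "inverse r = inverse q * r" using r_inverse_q(1) by simp
      have n: "i - m - l + 2 + (j + m + l) = ?n" by simp
      show ?thesis
        using vertex_anticommutator[of 1 1 "-1" "-1" r "inverse r" 1 "-1" "inverse q" m l v i j]
          fuse_minus[of "i - m - l + 2" "j + m + l" v] q_nz r_nz qm(2) x ch
        unfolding n by simp
    qed
    moreover have "?W i (?S j v) + ?S j (?W i v) = (q powi l / (- inverse r * (1 + q))) *s
        (?w1 + q *s (q powi (- (i - m + l + 2)) * r powi ?n) *s ?A)"
    proof -
      have x: "- r = q * - inverse r" using r_inverse_q(2) by simp
      have n: "i - m + l + 2 + (j + m - l) = ?n" by simp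
      have w: "?w1 = wickB (\<lambda>k. (-1) powi k) (i - m + l + 2) (j + m - l) v"
        by (rule fuse_minus_one) auto
      show ?thesis
        using vertex_anticommutator[of 1 "-1" "-1" 1 "- inverse r" "- r" 1 "-1" q m l v i j]
          fuse_plus[of "i - m + l + 2" "j + m - l" v] q_nz r_nz qm(1) x ch
        unfolding n w by simp
    qed
    ultimately have sum: "Xp i (Xm j v) + Xm j (Xp i v) = (F_plus r * F_minus q) *s
       ((inverse q powi (- 1 * l) / (r * (1 + inverse q))) *s
        (?w1 + inverse q *s (inverse q powi (- (i - m - l + 2)) * inverse r powi ?n) *s ?C)
       + (q powi l / (- inverse r * (1 + q))) *s
        (?w1 + q *s (q powi (- (i - m + l + 2)) * r powi ?n) *s ?A))" (is "_ = _ *s (?x + ?y)")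
    proof -
      assume 1: "?U i (?T j v) + ?T j (?U i v) = ?x" and 2: "?W i (?S j v) + ?S j (?W i v) = ?y"
      have lV: "sign \<epsilon> \<Longrightarrow> sign \<eta> \<Longrightarrow> V \<epsilon> h \<eta> x k (u + w) = V \<epsilon> h \<eta> x k u + V \<epsilon> h \<eta> x k w"
        "sign \<epsilon> \<Longrightarrow> sign \<eta> \<Longrightarrow> V \<epsilon> h \<eta> x k (s *s u) = s *s V \<epsilon> h \<eta> x k u" for \<epsilon> h \<eta> x k u w s
        by (simp_all add: lin_add[OF lin_vertex] lin_scale[OF lin_vertex])
      have "Xp i (Xm j v) + Xm j (Xp i v) = (F_plus r * F_minus q) *s
        ((?U i (?S j v) + ?S j (?U i v)) + (?W i (?T j v) + ?T j (?W i v)) +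
         ((?U i (?T j v) + ?T j (?U i v)) + (?W i (?S j v) + ?S j (?W i v))))"
        unfolding X_plus_def X_minus_def
        by (simp add: lV scale_right_distrib mult.commute add_ac)
      then show ?thesis unfolding US WT 1 2 by simp
    qed
    have F: "F_plus r * r = 1 + q"
      unfolding F_plus_def using r_nz by (simp_all add: distrib_right rr field_simps)
    have "inverse q powi (- 1 * l) / (r * (1 + inverse q)) = q powi l * r / (1 + q)"
    proof -
      have "r * (1 + inverse q) = inverse q * r + q * inverse r"
        unfolding r_inverse_q(2) by (simp add: distrib_left mult.commute)
      also have "\<dots> = inverse r * (1 + q)"
        unfolding r_inverse_q(1) by (simp add: distrib_left mult.commute)
      finally have eq: "r * (1 + inverse q) = inverse r * (1 + q)" .
      show ?thesis
        unfolding eq using q1 r_nz by (simp add: power_int_inverse power_int_minus field_simps)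
    qed
    moreover have "q powi l / (- inverse r * (1 + q)) = - (q powi l * r / (1 + q))"
      using q1 r_nz by (simp add: field_simps)
    \<comment> \<open>opposite coefficients of the two pairs eliminate \<open>?w1\<close>\<close>
    moreover have "K *s (z *s (w + y *s s *s u) + (- z) *s (w + y' *s s' *s u')) =
        (K * z) *s ((y * s) *s u - (y' * s') *s u')" for K z y s y' s' w u u'
      by (simp add: scale_right_distrib scale_right_diff_distrib mult.assoc)
    ultimately have "Xp i (Xm j v) + Xm j (Xp i v) = (F_plus r * F_minus q * (q powi l * r / (1 + q))) *s
       ((inverse q * (inverse q powi (- (i - m - l + 2)) * inverse r powi ?n)) *s ?C
        - (q * (q powi (- (i - m + l + 2)) * r powi ?n)) *s ?A)"
      unfolding sum by (simp only:)
    also have "F_plus r * F_minus q * (q powi l * r / (1 + q)) = - (q powi l / \<kappa>)"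
    proof -
      have "F_plus r * F_minus q * (q powi l * r / (1 + q)) = - ((F_plus r * r) / (1 + q) * (q powi l / \<kappa>))"
        unfolding F_minus_def divide_inverse by (simp only: mult_ac mult_minus_left mult_minus_right mult_1_left)
      then show ?thesis unfolding F using q1 by simp
    qed
    also have "- (q powi l / \<kappa>) *s ((inverse q * (inverse q powi (- (i - m - l + 2)) * inverse r powi ?n)) *s ?C
        - (q * (q powi (- (i - m + l + 2)) * r powi ?n)) *s ?A) =
      (1 / \<kappa>) *s ((q powi l * (q * (q powi (- (i - m + l + 2)) * r powi ?n))) *s ?A -
        (q powi l * (inverse q * (inverse q powi (- (i - m - l + 2)) * inverse r powi ?n))) *s ?C)"
      by (simp add: scale_right_diff_distrib)
    also have "q powi l * (q * (q powi (- (i - m + l + 2)) * r powi ?n)) = q powi (- (i + 1)) * r powi ?n * q powi m"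
    proof -
      have "q powi l * q * q powi (- (i - m + l + 2)) = q powi (l + 1 + - (i - m + l + 2))"
        by (simp only: power_int_add[OF disjI1[OF q_nz]] power_int_1_right)
      also have "l + 1 + - (i - m + l + 2) = - (i + 1) + m" by simp
      finally have e: "q powi l * q * q powi (- (i - m + l + 2)) = q powi (- (i + 1)) * q powi m"
        by (simp only: power_int_add[OF disjI1[OF q_nz]])
      have "q powi l * (q * (q powi (- (i - m + l + 2)) * r powi ?n)) =
          (q powi l * q * q powi (- (i - m + l + 2))) * r powi ?n"
        by (simp only: mult.assoc)
      then show ?thesis unfolding e by (simp only: mult_ac)
    qed
    also have "q powi l * (inverse q * (inverse q powi (- (i - m - l + 2)) * inverse r powi ?n)) =
        inverse q powi (j + 1) * r powi ?n * inverse q powi m"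
    proof -
      have iq: "inverse q \<noteq> 0" using q_nz by simp
      have "q powi l = inverse q powi (- l)" by (simp add: power_int_inverse power_int_minus)
      moreover have "inverse r powi ?n = inverse q powi ?n * r powi ?n"
      proof -
        have "inverse r = inverse q * r" using r_inverse_q(1) by simp
        then show ?thesis by (simp only: power_int_mult_distrib)
      qed
      ultimately have "q powi l * (inverse q * (inverse q powi (- (i - m - l + 2)) * inverse r powi ?n)) =
          (inverse q powi (- l) * inverse q * inverse q powi (- (i - m - l + 2)) * inverse q powi ?n) * r powi ?n"
        by (simp only: mult.assoc)
      also have "inverse q powi (- l) * inverse q * inverse q powi (- (i - m - l + 2)) * inverse q powi ?n =
          inverse q powi (- l + 1 + - (i - m - l + 2) + ?n)"
        by (simp only: power_int_add[OF disjI1[OF iq]] power_int_1_right)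
      also have "- l + 1 + - (i - m - l + 2) + ?n = (j + 1) + m" by simp
      finally show ?thesis unfolding power_int_add[OF disjI1[OF iq], of "j + 1" m] by (simp only: mult_ac)
    qed
    finally show "Xp i (Xm j v) + Xm j (Xp i v) = (1 / \<kappa>) *s (q powi (- (i + 1)) *s r powi ?n *s ?P ?n v -
        inverse q powi (j + 1) *s r powi ?n *s ?M ?n v)"
      using Psi_charged[OF one_neq_zero ch, of q \<kappa> ?n] Psi_charged[of "-1" m l v "inverse q" "- \<kappa>" ?n] ch
      by (simp add: mult.assoc)
  qed
  then show ?thesis
    unfolding prod_zw_def prod_wz_def smult2_delta_in_w smult2_delta_in_z dilate_def r_sq .
qed

end

section \<open>The realization\<close>

context osp_bosons
begin

text \<open>
  The currents \<open>X\<^sup>\<plusminus>\<close> change the eigenvalue of \<open>a\<^sub>0\<close> by \<open>\<plusminus>1\<close>, so its parity grades the space.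
\<close>

definition parity :: "'v \<Rightarrow> 'v" where
  "parity = op_powi scale (-1) (a 0)"

lemma parity_charged: "charged m l v \<Longrightarrow> parity v = (-1) powi m *s v"
  unfolding parity_def by (rule op_powi_charged)

lemma lin_parity: "lin parity"
  unfolding parity_def by (rule A0.lin_op_powi)

lemma parity_vertex:
  assumes "sign \<epsilon>" "sign \<eta>"
  shows "V \<epsilon> h \<eta> x k (parity v) = - parity (V \<epsilon> h \<eta> x k v)"
proof (induction v rule: charged_induct)
  case (charged m l v)
  have "(-1) powi (m + \<epsilon>) = - ((-1) powi m :: complex)" using assms(1) by (auto simp: power_int_add power_int_diff)
  then show ?case
    by (simp add: parity_charged[OF charged] parity_charged[OF charged_vertex[OF assms charged]]
      lin_scale[OF lin_vertex[OF assms]])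
qed (simp add: lin_add[OF lin_parity] lin_add[OF lin_vertex[OF assms]])

theorem drinfeld_relations:
  "drinfeld_osp22 scale q r parity (psi_plus scale q a) (psi_minus scale q a) Xp Xm"
  unfolding drinfeld_osp22_def psi_plus_Psi psi_minus_Psi
proof (intro conjI allI)
  have inv: "q * inverse q = 1" "inverse q * q = 1" using q_nz by simp_all
  show "vector_space scale" by (rule vector_space_axioms)
  show "lin parity" by (rule lin_parity)
  show "parity \<circ> parity = id"
    by (simp add: fun_eq_iff parity_def A0.op_powi_mult A0.op_powi_one)
  show "lin (Xp k)" "lin (Xm k)" for k by (rule lin_X)+
  show "Psi 1 q \<kappa> k (parity v) = parity (Psi 1 q \<kappa> k v)"
    "Psi (-1) (inverse q) (- \<kappa>) k (parity v) = parity (Psi (-1) (inverse q) (- \<kappa>) k v)" for k v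
    unfolding parity_def Psi_def A0.op_powi_mult
    by (simp_all add: op_powi_bexp[symmetric] A0.op_powi_mult mult.commute)
  show "Xp k (parity v) = - parity (Xp k v)" "Xm k (parity v) = - parity (Xm k v)" for k v
    by (simp_all add: X_plus_def X_minus_def parity_vertex lin_scale[OF lin_parity] lin_add[OF lin_parity]
      scale_right_distrib scale_right_diff_distrib)
  show "psi_form scale q (Psi 1 q \<kappa>) (Psi (-1) (inverse q) (- \<kappa>))"
    unfolding psi_form_def
  proof (intro exI conjI allI impI)
    let ?K = "op_powi scale q (a 0)" and ?K' = "op_powi scale (inverse q) (a 0)"
    have KK: "?K (?K' v) = v" "?K' (?K v) = v" for v
      unfolding A0.op_powi_mult inv by (rule A0.op_powi_one)+
    show "bij ?K" by (rule o_bij[of ?K']) (simp_all add: fun_eq_iff KK)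
    have invK: "inv ?K = ?K'" by (rule inv_equality) (simp_all add: KK)
    show "Psi (-1) (inverse q) (- \<kappa>) k v =
      inv ?K (ser_up (op_exp scale (\<lambda>n v. (- \<kappa>) *s a (- int n) v)) k v)" for k v
      unfolding invK psi_minus_Psi[symmetric] psi_minus_def ..
    show "Psi 1 q \<kappa> k v = ?K (ser_down (op_exp scale (\<lambda>n v. \<kappa> *s a (int n) v)) k v)" for k v
      unfolding psi_plus_Psi[symmetric] psi_plus_def ..
    show "lin ?K" by (rule A0.lin_op_powi)
    show "lin (a n)" for n by (rule linear_a)
  qed
  show "prod_zw (Psi 1 q \<kappa>) (Psi 1 q \<kappa>) = prod_wz (Psi 1 q \<kappa>) (Psi 1 q \<kappa>)"
    "prod_zw (Psi (-1) (inverse q) (- \<kappa>)) (Psi (-1) (inverse q) (- \<kappa>)) =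
     prod_wz (Psi (-1) (inverse q) (- \<kappa>)) (Psi (-1) (inverse q) (- \<kappa>))"
    unfolding prod_zw_def[abs_def] prod_wz_def[abs_def] by (intro ext Psi_commute; simp)+
  show "\<exists>ipsip ipsim.
        (\<forall>k v. k > 0 \<longrightarrow> ipsip k v = 0) \<and> ser_inverse (Psi 1 q \<kappa>) ipsip \<and>
        (\<forall>k v. k < 0 \<longrightarrow> ipsim k v = 0) \<and> ser_inverse (Psi (-1) (inverse q) (- \<kappa>)) ipsim \<and>
        prod_zwz ipsip Xp (Psi 1 q \<kappa>) =
          smult2 scale (expand_wz (lin_u r q / lin_u (r * q) 1)) (in_w Xp) \<and>
        prod_zwz ipsim Xp (Psi (-1) (inverse q) (- \<kappa>)) =
          smult2 scale (expand_zw (lin_u q (inverse r) / lin_u 1 (inverse r * q))) (in_w Xp) \<and>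
        prod_zwz (Psi 1 q \<kappa>) Xm ipsip =
          smult2 scale (expand_wz (lin_u (inverse r) q / lin_u (inverse r * q) 1)) (in_w Xm) \<and>
        prod_zwz (Psi (-1) (inverse q) (- \<kappa>)) Xm ipsim =
          smult2 scale (expand_zw (lin_u q r / lin_u 1 (r * q))) (in_w Xm)"
  proof (rule exI[of _ "Psi 1 (inverse q) (- \<kappa>)"], rule exI[of _ "Psi (-1) q \<kappa>"],
      intro conjI allI impI psi_X_relations)
    show "ser_inverse (Psi 1 q \<kappa>) (Psi 1 (inverse q) (- \<kappa>))"
      unfolding ser_inverse_def
      using Psi_inverse[of 1 q "inverse q" \<kappa>] Psi_inverse[of 1 "inverse q" q "- \<kappa>"] inv by simp
    show "ser_inverse (Psi (-1) (inverse q) (- \<kappa>)) (Psi (-1) q \<kappa>)"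
      unfolding ser_inverse_def
      using Psi_inverse[of "-1" q "inverse q" \<kappa>] Psi_inverse[of "-1" "inverse q" q "- \<kappa>"] inv by simp
  qed (simp_all add: Psi_vanish)
qed (rule psi_psi_relation Xp_Xp Xm_Xm Xp_Xm)+

end

section \<open>The absence of a classical limit\<close>

context osp_bosons
begin

lemma charged_vertex_vacuum:
  assumes sgn: "sign \<epsilon>" "sign \<eta>" and ch: "charged 0 0 v"
    and vac: "\<And>n. n > 0 \<Longrightarrow> a n v = 0" "\<And>n. n > 0 \<Longrightarrow> c n v = 0"
  shows "V \<epsilon> h \<eta> x 0 v = shift \<epsilon> \<eta> v"
proof -
  have "an \<epsilon> h \<eta> x i v = (if i = 0 then v else 0)" for i
    unfolding an_def by (rule bexp_kill) (simp_all add: bmode_def vac)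
  then have "nord (cr \<epsilon> h \<eta> x) (an \<epsilon> h \<eta> x) 0 v = v"
    unfolding nord_def
    by (subst Sum_any_single[of 0]) (auto simp: creatorD(3)[OF cr] lin_zero[OF creatorD(1)[OF cr]])
  then show ?thesis by (simp add: vertex_charged[OF sgn ch])
qed

end

abbreviation vacuum :: fock where "vacuum \<equiv> Poly_Mapping.single ({#}, {#}, 0, 0) 1"

text \<open>
  On the vacuum all oscillators and zero modes are trivial, so the mode of degree \<open>0\<close> of each summand is
  the charge shift alone, and the two summands lead to different charges.
\<close>

lemma X_minus_vacuum:
  assumes "p \<noteq> 0" "\<forall>n>0. p ^ n \<noteq> 1" "s\<^sup>2 = p"
  shows "Poly_Mapping.lookup (X_minus fock_scale p s (fock_a p) (fock_c p) fock_eQa fock_eQc 0 vacuum)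
    ({#}, {#}, -1, 1) = F_minus p"
proof -
  interpret F: osp_bosons fock_scale p "fock_a p" "fock_c p" fock_eQa fock_eQc s
    by (intro osp_bosons.intro osp_bosons_axioms.intro boson_oscillators_fock) (use assms in auto)
  have ch: "F.charged 0 0 vacuum" by (simp add: F.charged_def fock_single_simps)
  have vac: "fock_a p n vacuum = 0" "fock_c p n vacuum = 0" if "n > 0" for n
    using that by (simp_all add: fock_single_simps)
  have inv: "inv fock_eQa vacuum = Poly_Mapping.single ({#}, {#}, -1, 0) 1"
    "inv fock_eQc (Poly_Mapping.single (M, N, m, l) x) = Poly_Mapping.single (M, N, m, l - 1) x"
    "inv fock_eQa (Poly_Mapping.single (M, N, m, l) x) = Poly_Mapping.single (M, N, m - 1, l) x" for M N m l x
    by (rule inv_f_eq[OF bij_is_inj[OF bij_fock_eQa]] inv_f_eq[OF bij_is_inj[OF bij_fock_eQc]],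
        simp add: fock_single_simps)+
  have sh: "F.shift (-1) 1 vacuum = Poly_Mapping.single ({#}, {#}, -1, 1) 1"
    "F.shift (-1) (-1) vacuum = Poly_Mapping.single ({#}, {#}, -1, -1) 1"
    by (simp_all add: F.shift_def F.exp_charge_simps fock_single_simps inv)
  show ?thesis
    unfolding X_minus_def
    by (simp add: F.charged_vertex_vacuum[OF _ _ ch vac] sh lookup_fock_scale lookup_add lookup_single)
qed

text \<open>
  The real numbers above \<open>1\<close> are not roots of unity.
\<close>

lemma generic_near_one: "at (1::complex) within {q. \<forall>n>0. q ^ n \<noteq> 1} \<noteq> bot"
proof -
  have "\<exists>x\<in>{q. \<forall>n>0. q ^ n \<noteq> 1}. x \<noteq> (1::complex) \<and> dist x 1 < e" if e: "e > 0" for e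
  proof -
    let ?z = "of_real (1 + e / 2) :: complex"
    have "?z ^ n \<noteq> 1" if "n > 0" for n
    proof -
      have "(1 + e / 2) ^ n > 1" using e that by (simp add: one_less_power)
      then show ?thesis by (metis less_irrefl of_real_1 of_real_eq_iff of_real_power)
    qed
    moreover have "dist ?z 1 < e" "?z \<noteq> 1" using e by (simp_all add: dist_norm)
    ultimately show ?thesis by blast
  qed
  then show ?thesis
    unfolding trivial_limit_def eventually_at by blast
qed

text \<open>
  A limit \<open>L\<close> of the matrix element would give \<open>(q - q\<^sup>-\<^sup>1) F\<^sup>- = -1 \<longlongrightarrow> 0 \<cdot> L\<close>.
\<close>

lemma no_classical_limit:
  assumes rt: "\<forall>p. (rt p)\<^sup>2 = p"
  shows "\<not> has_classical_limit (\<lambda>p. X_minus fock_scale p (rt p) (fock_a p) (fock_c p) fock_eQa fock_eQc)"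
proof
  let ?F = "at (1::complex) within {q. \<forall>n>0. q ^ n \<noteq> 1}"
  let ?f = "\<lambda>p. Poly_Mapping.lookup (X_minus fock_scale p (rt p) (fock_a p) (fock_c p) fock_eQa fock_eQc 0 vacuum)
    ({#}, {#}, -1, 1)"
  assume "has_classical_limit (\<lambda>p. X_minus fock_scale p (rt p) (fock_a p) (fock_c p) fock_eQa fock_eQc)"
  then obtain L where L: "(?f \<longlongrightarrow> L) ?F" unfolding has_classical_limit_def by blast
  have "((\<lambda>p. (p - inverse p) * ?f p) \<longlongrightarrow> (1 - inverse 1) * L) ?F"
    by (intro tendsto_intros L) simp_all
  moreover have "\<forall>\<^sub>F p in ?F. (p - inverse p) * ?f p = -1"
  proof -
    have "\<forall>\<^sub>F p in ?F. p \<noteq> 0"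
      by (rule tendsto_imp_eventually_ne[OF tendsto_ident_at]) simp
    moreover have "\<forall>\<^sub>F p in ?F. \<forall>n>0. p ^ n \<noteq> 1" by (auto simp: eventually_at_filter)
    ultimately show ?thesis
    proof eventually_elim
      case (elim p)
      have "p ^ 2 \<noteq> 1" using elim(2) by simp
      then have "p - inverse p \<noteq> 0" using elim(1) by (auto simp: power2_eq_square field_simps)
      then show ?case using X_minus_vacuum[OF elim rt[rule_format]] by (simp add: F_minus_def)
    qed
  qed
  ultimately have "((\<lambda>p. -1) \<longlongrightarrow> (1 - inverse 1) * L) ?F"
    using Lim_transform_eventually by fast
  then have "(1 - inverse 1) * L = -1"
    using tendsto_unique[OF generic_near_one _ tendsto_const] by blast
  then show False by simp
qed

theorem theorem1:
  fixes scale :: "complex \<Rightarrow> 'v::ab_group_add \<Rightarrow> 'v"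
    and q r :: complex
    and a c :: "int \<Rightarrow> 'v \<Rightarrow> 'v"
    and eQa eQc :: "'v \<Rightarrow> 'v"
  assumes "q \<noteq> 0"
    and "\<forall>n>0. q ^ n \<noteq> 1"
    and "r\<^sup>2 = q"
    and "boson_oscillators scale q a c eQa eQc"
  shows "(\<exists>P. drinfeld_osp22 scale q r P
            (psi_plus scale q a) (psi_minus scale q a)
            (X_plus scale q r a c eQa eQc) (X_minus scale q r a c eQa eQc)) \<and>
         (\<forall>rt. (\<forall>p. (rt p)\<^sup>2 = p) \<longrightarrow>
            \<not> has_classical_limit (\<lambda>p. X_minus fock_scale p (rt p)
                 (fock_a p) (fock_c p) fock_eQa fock_eQc))"
proof -
  interpret osp_bosons scale q a c eQa eQc r
    by (intro osp_bosons.intro osp_bosons_axioms.intro assms) (use assms in auto)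
  show ?thesis using drinfeld_relations no_classical_limit by blast
qed

end
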